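(* Let $(M,g,J)$ be a non-Kähler BHE (Bismut Hermite-Einstein) manifold with Bismut connection $\nabla$, and let $V$ be a non-vanishing vector field on $M$ such that $V$ and $JV$ are $\nabla$-parallel and $\mathcal L_VJ=\mathcal L_{JV}J=0$. Then there exists a locally defined Riemannian submersion $\pi\colon M\to N$ along the distribution spanned by $\{V, JV\}$ (i.e. the fibers are tangent to this distribution). Moreover $J$ projects to an integrable complex structure $\check J$ on $N$ such that the Bismut connection $\check\nabla$ on $(N, g_N,\check{J})$ and the Bismut connection $\nabla$ on $(M,g,J)$ are related via $$\check\nabla_XY=\pi_*(\nabla_{\overline{X}}\overline{Y}),$$ where $\overline X,\overline Y$ are the horizontal lifts of vector fields $X,Y$ on $N$.
   Context: For a Hermitian manifold $(M,g,J)$ the Bismut connection is the unique connection $\nabla$ with $\nabla g=0$, $\nabla J=0$ and totally skew-symmetric torsion $T(X,Y,Z)=g(\nabla_XY-\nabla_YX-[X,Y],Z)$. The manifold is SKT if $\mathrm dT=0$. An SKT manifold $(M^{2n},g,J)$ is BHE if $$\rho^B(X,Y)=\frac 12\sum_{i=1}^{2n}R^B(X,Y,Je_i,e_i)=0,$$ where $\{e_i\}$ is an orthonormal frame and $R^B$ is the curvature tensor of the Bismut connection. In the paper, $V$ is the vector field with the stated properties whose existence on non-Kähler BHE manifolds is taken from earlier work (Apostolov–Barbaro–Lee–Streets). "Locally defined" means: every point has an open neighborhood $U$ with such a Riemannian submersion $\pi\colon (U,g)\to(N,g_N)$. $J$ projects to $\check J$ if $g(J\overline X,\overline Y)=g_N(\check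 JX,Y)$ for all tangent vectors $X,Y$ of $N$ at a common point and their horizontal lifts at any point of the fiber. *)

theory Defs
  imports "HOL-Analysis.Analysis" "HOL-Library.Function_Algebras"
begin

section \<open>Smooth manifolds\<close>

text \<open>All sets \<^term>\<open>S\<close> on which differentiability is considered are open, so the derivative
  at \<^term>\<open>x\<close> is unrestricted.  For a finite-dimensional domain \<open>Ck_on k S f\<close> says that \<open>f\<close> is of
  class \<open>C\<^sup>k\<close> on \<open>S\<close>.\<close>

primrec Ck_on :: "nat \<Rightarrow> 'e::euclidean_space set \<Rightarrow> ('e \<Rightarrow> 'b::real_normed_vector) \<Rightarrow> bool" where
  "Ck_on 0 S f \<longleftrightarrow> continuous_on S f"
| "Ck_on (Suc k) S f \<longleftrightarrow>
     (\<exists>f'. (\<forall>x\<in>S. (f has_derivative f' x) (at x)) \<and> (\<forall>v. Ck_on k S (\<lambda>x. f' x v)))"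

definition smooth_on :: "'e::euclidean_space set \<Rightarrow> ('e \<Rightarrow> 'b::real_normed_vector) \<Rightarrow> bool" where
  "smooth_on S f \<longleftrightarrow> (\<forall>k. Ck_on k S f)"

text \<open>A manifold modelled on the Euclidean space \<open>'e\<close>, of real dimension \<open>DIM('e)\<close>; its points
  form the set \<open>topspace (mtop M)\<close>.  A chart is a pair of a domain and a coordinate map; the atlas
  need not be maximal.\<close>

record ('a, 'e) mfd =
  mtop :: "'a topology"
  atlas :: "('a set \<times> ('a \<Rightarrow> 'e)) set"

definition smooth_manifold :: "('a, 'e::euclidean_space) mfd \<Rightarrow> bool" where
  "smooth_manifold M \<longleftrightarrow>
     Hausdorff_space (mtop M) \<and> second_countable (mtop M) \<and>
     (\<forall>(C, \<phi>) \<in> atlas M. openin (mtop M) C \<and> open (\<phi> ` C) \<and>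
        homeomorphic_map (subtopology (mtop M) C) (top_of_set (\<phi> ` C)) \<phi>) \<and>
     (\<Union>(C, \<phi>) \<in> atlas M. C) = topspace (mtop M) \<and>
     (\<forall>(C, \<phi>) \<in> atlas M. \<forall>(D, \<psi>) \<in> atlas M.
        smooth_on (\<phi> ` (C \<inter> D)) (\<psi> \<circ> inv_into C \<phi>))"

definition smooth_fun :: "('a, 'e::euclidean_space) mfd \<Rightarrow> 'a set \<Rightarrow> ('a \<Rightarrow> real) \<Rightarrow> bool" where
  "smooth_fun M U f \<longleftrightarrow> openin (mtop M) U \<and>
     (\<forall>(C, \<phi>) \<in> atlas M. smooth_on (\<phi> ` (C \<inter> U)) (f \<circ> inv_into C \<phi>))"

definition smooth_map ::
  "('a, 'e::euclidean_space) mfd \<Rightarrow> 'a set \<Rightarrow> ('b, 'f::euclidean_space) mfd \<Rightarrow> ('a \<Rightarrow> 'b) \<Rightarrow> bool" where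
  "smooth_map M U N \<pi> \<longleftrightarrow> openin (mtop M) U \<and>
     continuous_map (subtopology (mtop M) U) (mtop N) \<pi> \<and>
     (\<forall>(C, \<phi>) \<in> atlas M. \<forall>(D, \<psi>) \<in> atlas N.
        smooth_on (\<phi> ` (C \<inter> U \<inter> \<pi> -` D)) (\<psi> \<circ> \<pi> \<circ> inv_into C \<phi>))"

text \<open>Tangent vectors at \<open>p\<close> are derivations of the functions that are smooth near \<open>p\<close>.  As HOL
  functions are total, a derivation is normalised to be \<open>0\<close> on functions that are not smooth near
  \<open>p\<close>.  The Leibniz rule makes it depend only on germs, so for open \<open>U\<close> no distinction
  between tangent vectors of \<open>U\<close> and of \<open>M\<close> is needed.\<close>

type_synonym 'a tvec = "('a \<Rightarrow> real) \<Rightarrow> real"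
type_synonym 'a vfield = "'a \<Rightarrow> 'a tvec"

definition smooth_near :: "('a, 'e::euclidean_space) mfd \<Rightarrow> 'a \<Rightarrow> ('a \<Rightarrow> real) \<Rightarrow> bool" where
  "smooth_near M p f \<longleftrightarrow> (\<exists>U. p \<in> U \<and> smooth_fun M U f)"

definition tangent_space :: "('a, 'e::euclidean_space) mfd \<Rightarrow> 'a \<Rightarrow> 'a tvec set" where
  "tangent_space M p = {v.
     (\<forall>f. \<not> smooth_near M p f \<longrightarrow> v f = 0) \<and>
     (\<forall>f h a b. smooth_near M p f \<and> smooth_near M p h \<longrightarrow>
        v (\<lambda>x. a * f x + b * h x) = a * v f + b * v h \<and>
        v (\<lambda>x. f x * h x) = f p * v h + h p * v f)}"

text \<open>Sums, differences and zero of tangent vectors and of vector fields are the pointwise ones of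
  \<^theory>\<open>HOL-Library.Function_Algebras\<close>.\<close>

definition tscale :: "real \<Rightarrow> 'a tvec \<Rightarrow> 'a tvec" where
  "tscale c v = (\<lambda>f. c * v f)"

definition fscale :: "('a \<Rightarrow> real) \<Rightarrow> 'a vfield \<Rightarrow> 'a vfield" where
  "fscale h X = (\<lambda>p. tscale (h p) (X p))"

text \<open>Smooth vector fields over an open set \<open>U\<close>; the values outside \<open>U\<close> are arbitrary.\<close>

definition smooth_vf :: "('a, 'e::euclidean_space) mfd \<Rightarrow> 'a set \<Rightarrow> 'a vfield \<Rightarrow> bool" where
  "smooth_vf M U X \<longleftrightarrow> openin (mtop M) U \<and> (\<forall>p\<in>U. X p \<in> tangent_space M p) \<and>
     (\<forall>W f. W \<subseteq> U \<and> smooth_fun M W f \<longrightarrow> smooth_fun M W (\<lambda>p. X p f))"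

definition lie_bracket ::
  "('a, 'e::euclidean_space) mfd \<Rightarrow> 'a vfield \<Rightarrow> 'a vfield \<Rightarrow> 'a vfield" where
  "lie_bracket M X Y p f =
     (if smooth_near M p f then X p (\<lambda>q. Y q f) - Y p (\<lambda>q. X q f) else 0)"

definition pushforward ::
  "('b, 'f::euclidean_space) mfd \<Rightarrow> ('a \<Rightarrow> 'b) \<Rightarrow> 'a \<Rightarrow> 'a tvec \<Rightarrow> 'b tvec" where
  "pushforward N \<pi> p v = (\<lambda>f. if smooth_near N (\<pi> p) f then v (f \<circ> \<pi>) else 0)"

text \<open>A \<open>k\<close>-form is given by its values on lists of \<open>k\<close> vector fields, and its exterior derivative
  by
  \<open>d\<omega>(X\<^sub>0,\<dots>,X\<^sub>k) = (\<Sum>i. (-1)\<^sup>i X\<^sub>i(\<omega>(\<dots>,X\<^sub>i omitted,\<dots>)))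
     + (\<Sum>i<j. (-1)\<^sup>i\<^sup>+\<^sup>j \<omega>([X\<^sub>i,X\<^sub>j],\<dots>,X\<^sub>i and X\<^sub>j omitted,\<dots>))\<close>.\<close>

definition omit :: "nat \<Rightarrow> 'b list \<Rightarrow> 'b list" where
  "omit i xs = take i xs @ drop (Suc i) xs"

definition ext_deriv :: "('a, 'e::euclidean_space) mfd \<Rightarrow>
    ('a vfield list \<Rightarrow> 'a \<Rightarrow> real) \<Rightarrow> 'a vfield list \<Rightarrow> 'a \<Rightarrow> real" where
  "ext_deriv M \<omega> Xs p =
     (\<Sum>i<length Xs. (- 1) ^ i * (Xs ! i) p (\<omega> (omit i Xs))) +
     (\<Sum>j<length Xs. \<Sum>i<j. (- 1) ^ (i + j) *
        \<omega> (lie_bracket M (Xs ! i) (Xs ! j) # omit i (omit j Xs)) p)"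

definition closed_form ::
  "('a, 'e::euclidean_space) mfd \<Rightarrow> nat \<Rightarrow> ('a vfield list \<Rightarrow> 'a \<Rightarrow> real) \<Rightarrow> bool" where
  "closed_form M k \<omega> \<longleftrightarrow>
     (\<forall>U Xs. length Xs = Suc k \<and> (\<forall>X \<in> set Xs. smooth_vf M U X) \<longrightarrow>
        (\<forall>p\<in>U. ext_deriv M \<omega> Xs p = 0))"

section \<open>Hermitian manifolds\<close>

type_synonym 'a metric_tensor = "'a \<Rightarrow> 'a tvec \<Rightarrow> 'a tvec \<Rightarrow> real"
type_synonym 'a endo_field = "'a \<Rightarrow> 'a tvec \<Rightarrow> 'a tvec"

definition riemannian_metric ::
  "('a, 'e::euclidean_space) mfd \<Rightarrow> 'a metric_tensor \<Rightarrow> bool" where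
  "riemannian_metric M g \<longleftrightarrow>
     (\<forall>p \<in> topspace (mtop M). \<forall>u \<in> tangent_space M p. \<forall>v \<in> tangent_space M p.
        g p u v = g p v u \<and> (u \<noteq> 0 \<longrightarrow> g p u u > 0) \<and>
        (\<forall>w \<in> tangent_space M p. \<forall>a b.
           g p (tscale a u + tscale b v) w = a * g p u w + b * g p v w)) \<and>
     (\<forall>U X Y. smooth_vf M U X \<and> smooth_vf M U Y \<longrightarrow> smooth_fun M U (\<lambda>p. g p (X p) (Y p)))"

definition endo_app :: "'a endo_field \<Rightarrow> 'a vfield \<Rightarrow> 'a vfield" where
  "endo_app J X = (\<lambda>p. J p (X p))"

definition almost_complex_structure ::
  "('a, 'e::euclidean_space) mfd \<Rightarrow> 'a endo_field \<Rightarrow> bool" where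
  "almost_complex_structure M J \<longleftrightarrow>
     (\<forall>p \<in> topspace (mtop M). \<forall>u \<in> tangent_space M p.
        J p u \<in> tangent_space M p \<and> J p (J p u) = - u \<and>
        (\<forall>v \<in> tangent_space M p. \<forall>a b.
           J p (tscale a u + tscale b v) = tscale a (J p u) + tscale b (J p v))) \<and>
     (\<forall>U X. smooth_vf M U X \<longrightarrow> smooth_vf M U (endo_app J X))"

text \<open>Integrability means that the Nijenhuis tensor vanishes.\<close>

definition nijenhuis ::
  "('a, 'e::euclidean_space) mfd \<Rightarrow> 'a endo_field \<Rightarrow> 'a vfield \<Rightarrow> 'a vfield \<Rightarrow> 'a vfield" where
  "nijenhuis M J X Y =
     lie_bracket M (endo_app J X) (endo_app J Y)
     - endo_app J (lie_bracket M (endo_app J X) Y)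
     - endo_app J (lie_bracket M X (endo_app J Y))
     - lie_bracket M X Y"

definition integrable_complex_structure ::
  "('a, 'e::euclidean_space) mfd \<Rightarrow> 'a endo_field \<Rightarrow> bool" where
  "integrable_complex_structure M J \<longleftrightarrow> almost_complex_structure M J \<and>
     (\<forall>U X Y. smooth_vf M U X \<and> smooth_vf M U Y \<longrightarrow> (\<forall>p\<in>U. nijenhuis M J X Y p = 0))"

definition hermitian_manifold ::
  "('a, 'e::euclidean_space) mfd \<Rightarrow> 'a metric_tensor \<Rightarrow> 'a endo_field \<Rightarrow> bool" where
  "hermitian_manifold M g J \<longleftrightarrow>
     smooth_manifold M \<and> riemannian_metric M g \<and> integrable_complex_structure M J \<and>
     (\<forall>p \<in> topspace (mtop M). \<forall>u \<in> tangent_space M p. \<forall>v \<in> tangent_space M p.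
        g p (J p u) (J p v) = g p u v)"

definition fundamental_form ::
  "'a metric_tensor \<Rightarrow> 'a endo_field \<Rightarrow> 'a vfield list \<Rightarrow> 'a \<Rightarrow> real" where
  "fundamental_form g J Xs p = g p (J p ((Xs ! 0) p)) ((Xs ! 1) p)"

definition kaehler ::
  "('a, 'e::euclidean_space) mfd \<Rightarrow> 'a metric_tensor \<Rightarrow> 'a endo_field \<Rightarrow> bool" where
  "kaehler M g J \<longleftrightarrow> hermitian_manifold M g J \<and> closed_form M 2 (fundamental_form g J)"

definition lie_deriv_endo ::
  "('a, 'e::euclidean_space) mfd \<Rightarrow> 'a vfield \<Rightarrow> 'a endo_field \<Rightarrow> 'a vfield \<Rightarrow> 'a vfield" where
  "lie_deriv_endo M V J X = lie_bracket M V (endo_app J X) - endo_app J (lie_bracket M V X)"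

section \<open>The Bismut connection\<close>

text \<open>A connection acts on vector fields defined over any open set \<open>U\<close>.  Tensoriality and the
  Leibniz rule over every \<open>U\<close> (with functions such as indicator functions of the complement of \<open>U\<close>)
  imply that \<open>nab X Y\<close> depends on \<open>U\<close> only on the restrictions of \<open>X\<close> and \<open>Y\<close> to \<open>U\<close>, i.e. \<open>nab\<close> is
  an ordinary affine connection together with its restrictions to open subsets.\<close>

type_synonym 'a conn = "'a vfield \<Rightarrow> 'a vfield \<Rightarrow> 'a vfield"

definition affine_connection :: "('a, 'e::euclidean_space) mfd \<Rightarrow> 'a conn \<Rightarrow> bool" where
  "affine_connection M nab \<longleftrightarrow>
     (\<forall>U X Y Z h. smooth_vf M U X \<and> smooth_vf M U Y \<and> smooth_vf M U Z \<and> smooth_fun M U h \<longrightarrow>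
        smooth_vf M U (nab X Y) \<and>
        (\<forall>p\<in>U.
           nab (X + Y) Z p = nab X Z p + nab Y Z p \<and>
           nab (fscale h X) Y p = tscale (h p) (nab X Y p) \<and>
           nab X (Y + Z) p = nab X Y p + nab X Z p \<and>
           nab X (fscale h Y) p = tscale (X p h) (Y p) + tscale (h p) (nab X Y p)))"

definition torsion ::
  "('a, 'e::euclidean_space) mfd \<Rightarrow> 'a conn \<Rightarrow> 'a vfield \<Rightarrow> 'a vfield \<Rightarrow> 'a vfield" where
  "torsion M nab X Y = nab X Y - nab Y X - lie_bracket M X Y"

definition torsion_form :: "('a, 'e::euclidean_space) mfd \<Rightarrow> 'a metric_tensor \<Rightarrow> 'a conn \<Rightarrow>
    'a vfield list \<Rightarrow> 'a \<Rightarrow> real" where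
  "torsion_form M g nab Xs p = g p (torsion M nab (Xs ! 0) (Xs ! 1) p) ((Xs ! 2) p)"

definition curvature ::
  "('a, 'e::euclidean_space) mfd \<Rightarrow> 'a conn \<Rightarrow> 'a vfield \<Rightarrow> 'a vfield \<Rightarrow> 'a vfield \<Rightarrow> 'a vfield" where
  "curvature M nab X Y Z = nab X (nab Y Z) - nab Y (nab X Z) - nab (lie_bracket M X Y) Z"

definition parallel :: "('a, 'e::euclidean_space) mfd \<Rightarrow> 'a conn \<Rightarrow> 'a vfield \<Rightarrow> bool" where
  "parallel M nab Y \<longleftrightarrow> (\<forall>U X. smooth_vf M U X \<longrightarrow> (\<forall>p\<in>U. nab X Y p = 0))"

definition bismut_connection ::
  "('a, 'e::euclidean_space) mfd \<Rightarrow> 'a metric_tensor \<Rightarrow> 'a endo_field \<Rightarrow> 'a conn \<Rightarrow> bool" where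
  "bismut_connection M g J nab \<longleftrightarrow> affine_connection M nab \<and>
     (\<forall>U X Y Z. smooth_vf M U X \<and> smooth_vf M U Y \<and> smooth_vf M U Z \<longrightarrow>
        (\<forall>p\<in>U.
           X p (\<lambda>q. g q (Y q) (Z q)) = g p (nab X Y p) (Z p) + g p (Y p) (nab X Z p) \<and>
           nab X (endo_app J Y) p = J p (nab X Y p) \<and>
           torsion_form M g nab [X, Y, Z] p = - torsion_form M g nab [Y, X, Z] p \<and>
           torsion_form M g nab [X, Y, Z] p = - torsion_form M g nab [X, Z, Y] p))"

definition skt ::
  "('a, 'e::euclidean_space) mfd \<Rightarrow> 'a metric_tensor \<Rightarrow> 'a endo_field \<Rightarrow> 'a conn \<Rightarrow> bool" where
  "skt M g J nab \<longleftrightarrow> hermitian_manifold M g J \<and> bismut_connection M g J nab \<and>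
     closed_form M 3 (torsion_form M g nab)"

text \<open>With \<open>DIM('e) = 2n\<close> many vector fields, an orthonormal family is a frame.\<close>

definition orthonormal_frame :: "('a, 'e::euclidean_space) mfd \<Rightarrow> 'a metric_tensor \<Rightarrow> 'a set \<Rightarrow>
    (nat \<Rightarrow> 'a vfield) \<Rightarrow> bool" where
  "orthonormal_frame M g U e \<longleftrightarrow>
     (\<forall>i\<in>{1..DIM('e)}. smooth_vf M U (e i)) \<and>
     (\<forall>p\<in>U. \<forall>i\<in>{1..DIM('e)}. \<forall>j\<in>{1..DIM('e)}.
        g p (e i p) (e j p) = (if i = j then 1 else 0))"

definition bismut_ricci :: "('a, 'e::euclidean_space) mfd \<Rightarrow> 'a metric_tensor \<Rightarrow> 'a endo_field \<Rightarrow>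
    'a conn \<Rightarrow> (nat \<Rightarrow> 'a vfield) \<Rightarrow> 'a vfield \<Rightarrow> 'a vfield \<Rightarrow> 'a \<Rightarrow> real" where
  "bismut_ricci M g J nab e X Y p =
     (1 / 2) * (\<Sum>i = 1..DIM('e). g p (curvature M nab X Y (endo_app J (e i)) p) (e i p))"

definition bhe ::
  "('a, 'e::euclidean_space) mfd \<Rightarrow> 'a metric_tensor \<Rightarrow> 'a endo_field \<Rightarrow> 'a conn \<Rightarrow> bool" where
  "bhe M g J nab \<longleftrightarrow> skt M g J nab \<and>
     (\<forall>U e X Y. orthonormal_frame M g U e \<and> smooth_vf M U X \<and> smooth_vf M U Y \<longrightarrow>
        (\<forall>p\<in>U. bismut_ricci M g J nab e X Y p = 0))"

section \<open>Riemannian submersions\<close>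

definition vertical_space :: "('a, 'e::euclidean_space) mfd \<Rightarrow> ('b, 'f::euclidean_space) mfd \<Rightarrow>
    ('a \<Rightarrow> 'b) \<Rightarrow> 'a \<Rightarrow> 'a tvec set" where
  "vertical_space M N \<pi> p = {v \<in> tangent_space M p. pushforward N \<pi> p v = 0}"

definition horizontal_space :: "('a, 'e::euclidean_space) mfd \<Rightarrow> 'a metric_tensor \<Rightarrow>
    ('b, 'f::euclidean_space) mfd \<Rightarrow> ('a \<Rightarrow> 'b) \<Rightarrow> 'a \<Rightarrow> 'a tvec set" where
  "horizontal_space M g N \<pi> p =
     {v \<in> tangent_space M p. \<forall>w \<in> vertical_space M N \<pi> p. g p v w = 0}"

text \<open>A Riemannian submersion, defined on the open subset \<open>U\<close> of \<open>M\<close>, onto \<open>N\<close>.\<close>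

definition riemannian_submersion :: "('a, 'e::euclidean_space) mfd \<Rightarrow> 'a metric_tensor \<Rightarrow> 'a set \<Rightarrow>
    ('b, 'f::euclidean_space) mfd \<Rightarrow> 'b metric_tensor \<Rightarrow> ('a \<Rightarrow> 'b) \<Rightarrow> bool" where
  "riemannian_submersion M g U N gN \<pi> \<longleftrightarrow>
     smooth_map M U N \<pi> \<and> \<pi> ` U = topspace (mtop N) \<and>
     (\<forall>p\<in>U. pushforward N \<pi> p ` tangent_space M p = tangent_space N (\<pi> p) \<and>
        (\<forall>v \<in> horizontal_space M g N \<pi> p. \<forall>w \<in> horizontal_space M g N \<pi> p.
           gN (\<pi> p) (pushforward N \<pi> p v) (pushforward N \<pi> p w) = g p v w))"

definition is_horizontal_lift :: "('a, 'e::euclidean_space) mfd \<Rightarrow> 'a metric_tensor \<Rightarrow>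
    ('b, 'f::euclidean_space) mfd \<Rightarrow> ('a \<Rightarrow> 'b) \<Rightarrow> 'a \<Rightarrow> 'b tvec \<Rightarrow> 'a tvec \<Rightarrow> bool" where
  "is_horizontal_lift M g N \<pi> p x v \<longleftrightarrow>
     v \<in> horizontal_space M g N \<pi> p \<and> pushforward N \<pi> p v = x"

definition is_horizontal_lift_vf :: "('a, 'e::euclidean_space) mfd \<Rightarrow> 'a metric_tensor \<Rightarrow> 'a set \<Rightarrow>
    ('b, 'f::euclidean_space) mfd \<Rightarrow> ('a \<Rightarrow> 'b) \<Rightarrow> 'b set \<Rightarrow> 'b vfield \<Rightarrow> 'a vfield \<Rightarrow> bool" where
  "is_horizontal_lift_vf M g U N \<pi> W X Xb \<longleftrightarrow>
     (\<forall>p \<in> U \<inter> \<pi> -` W. is_horizontal_lift M g N \<pi> p (X (\<pi> p)) (Xb p))"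

definition projects_to :: "('a, 'e::euclidean_space) mfd \<Rightarrow> 'a metric_tensor \<Rightarrow> 'a endo_field \<Rightarrow>
    'a set \<Rightarrow> ('b, 'f::euclidean_space) mfd \<Rightarrow> 'b metric_tensor \<Rightarrow> 'b endo_field \<Rightarrow> ('a \<Rightarrow> 'b) \<Rightarrow>
    bool" where
  "projects_to M g J U N gN JN \<pi> \<longleftrightarrow>
     (\<forall>p\<in>U. \<forall>x \<in> tangent_space N (\<pi> p). \<forall>y \<in> tangent_space N (\<pi> p). \<forall>xb yb.
        is_horizontal_lift M g N \<pi> p x xb \<and> is_horizontal_lift M g N \<pi> p y yb \<longrightarrow>
        g p (J p xb) yb = gN (\<pi> p) (JN (\<pi> p) x) y)"

end

theory Submission
  imports Defs
begin

text \<open>Put \<open>W = JV\<close>.  Since \<open>L\<^sub>VJ = 0\<close>, the fields \<open>V\<close> and \<open>W\<close> commute, and their joint flow gives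
  coordinates \<open>U \<cong> K \<times> B\<close> in which they are the two coordinate fields of \<open>K \<subseteq> \<real>\<^sup>2\<close>; the quotient \<open>N\<close>
  is the ball \<open>B\<close>.  A parallel field \<open>\<xi>\<close> of a metric connection with skew-symmetric torsion is
      Killing,
  hence \<open>[\<xi>,X] = 0\<close> for the horizontal lift \<open>X\<close> of a field on \<open>N\<close> and \<open>\<xi> \<in> {V,W}\<close>.  A horizontal
      field
  on \<open>U\<close> is such a lift if and only if it commutes with \<open>V\<close> and \<open>W\<close>.  Therefore \<open>g\<close> descends to
      \<open>N\<close>, and so
  does \<open>J\<close>, because \<open>V\<close> and \<open>W\<close> preserve it.  For lifts \<open>X, Y, Z\<close> the Koszul formula expresses
  \<open>g(\<nabla>\<^sub>XY,Z)\<close> by the metric, brackets and \<open>T(X,Y,Z)\<close>, which is constant along the fibres, as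
  \<open>L\<^sub>\<xi>T = d(\<iota>\<^sub>\<xi>T) + \<iota>\<^sub>\<xi>dT = 0\<close>.  So \<open>\<nabla>\<^sub>XY\<close>, which is horizontal since \<open>V\<close> and \<open>W\<close> are parallel, is
      itself
  a lift, and what it projects to is the Bismut connection of \<open>N\<close>.\<close>



subsection \<open>Calculus of smooth functions\<close>

text \<open>The inverse function theorem is applied to the map that flows out of a slice transversal
  to \<open>V\<close> and \<open>W\<close>, so the flow has to depend smoothly on its starting point
  and not only on time. Invariance is only ever obtained as a vanishing derivative along
  \<open>V\<close> and \<open>W\<close>; it becomes constancy because the fibres of the box are
  discs. Hence every structure on \<open>N\<close> can be defined by evaluation on the central
  slice.

  For \<open>A = \<nabla>\<^sub>XY\<close> the criterion for being a lift is verified by duality.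
  The bracket \<open>[\<xi>,A]\<close> is horizontal, and its product with a lift \<open>Z\<close>
  equals \<open>\<xi>(g(A,Z)) = 0\<close>; the choice of a \<open>Z\<close> that takes the value
  \<open>[\<xi>,A]\<close> at the given point forces this bracket to have length zero.

  Brackets of lifts have vertical components in general. Brackets, torsion and Nijenhuis tensors are
  therefore compared only after projection, and \<open>J\<close> has to commute with the projection
  on all tangent vectors, not only on the horizontal ones.\<close>

lemma Ck_on_cong:
  assumes "open S" "\<And>x. x \<in> S \<Longrightarrow> f x = h x"
  shows "Ck_on k S f \<longleftrightarrow> Ck_on k S h"
proof (cases k)
  case 0
  then show ?thesis using assms by (simp cong: continuous_on_cong)
next
  case (Suc m)
  have "(f has_derivative f' x) (at x) \<longleftrightarrow> (h has_derivative f' x) (at x)" if "x \<in> S" for f' x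
    using assms that has_derivative_transform_within_open by (metis (no_types, lifting))
  then show ?thesis using Suc by (auto simp: Ball_def)
qed

text \<open>Derivatives are unique, so the existential witness in \<open>Ck_on\<close> may be
  replaced by the canonical \<open>frechet_derivative\<close>. With a canonical derivative local
  regularity can be glued, as in \<open>Ck_on_local\<close>.\<close>

lemma Ck_on_Suc_iff:
  assumes "open S"
  shows "Ck_on (Suc k) S f \<longleftrightarrow>
    (\<forall>x\<in>S. f differentiable at x) \<and> (\<forall>v. Ck_on k S (\<lambda>x. frechet_derivative f (at x) v))"
    (is "?L \<longleftrightarrow> ?R")
proof
  assume ?L
  then obtain f' where f': "\<And>x. x \<in> S \<Longrightarrow> (f has_derivative f' x) (at x)"
    and C: "\<And>v. Ck_on k S (\<lambda>x. f' x v)" by auto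
  have eq: "frechet_derivative f (at x) = f' x" if "x \<in> S" for x
    using f'[OF that] by (metis frechet_derivative_at)
  have "Ck_on k S (\<lambda>x. frechet_derivative f (at x) v)" for v
    using C[of v] by (subst Ck_on_cong[OF assms, of _ "\<lambda>x. f' x v"]) (auto simp: eq)
  then show ?R using f' differentiable_def by blast
next
  assume ?R then show ?L
    using frechet_derivative_works by (auto intro!: exI[of _ "\<lambda>x. frechet_derivative f (at x)"])
qed

lemma Ck_on_SucI:
  assumes "\<And>x. x \<in> S \<Longrightarrow> (f has_derivative f' x) (at x)" "\<And>v. Ck_on k S (\<lambda>x. f' x v)"
  shows "Ck_on (Suc k) S f"
  using assms by auto

lemma Ck_on_SucE:
  assumes "Ck_on (Suc k) S f"
  obtains f' where "\<And>x. x \<in> S \<Longrightarrow> (f has_derivative f' x) (at x)" "\<And>v. Ck_on k S (\<lambda>x. f' x v)"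
  using assms by auto

lemma Ck_on_SucD: "Ck_on (Suc k) S f \<Longrightarrow> Ck_on k S f"
proof (induction k arbitrary: f)
  case 0
  then obtain f' where "\<And>x. x \<in> S \<Longrightarrow> (f has_derivative f' x) (at x)" by (rule Ck_on_SucE) blast
  then show ?case
    using has_derivative_continuous continuous_at_imp_continuous_on by (metis Ck_on.simps(1))
next
  case (Suc k)
  from Suc.prems obtain f' where "\<And>x. x \<in> S \<Longrightarrow> (f has_derivative f' x) (at x)"
    and "\<And>v. Ck_on (Suc k) S (\<lambda>x. f' x v)" by (rule Ck_on_SucE) blast
  then show ?case using Suc.IH by (intro Ck_on_SucI[of _ _ f']) auto
qed

lemma Ck_on_mono: "Ck_on m S f \<Longrightarrow> k \<le> m \<Longrightarrow> Ck_on k S f"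
proof (induction m)
  case (Suc m)
  then show ?case using Ck_on_SucD[OF Suc.prems(1)] by (cases "k = Suc m") auto
qed simp

lemma Ck_on_continuous: "Ck_on k S f \<Longrightarrow> continuous_on S f"
  using Ck_on_mono[of k S f 0] by simp

lemma Ck_on_subset: "Ck_on k S f \<Longrightarrow> T \<subseteq> S \<Longrightarrow> Ck_on k T f"
proof (induction k arbitrary: f)
  case (Suc k)
  from Suc.prems(1) obtain f' where f': "\<And>x. x \<in> S \<Longrightarrow> (f has_derivative f' x) (at x)"
    "\<And>v. Ck_on k S (\<lambda>x. f' x v)" by (rule Ck_on_SucE) blast
  show ?case
    by (rule Ck_on_SucI[of _ _ f']) (use f' Suc.prems(2) Suc.IH in blast)+
qed (simp add: continuous_on_subset)

lemma Ck_on_local: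
  assumes "open S" "\<And>x. x \<in> S \<Longrightarrow> \<exists>T. open T \<and> x \<in> T \<and> Ck_on k (S \<inter> T) f"
  shows "Ck_on k S f"
  using assms
proof (induction k arbitrary: f)
  case 0
  have "continuous (at x) f" if x: "x \<in> S" for x
    using 0(2)[OF x] 0(1) x continuous_on_eq_continuous_at[of "S \<inter> _" f] by auto
  then show ?case by (simp add: continuous_at_imp_continuous_on)
next
  case (Suc k)
  show ?case unfolding Ck_on_Suc_iff[OF Suc.prems(1)]
  proof (intro conjI ballI allI)
    fix x assume x: "x \<in> S"
    then obtain T where T: "open T" "x \<in> T" "Ck_on (Suc k) (S \<inter> T) f" using Suc.prems(2) by blast
    have o: "open (S \<inter> T)" using T(1) Suc.prems(1) by blast
    from T(3) show "f differentiable at x"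
      unfolding Ck_on_Suc_iff[OF o] using T(2) x by blast
  next
    fix v show "Ck_on k S (\<lambda>x. frechet_derivative f (at x) v)"
    proof (rule Suc.IH[OF Suc.prems(1)])
      fix x assume x: "x \<in> S"
      then obtain T where T: "open T" "x \<in> T" "Ck_on (Suc k) (S \<inter> T) f" using Suc.prems(2) by blast
      have o: "open (S \<inter> T)" using T(1) Suc.prems(1) by blast
      from T(3) have "Ck_on k (S \<inter> T) (\<lambda>x. frechet_derivative f (at x) v)"
        unfolding Ck_on_Suc_iff[OF o] by blast
      then show "\<exists>T. open T \<and> x \<in> T \<and> Ck_on k (S \<inter> T) (\<lambda>x. frechet_derivative f (at x) v)"
        using T by blast
    qed
  qed
qed

lemma Ck_on_const: "Ck_on k S (\<lambda>x. c)"
proof (induction k arbitrary: c)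
  case (Suc k)
  show ?case by (rule Ck_on_SucI[of _ _ "\<lambda>x v. 0"]) (auto intro: Suc)
qed auto

lemma Ck_on_bounded_linear:
  assumes "bounded_linear h" "Ck_on k S f"
  shows "Ck_on k S (\<lambda>x. h (f x))"
  using assms(2)
proof (induction k arbitrary: f)
  case 0 then show ?case
    using bounded_linear.continuous_on[OF assms(1)] by simp
next
  case (Suc k)
  from Suc.prems obtain f' where f': "\<And>x. x \<in> S \<Longrightarrow> (f has_derivative f' x) (at x)"
    "\<And>v. Ck_on k S (\<lambda>x. f' x v)" by (rule Ck_on_SucE) blast
  show ?case
    by (rule Ck_on_SucI[of _ _ "\<lambda>x v. h (f' x v)"])
      (auto intro: Suc.IH f' bounded_linear.has_derivative[OF assms(1)])
qed

lemma Ck_on_linear: "bounded_linear h \<Longrightarrow> Ck_on k S h"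
proof (cases k)
  case (Suc m)
  assume h: "bounded_linear h"
  show ?thesis unfolding Suc
    by (rule Ck_on_SucI[of _ _ "\<lambda>_. h"]) (auto intro: Ck_on_const
        bounded_linear_imp_has_derivative h)
qed (auto intro: linear_continuous_on)

lemma Ck_on_id: "Ck_on k S (\<lambda>x. x)"
  by (rule Ck_on_linear) (rule bounded_linear_ident)

lemma Ck_on_add:
  assumes "Ck_on k S f" "Ck_on k S h"
  shows "Ck_on k S (\<lambda>x. f x + h x)"
  using assms
proof (induction k arbitrary: f h)
  case 0 then show ?case by (simp add: continuous_on_add)
next
  case (Suc k)
  from Suc.prems(1) obtain f' where f': "\<And>x. x \<in> S \<Longrightarrow> (f has_derivative f' x) (at x)"
    "\<And>v. Ck_on k S (\<lambda>x. f' x v)" by (rule Ck_on_SucE) blast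
  from Suc.prems(2) obtain h' where h': "\<And>x. x \<in> S \<Longrightarrow> (h has_derivative h' x) (at x)"
    "\<And>v. Ck_on k S (\<lambda>x. h' x v)" by (rule Ck_on_SucE) blast
  show ?case
    by (rule Ck_on_SucI[of _ _ "\<lambda>x v. f' x v + h' x v"])
      (rule has_derivative_add Suc.IH f' h' | assumption)+
qed

lemma Ck_on_sum: "(\<And>i. i \<in> I \<Longrightarrow> Ck_on k S (f i)) \<Longrightarrow> Ck_on k S (\<lambda>x. \<Sum>i\<in>I. f i x)"
  by (induction I rule: infinite_finite_induct) (auto intro: Ck_on_add Ck_on_const)

lemma Ck_on_bilinear:
  assumes B: "bounded_bilinear prd"
  shows "Ck_on k S f \<Longrightarrow> Ck_on k S h \<Longrightarrow> Ck_on k S (\<lambda>x. prd (f x) (h x))"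
proof (induction k arbitrary: f h)
  case 0 then show ?case by (auto intro: bounded_bilinear.continuous_on[OF B])
next
  case (Suc k)
  from Suc.prems(1) obtain f' where f': "\<And>x. x \<in> S \<Longrightarrow> (f has_derivative f' x) (at x)"
    "\<And>v. Ck_on k S (\<lambda>x. f' x v)" by (rule Ck_on_SucE) blast
  from Suc.prems(2) obtain h' where h': "\<And>x. x \<in> S \<Longrightarrow> (h has_derivative h' x) (at x)"
    "\<And>v. Ck_on k S (\<lambda>x. h' x v)" by (rule Ck_on_SucE) blast
  note c = Ck_on_SucD[OF Suc.prems(1)] Ck_on_SucD[OF Suc.prems(2)]
  show ?case
    by (rule Ck_on_SucI[of _ _ "\<lambda>x v. prd (f x) (h' x v) + prd (f' x v) (h x)"])
      (rule bounded_bilinear.FDERIV[OF B f'(1) h'(1)] Ck_on_add Suc.IH c f'(2) h'(2) | assumption)+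
qed

lemmas Ck_on_scaleR = Ck_on_bilinear[OF bounded_bilinear_scaleR]
lemma Ck_on_compose:
  fixes f :: "'e::euclidean_space \<Rightarrow> 'f::euclidean_space" and h :: "'f \<Rightarrow> 'b::real_normed_vector"
  assumes "open S" "open T" "f ` S \<subseteq> T"
  shows "Ck_on k S f \<Longrightarrow> Ck_on k T h \<Longrightarrow> Ck_on k S (\<lambda>x. h (f x))"
proof (induction k arbitrary: h)
  case 0 then show ?case using assms(3) by (auto intro: continuous_on_compose2)
next
  case (Suc k)
  from Suc.prems(1) obtain f' where f': "\<And>x. x \<in> S \<Longrightarrow> (f has_derivative f' x) (at x)"
    "\<And>v. Ck_on k S (\<lambda>x. f' x v)" by (rule Ck_on_SucE) blast
  from Suc.prems(2) obtain h' where h': "\<And>x. x \<in> T \<Longrightarrow> (h has_derivative h' x) (at x)"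
    "\<And>v. Ck_on k T (\<lambda>x. h' x v)" by (rule Ck_on_SucE) blast
  have fS: "f x \<in> T" if "x \<in> S" for x using assms(3) that by auto
  have d: "((\<lambda>x. h (f x)) has_derivative (\<lambda>v. h' (f x) (f' x v))) (at x)" if "x \<in> S" for x
    using has_derivative_compose[OF f'(1)[OF that] h'(1)[OF fS[OF that]]] .
  have lin: "linear (h' (f x))" if "x \<in> S" for x
    using h'(1)[OF fS[OF that]] by (simp add: has_derivative_linear)
  \<comment> \<open>In the derivative of the composite both the base point and the direction vary
    with \<open>x\<close>, whereas \<open>Ck_on\<close> controls \<open>h'\<close> only in fixed
    directions. The expansion in a basis separates the two.\<close>
  have eq: "h' (f x) (f' x v) = (\<Sum>i\<in>Basis. (f' x v \<bullet> i) *\<^sub>R h' (f x) i)" if "x \<in> S" for x v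
    using linear_sum[OF lin[OF that], of "\<lambda>i. (f' x v \<bullet> i) *\<^sub>R i" Basis]
    by (simp add: euclidean_representation linear_scale[OF lin[OF that]])
  have "Ck_on k S (\<lambda>x. \<Sum>i\<in>Basis. (f' x v \<bullet> i) *\<^sub>R h' (f x) i)" for v
    by (intro Ck_on_sum Ck_on_scaleR Ck_on_bounded_linear[OF bounded_linear_inner_left] f'(2)
        Suc.IH h'(2) Ck_on_SucD[OF Suc.prems(1)])
  then have "Ck_on k S (\<lambda>x. h' (f x) (f' x v))" for v
    using Ck_on_cong[OF assms(1), of "\<lambda>x. h' (f x) (f' x v)"
        "\<lambda>x. \<Sum>i\<in>Basis. (f' x v \<bullet> i) *\<^sub>R h' (f x) i" k for v] eq by blast
  with d show ?case by (intro Ck_on_SucI[of _ _ "\<lambda>x v. h' (f x) (f' x v)"]) auto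
qed

lemma smooth_on_compose:
  fixes f :: "'e::euclidean_space \<Rightarrow> 'f::euclidean_space" and h :: "'f \<Rightarrow> 'b::real_normed_vector"
  assumes "smooth_on S f" "smooth_on T h" "open S" "open T" "f ` S \<subseteq> T"
  shows "smooth_on S (\<lambda>x. h (f x))"
  unfolding smooth_on_def
proof
  fix k show "Ck_on k S (\<lambda>x. h (f x))"
    by (rule Ck_on_compose[OF assms(3-5)]) (use assms(1,2) in \<open>simp_all add: smooth_on_def\<close>)
qed

lemma smooth_on_cong:
  "open S \<Longrightarrow> (\<And>x. x \<in> S \<Longrightarrow> f x = h x) \<Longrightarrow> smooth_on S f \<longleftrightarrow> smooth_on S h"
  unfolding smooth_on_def using Ck_on_cong by blast

lemma smooth_on_subset: "smooth_on S f \<Longrightarrow> T \<subseteq> S \<Longrightarrow> smooth_on T f"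
  unfolding smooth_on_def using Ck_on_subset by blast

lemma smooth_on_local:
  assumes "open S" "\<And>x. x \<in> S \<Longrightarrow> \<exists>T. open T \<and> x \<in> T \<and> smooth_on (S \<inter> T) f"
  shows "smooth_on S f"
  unfolding smooth_on_def
proof
  fix k show "Ck_on k S f"
    by (rule Ck_on_local[OF assms(1)]) (use assms(2) in \<open>force simp: smooth_on_def\<close>)
qed

lemma smooth_on_const: "smooth_on S (\<lambda>x. c)"
  and smooth_on_id: "smooth_on S (\<lambda>x. x)"
  and smooth_on_linear: "bounded_linear l \<Longrightarrow> smooth_on S l"
  by (auto simp: smooth_on_def Ck_on_const Ck_on_id Ck_on_linear)

lemma smooth_on_add: "smooth_on S f \<Longrightarrow> smooth_on S h \<Longrightarrow> smooth_on S (\<lambda>x. f x + h x)"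
  and smooth_on_bounded_linear: "bounded_linear l \<Longrightarrow> smooth_on S f \<Longrightarrow> smooth_on S (\<lambda>x. l (f x))"
  by (auto simp: smooth_on_def Ck_on_add Ck_on_bounded_linear)

lemma smooth_on_bilinear:
  "bounded_bilinear prd \<Longrightarrow> smooth_on S f \<Longrightarrow> smooth_on S h \<Longrightarrow> smooth_on S (\<lambda>x. prd (f x) (h x))"
  by (auto simp: smooth_on_def Ck_on_bilinear)

lemmas smooth_on_scaleR = smooth_on_bilinear[OF bounded_bilinear_scaleR]
lemmas smooth_on_mult = smooth_on_bilinear[OF bounded_bilinear_mult]

lemma smooth_on_sum: "(\<And>i. i \<in> I \<Longrightarrow> smooth_on S (f i)) \<Longrightarrow> smooth_on S (\<lambda>x. \<Sum>i\<in>I. f i x)"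
  by (auto simp: smooth_on_def Ck_on_sum)

lemma bounded_linear_Pair_left: "bounded_linear (\<lambda>x. (x, 0))"
  and bounded_linear_Pair_right: "bounded_linear (\<lambda>x. (0, x))"
  by (auto intro: bounded_linear_Pair bounded_linear_ident bounded_linear_zero)

lemma smooth_on_Pair: "smooth_on S f \<Longrightarrow> smooth_on S h \<Longrightarrow> smooth_on S (\<lambda>x. (f x, h x))"
  using smooth_on_add[OF smooth_on_bounded_linear[OF bounded_linear_Pair_left]
      smooth_on_bounded_linear[OF bounded_linear_Pair_right], of S f h] by simp

lemma smooth_on_continuous: "smooth_on S f \<Longrightarrow> continuous_on S f"
  unfolding smooth_on_def using Ck_on.simps(1) by blast

lemma smooth_on_differentiable: "smooth_on S f \<Longrightarrow> x \<in> S \<Longrightarrow> f differentiable at x"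
  unfolding smooth_on_def differentiable_def using Ck_on_SucE[of 0 S f] by blast

lemma smooth_on_has_derivative:
  "smooth_on S f \<Longrightarrow> x \<in> S \<Longrightarrow> (f has_derivative frechet_derivative f (at x)) (at x)"
  using smooth_on_differentiable frechet_derivative_works by blast

lemma smooth_on_frechet_derivative:
  assumes "open S" "smooth_on S f"
  shows "smooth_on S (\<lambda>x. frechet_derivative f (at x) v)"
  using assms(2) unfolding smooth_on_def using Ck_on_Suc_iff[OF assms(1)] by blast

lemma frechet_derivative_sum_Basis:
  fixes f :: "'e::euclidean_space \<Rightarrow> 'b::real_normed_vector"
  assumes "f differentiable at x"
  shows "frechet_derivative f (at x) v = (\<Sum>i\<in>Basis. (v \<bullet> i) *\<^sub>R frechet_derivative f (at x) i)"
proof -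
  have lin: "linear (frechet_derivative f (at x))"
    using assms by (simp add: linear_frechet_derivative)
  show ?thesis
    using linear_sum[OF lin, of "\<lambda>i. (v \<bullet> i) *\<^sub>R i" Basis]
    by (simp add: euclidean_representation linear_scale[OF lin])
qed

lemma smooth_on_frechet_derivative_vf:
  assumes "open S" "smooth_on S f" "smooth_on S h"
  shows "smooth_on S (\<lambda>x. frechet_derivative f (at x) (h x))"
proof -
  have "smooth_on S (\<lambda>x. \<Sum>i\<in>Basis. (h x \<bullet> i) *\<^sub>R frechet_derivative f (at x) i)"
    by (intro smooth_on_sum smooth_on_scaleR smooth_on_bounded_linear[OF bounded_linear_inner_left]
        smooth_on_frechet_derivative assms)
  then show ?thesis
    using smooth_on_cong[OF assms(1), of "\<lambda>x. frechet_derivative f (at x) (h x)"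
        "\<lambda>x. \<Sum>i\<in>Basis. (h x \<bullet> i) *\<^sub>R frechet_derivative f (at x) i"]
      frechet_derivative_sum_Basis[OF smooth_on_differentiable[OF assms(2)]] by blast
qed


subsection \<open>Smooth inverse functions and Hadamard's lemma\<close>

text \<open>As \<open>Q\<close> vanishes at \<open>x\<close>, the term of the product rule with the
  derivative of \<open>P\<close> drops out, and continuity of \<open>P\<close> is enough. This
  serves for the inverse of an operator-valued map, which is known to be continuous before it is
  known to be differentiable.\<close>

lemma has_derivative_bilinear_zero:
  assumes B: "bounded_bilinear prd" and P: "isCont P x"
    and Q: "(Q has_derivative Q') (at x)" "Q x = 0"
  shows "((\<lambda>y. prd (P y) (Q y)) has_derivative (\<lambda>h. prd (P x) (Q' h))) (at x)"
proof -
  interpret bounded_bilinear prd by (rule B)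
  obtain K where K: "K > 0" "\<And>a b. norm (prd a b) \<le> norm a * norm b * K"
    using pos_bounded by blast
  have bl: "bounded_linear Q'" using Q(1) by (rule has_derivative_bounded_linear)
  then obtain C where C: "C > 0" "\<And>h. norm (Q' h) \<le> norm h * C"
    using bounded_linear.pos_bounded by blast
  have 1: "((\<lambda>y. prd (P y - P x) (Q y)) has_derivative (\<lambda>h. 0)) (at x)"
    unfolding has_derivative_at_alt
  proof (intro conjI allI impI)
    fix e :: real assume e: "e > 0"
    obtain d1 where d1: "d1 > 0" "\<And>y. norm (y - x) < d1 \<Longrightarrow> norm (Q y - Q x - Q' (y - x)) \<le> 1 * norm
        (y - x)"
      using Q(1) unfolding has_derivative_at_alt by (meson zero_less_one)
    \<comment> \<open>The remainder is at most \<open>e' * norm (Q y) * K\<close>, and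
      \<open>norm (Q y) \<le> (1 + C) * norm (y - x)\<close> near \<open>x\<close>; this choice
      turns the product into \<open>e * norm (y - x)\<close>.\<close>
    define e' where "e' = e / ((1 + C) * K)"
    have e': "e' > 0" using e C K by (simp add: e'_def)
    obtain d2 where d2: "d2 > 0" "\<And>y. norm (y - x) < d2 \<Longrightarrow> norm (P y - P x) < e'"
      using P e' unfolding continuous_at_eps_delta dist_norm by blast
    show "\<exists>d>0. \<forall>y. norm (y - x) < d \<longrightarrow> norm (prd (P y - P x) (Q y) - prd (P x - P x) (Q x) - 0) \<le>
        e * norm (y - x)"
    proof (intro exI[of _ "min d1 d2"] conjI allI impI)
      fix y assume y: "norm (y - x) < min d1 d2"
      have "norm (Q y) \<le> norm (Q y - Q' (y - x)) + norm (Q' (y - x))"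
        using norm_triangle_ineq[of "Q y - Q' (y - x)" "Q' (y - x)"] by simp
      also have "\<dots> \<le> (1 + C) * norm (y - x)"
        using d1(2)[of y] C(2)[of "y - x"] y Q(2) by (simp add: algebra_simps)
      finally have q: "norm (Q y) \<le> (1 + C) * norm (y - x)" .
      have p: "norm (P y - P x) \<le> e'" using d2(2)[of y] y by simp
      have "norm (prd (P y - P x) (Q y)) \<le> norm (P y - P x) * norm (Q y) * K" by (rule K(2))
      also have "\<dots> \<le> (e' * ((1 + C) * norm (y - x))) * K"
        using p q e' K(1) by (intro mult_right_mono mult_mono) auto
      also have "\<dots> = (e' * ((1 + C) * K)) * norm (y - x)" by simp
      also have "e' * ((1 + C) * K) = e" unfolding e'_def using C K by simp
      finally show "norm (prd (P y - P x) (Q y) - prd (P x - P x) (Q x) - 0) \<le> e * norm (y - x)"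
        by (simp add: zero_left)
    qed (use d1 d2 in auto)
  qed simp
  have 2: "((\<lambda>y. prd (P x) (Q y)) has_derivative (\<lambda>h. prd (P x) (Q' h))) (at x)"
    by (rule bounded_linear.has_derivative[OF bounded_linear_right Q(1)])
  show ?thesis using has_derivative_add[OF 1 2] by (simp add: diff_left)
qed

text \<open>The identity \<open>R y = R x + R y (A x - A y) R x\<close> gives continuity of the inverse \<open>R\<close> of \<open>A\<close>,
  and then \<open>R' = - R A' R\<close>.\<close>

lemma Ck_on_blinfun_inverse:
  fixes A :: "'e::euclidean_space \<Rightarrow> 'x::real_normed_vector \<Rightarrow>\<^sub>L 'y::real_normed_vector"
  assumes S: "open S" and RA: "\<And>x. x \<in> S \<Longrightarrow> R x o\<^sub>L A x = id_blinfun"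
    and AR: "\<And>x. x \<in> S \<Longrightarrow> A x o\<^sub>L R x = id_blinfun"
  shows "Ck_on k S A \<Longrightarrow> Ck_on k S R"
proof (induction k)
  have RA': "R x (A x v) = v" if "x \<in> S" for x v
    using RA[OF that] by (metis blinfun_apply_blinfun_compose blinfun_apply_id_blinfun)
  have AR': "A x (R x v) = v" if "x \<in> S" for x v
    using AR[OF that] by (metis blinfun_apply_blinfun_compose blinfun_apply_id_blinfun)
  have eq: "R y = R x + (R y o\<^sub>L ((A x - A y) o\<^sub>L R x))" if "x \<in> S" "y \<in> S" for x y
    by (rule blinfun_eqI) (simp add: blinfun.bilinear_simps RA' AR' that)
  case 0
  have cA: "continuous_on S A" using 0 by simp
  have "isCont R x" if x: "x \<in> S" for x
  proof -
    have cx: "isCont A x" using cA S x continuous_on_eq_continuous_at by blast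
    define b where "b = norm (R x) + 1"
    have b: "b > 0" "norm (R x) \<le> b" by (simp_all add: b_def add_nonneg_pos)
    \<comment> \<open>Within the threshold \<open>1 / (2 * b)\<close> the correction in
      \<open>eq\<close> has at most half the norm of \<open>R y\<close> and can be absorbed. This
      bounds \<open>R\<close> near \<open>x\<close> by \<open>2 * b\<close> before anything is known
      about its continuity.\<close>
    have "eventually (\<lambda>y. dist (A y) (A x) < 1 / (2 * b)) (at x)"
      using cx b tendstoD[of A "A x" "at x" "1 / (2 * b)"] by (simp add: isCont_def)
    moreover have "eventually (\<lambda>y. y \<in> S) (at x)" using S x eventually_at_topological by blast
    ultimately have "eventually (\<lambda>y. norm (R y - R x) \<le> 2 * b * b * norm (A x - A y)) (at x)"
    proof eventually_elim
      case (elim y)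
      have "norm (R y - R x) \<le> norm (R y) * (norm (A x - A y) * norm (R x))"
        using eq[OF x elim(2)] norm_blinfun_compose[of "R y" "(A x - A y) o\<^sub>L R x"]
          norm_blinfun_compose[of "A x - A y" "R x"]
        by (smt (verit) add_diff_cancel_left' mult_left_mono norm_ge_zero)
      also have "\<dots> \<le> norm (R y) * (norm (A x - A y) * b)"
        using b by (intro mult_left_mono) auto
      finally have 1: "norm (R y - R x) \<le> norm (R y) * (norm (A x - A y) * b)" .
      have "norm (A x - A y) * b \<le> 1 / (2 * b) * b"
        using elim(1) b by (intro mult_right_mono) (auto simp: dist_norm norm_minus_commute)
      then have "norm (A x - A y) * b \<le> 1/2" using b by simp
      then have "norm (R y) * (norm (A x - A y) * b) \<le> norm (R y) * (1/2)"
        by (intro mult_left_mono) auto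
      then have "norm (R y) \<le> 2 * b"
        using 1 b(2) norm_triangle_sub[of "R y" "R x"] by linarith
      then have "norm (R y) * (norm (A x - A y) * b) \<le> 2 * b * (norm (A x - A y) * b)"
        using b by (intro mult_right_mono) auto
      with 1 show ?case by (simp add: mult_ac)
    qed
    moreover have "((\<lambda>y. 2 * b * b * norm (A x - A y)) \<longlongrightarrow> 2 * b * b * norm (A x - A x)) (at x)"
      using cx unfolding isCont_def by (intro tendsto_intros)
    ultimately have "((\<lambda>y. R y - R x) \<longlongrightarrow> 0) (at x)"
      by (intro Lim_null_comparison[of "\<lambda>y. R y - R x" "\<lambda>y. 2 * b * b * norm (A x - A y)"]) auto
    then show ?thesis unfolding isCont_def using Lim_null by blast
  qed
  then show ?case by (simp add: continuous_at_imp_continuous_on)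
next
  have RA': "R x (A x v) = v" if "x \<in> S" for x v
    using RA[OF that] by (metis blinfun_apply_blinfun_compose blinfun_apply_id_blinfun)
  have AR': "A x (R x v) = v" if "x \<in> S" for x v
    using AR[OF that] by (metis blinfun_apply_blinfun_compose blinfun_apply_id_blinfun)
  have eq: "R y = R x + (R y o\<^sub>L ((A x - A y) o\<^sub>L R x))" if "x \<in> S" "y \<in> S" for x y
    by (rule blinfun_eqI) (simp add: blinfun.bilinear_simps RA' AR' that)
  case (Suc k)
  have IH: "Ck_on k S R" using Suc.IH Ck_on_SucD[OF Suc.prems] by blast
  have cR: "isCont R x" if "x \<in> S" for x
    using Ck_on_continuous[OF IH] S that continuous_on_eq_continuous_at by blast
  from Suc.prems obtain A' where A': "\<And>x. x \<in> S \<Longrightarrow> (A has_derivative A' x) (at x)"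
    "\<And>v. Ck_on k S (\<lambda>x. A' x v)" by (rule Ck_on_SucE) blast
  show ?case
  proof (rule Ck_on_SucI)
    fix x assume x: "x \<in> S"
    have "((\<lambda>y. (A x - A y) o\<^sub>L R x) has_derivative (\<lambda>h. (- A' x h) o\<^sub>L R x)) (at x)"
      by (rule bounded_linear.has_derivative[OF bounded_bilinear.bounded_linear_left[OF
          bounded_bilinear_blinfun_compose]])
        (auto intro!: derivative_eq_intros A' x)
    then have "((\<lambda>y. R y o\<^sub>L ((A x - A y) o\<^sub>L R x)) has_derivative (\<lambda>h. R x o\<^sub>L ((- A' x h) o\<^sub>L R
        x))) (at x)"
      by (rule has_derivative_bilinear_zero[OF bounded_bilinear_blinfun_compose cR[OF x]]) (simp
          add: blinfun_eqI)
    then have "((\<lambda>y. R x + (R y o\<^sub>L ((A x - A y) o\<^sub>L R x))) has_derivative (\<lambda>h. R x o\<^sub>L ((- A' x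
        h) o\<^sub>L R x))) (at x)"
      using has_derivative_add[OF has_derivative_const[of "R x"]] by fastforce
    then show "(R has_derivative (\<lambda>h. R x o\<^sub>L ((- A' x h) o\<^sub>L R x))) (at x)"
      by (rule has_derivative_transform_within_open[OF _ S x]) (use eq[OF x] in auto)
  next
    fix v
    have m: "Ck_on k S (\<lambda>x. - A' x v)"
      using Ck_on_bounded_linear[OF bounded_linear_minus[OF bounded_linear_ident] A'(2)] .
    show "Ck_on k S (\<lambda>x. R x o\<^sub>L ((- A' x v) o\<^sub>L R x))"
      by (intro Ck_on_bilinear[OF bounded_bilinear_blinfun_compose] IH m)
  qed
qed

lemma Blinfun_frechet_derivative:
  assumes "f differentiable at x"
  shows "blinfun_apply (Blinfun (frechet_derivative f (at x))) = frechet_derivative f (at x)"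
  using assms by (simp add: bounded_linear_Blinfun_apply frechet_derivative_works
      has_derivative_bounded_linear)

text \<open>Directional derivatives control the operator-valued derivative because the domain is
  finite-dimensional: the latter is a finite sum of rank-one operators whose coefficients are
  partial derivatives.\<close>

lemma Ck_on_Blinfun_derivative:
  fixes f :: "'e::euclidean_space \<Rightarrow> 'b::real_normed_vector"
  assumes S: "open S" and f: "Ck_on (Suc k) S f"
  shows "Ck_on k S (\<lambda>x. Blinfun (frechet_derivative f (at x)))"
proof -
  let ?D = "\<lambda>x. frechet_derivative f (at x)"
  have d: "f differentiable at x" if "x \<in> S" for x
    using f that unfolding Ck_on_Suc_iff[OF S] by blast
  have eq: "Blinfun (?D x) = (\<Sum>i\<in>Basis. blinfun_scaleR_left (?D x i) o\<^sub>L blinfun_inner_right i)"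
    if "x \<in> S" for x
  proof (rule blinfun_eqI)
    fix v
    show "blinfun_apply (Blinfun (?D x)) v =
        blinfun_apply (\<Sum>i\<in>Basis. blinfun_scaleR_left (?D x i) o\<^sub>L blinfun_inner_right i) v"
      unfolding Blinfun_frechet_derivative[OF d[OF that]]
      by (subst frechet_derivative_sum_Basis[OF d[OF that]])
        (simp add: blinfun.sum_left blinfun_inner_right.rep_eq inner_commute)
  qed
  have bl: "bounded_linear (\<lambda>c. blinfun_scaleR_left c o\<^sub>L blinfun_inner_right i)" for i :: 'e
    by (rule bounded_linear_compose[OF bounded_bilinear.bounded_linear_left[OF
        bounded_bilinear_blinfun_compose]
          bounded_linear_blinfun_scaleR_left])
  have "Ck_on k S (\<lambda>x. \<Sum>i\<in>Basis. blinfun_scaleR_left (?D x i) o\<^sub>L blinfun_inner_right i)"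
    by (intro Ck_on_sum Ck_on_bounded_linear[OF bl]) (use f in \<open>auto simp: Ck_on_Suc_iff[OF S]
        simp del: Ck_on.simps\<close>)
  then show ?thesis using Ck_on_cong[OF S, of "\<lambda>x. Blinfun (?D x)", OF eq] by blast
qed

lemma smooth_on_Blinfun_derivative:
  fixes f :: "'e::euclidean_space \<Rightarrow> 'b::real_normed_vector"
  assumes "open S" "smooth_on S f"
  shows "smooth_on S (\<lambda>x. Blinfun (frechet_derivative f (at x)))"
  using assms Ck_on_Blinfun_derivative unfolding smooth_on_def by blast

text \<open>The regularity of the inverse is bootstrapped. If \<open>g\<close> is
  \<open>C^k\<close>, then so is the operator \<open>f' (g y)\<close>, and by
  \<open>Ck_on_blinfun_inverse\<close> so is its inverse, which is the derivative of
  \<open>g\<close>. Hence \<open>g\<close> is \<open>C^(k+1)\<close>.\<close>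

lemma smooth_inverse_function_id:
  fixes f :: "'a::euclidean_space \<Rightarrow> 'a"
  assumes U: "open U" and f: "smooth_on U f" and x0: "x0 \<in> U"
    and id: "(f has_derivative (\<lambda>h. h)) (at x0)"
  obtains U' V g where "open U'" "U' \<subseteq> U" "x0 \<in> U'" "open V" "f x0 \<in> V" "homeomorphism U' V f g"
    "smooth_on V g"
proof -
  define f' where "f' x = Blinfun (frechet_derivative f (at x))" for x
  have f'app: "blinfun_apply (f' x) = frechet_derivative f (at x)" if "x \<in> U" for x
    using Blinfun_frechet_derivative smooth_on_differentiable[OF f that] by (simp add: f'_def)
  have s': "smooth_on U f'" unfolding f'_def by (rule smooth_on_Blinfun_derivative[OF U f])
  have "frechet_derivative f (at x0) = (\<lambda>h. h)" using id by (metis frechet_derivative_at)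
  then have i: "id_blinfun o\<^sub>L f' x0 = id_blinfun"
    by (intro blinfun_eqI) (simp add: f'app[OF x0])
  obtain U' V g g' where *: "open U'" "U' \<subseteq> U" "x0 \<in> U'" "open V" "f x0 \<in> V" "homeomorphism U' V f
      g"
    and g': "\<And>y. y \<in> V \<Longrightarrow> (g has_derivative (g' y)) (at y)"
    "\<And>y. y \<in> V \<Longrightarrow> g' y = inv (blinfun_apply (f'(g y)))"
    "\<And>y. y \<in> V \<Longrightarrow> bij (blinfun_apply (f'(g y)))"
  proof (rule inverse_function_theorem[OF U _ smooth_on_continuous[OF s'] x0 i])
    show "(f has_derivative blinfun_apply (f' x)) (at x)" if "x \<in> U" for x
      using smooth_on_has_derivative[OF f that] f'app[OF that] by simp
  qed blast
  have gU: "g ` V \<subseteq> U" using *(2,6) by (auto simp: homeomorphism_def)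
  have bl: "blinfun_apply (Blinfun (g' y)) = g' y" if "y \<in> V" for y
    using g'(1)[OF that] by (simp add: bounded_linear_Blinfun_apply has_derivative_bounded_linear)
  have "Ck_on k V g" for k
  proof (induction k)
    case 0 show ?case using *(6) by (auto simp: homeomorphism_def)
  next
    case (Suc k)
    have "Ck_on k V (\<lambda>y. f' (g y))"
      by (rule Ck_on_compose[OF *(4) U gU Suc]) (use s' in \<open>simp add: smooth_on_def\<close>)
    then have R: "Ck_on k V (\<lambda>y. Blinfun (g' y))"
    proof (rule Ck_on_blinfun_inverse[OF *(4), rotated 2])
      fix y assume y: "y \<in> V"
      note b = g'(3)[OF y]
      show "Blinfun (g' y) o\<^sub>L f' (g y) = id_blinfun"
        by (rule blinfun_eqI) (simp add: bl[OF y], simp add: g'(2)[OF y] inv_f_f[OF bij_is_inj[OF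
            b]])
      show "f' (g y) o\<^sub>L Blinfun (g' y) = id_blinfun"
        by (rule blinfun_eqI) (simp add: bl[OF y], simp add: g'(2)[OF y] surj_f_inv_f[OF
            bij_is_surj[OF b]])
    qed
    show ?case
    proof (rule Ck_on_SucI[OF g'(1)])
      fix v
      have "Ck_on k V (\<lambda>y. blinfun_apply (Blinfun (g' y)) v)"
        by (rule Ck_on_bounded_linear[OF blinfun.bounded_linear_left R])
      then show "Ck_on k V (\<lambda>y. g' y v)"
        using Ck_on_cong[OF *(4), of "\<lambda>y. g' y v" "\<lambda>y. blinfun_apply (Blinfun (g' y)) v"] bl by auto
    qed
  qed
  then show ?thesis using that * unfolding smooth_on_def by blast
qed

text \<open>Composition with the inverse \<open>j\<close> of the derivative at \<open>x0\<close>
  reduces the claim to a map of a space into itself whose derivative at \<open>x0\<close> is the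
  identity.\<close>

lemma smooth_inverse_function:
  fixes f :: "'a::euclidean_space \<Rightarrow> 'b::euclidean_space"
  assumes U: "open U" and f: "smooth_on U f" and x0: "x0 \<in> U"
    and d: "(f has_derivative f') (at x0)" and b: "bij f'"
  obtains U' V g where "open U'" "U' \<subseteq> U" "x0 \<in> U'" "open V" "f x0 \<in> V" "homeomorphism U' V f g"
    "smooth_on V g"
proof -
  have lf: "linear f'" using d by (rule has_derivative_linear)
  define j where "j = inv f'"
  have fj: "f' (j y) = y" "j (f' x) = x" for x y
    using b by (simp_all add: j_def bij_is_surj surj_f_inv_f bij_is_inj)
  have lj: "linear j"
  proof (rule linearI)
    show "j (x + y) = j x + j y" for x y using linear_add[OF lf, of "j x" "j y"] by (metis fj)
    show "j (r *\<^sub>R x) = r *\<^sub>R j x" for r x using linear_scale[OF lf, of r "j x"] by (metis fj)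
  qed
  then have blj: "bounded_linear j" by (simp add: linear_conv_bounded_linear)
  have "((\<lambda>x. j (f x)) has_derivative (\<lambda>h. h)) (at x0)"
    using bounded_linear.has_derivative[OF blj d] by (simp add: fj)
  then obtain U' V g where *: "open U'" "U' \<subseteq> U" "x0 \<in> U'" "open V" "j (f x0) \<in> V"
    "homeomorphism U' V (\<lambda>x. j (f x)) g" "smooth_on V g"
    using smooth_inverse_function_id[OF U smooth_on_bounded_linear[OF blj f] x0] by metis
  have V: "f' ` V = j -` V"
  proof safe
    show "x \<in> f' ` V" if "j x \<in> V" for x using that fj(1) by (metis imageI)
  qed (simp add: fj)
  have cj: "continuous_on UNIV j" using blj by (simp add: linear_continuous_on)
  have oV: "open (f' ` V)" unfolding V
    using *(4) cj by (simp add: continuous_on_open_vimage[OF open_UNIV])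
  have sm: "smooth_on (f' ` V) (\<lambda>y. g (j y))"
    by (rule smooth_on_compose[OF smooth_on_linear[OF blj] *(7) oV *(4)]) (auto simp: V)
  have cf: "continuous_on U' f" using smooth_on_continuous[OF f] *(2) continuous_on_subset by blast
  have h: "g ` V = U'" "\<And>x. x \<in> U' \<Longrightarrow> g (j (f x)) = x" "\<And>y. y \<in> V \<Longrightarrow> j (f (g y)) = y"
    "(\<lambda>x. j (f x)) ` U' = V"
    using *(6) by (auto simp: homeomorphism_def)
  have "homeomorphism U' (f' ` V) f (\<lambda>y. g (j y))"
    unfolding homeomorphism_def
  proof (intro conjI ballI cf smooth_on_continuous[OF sm])
    have "f' ` V = (\<lambda>x. f' (j (f x))) ` U'" using h(4) by (metis image_image)
    then show "f ` U' = f' ` V" by (simp add: fj)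
    show "(\<lambda>y. g (j y)) ` f' ` V = U'" using h(1) by (simp add: image_image fj)
    show "g (j (f x)) = x" if "x \<in> U'" for x using h(2) that .
    show "f (g (j y)) = y" if "y \<in> f' ` V" for y
    proof -
      have "j (f (g (j y))) = j y" using h(3)[of "j y"] that fj by auto
      then show ?thesis by (metis fj(1))
    qed
  qed
  moreover have "f x0 \<in> f' ` V" using *(5) by (simp add: V)
  ultimately show ?thesis using that[OF *(1-3) oV _ _ sm] by blast
qed

text \<open>Differentiating under the integral raises \<open>m\<close> by one, so \<open>m\<close> has to be arbitrary in the
  induction on \<open>k\<close>.\<close>

lemma Ck_on_ray_integral:
  fixes F :: "'e::euclidean_space \<Rightarrow> real"
  shows "Ck_on k (ball c r) F \<Longrightarrow>
    Ck_on k (ball c r) (\<lambda>x. integral (cbox 0 1) (\<lambda>t. t ^ m * F (c + t *\<^sub>R (x - c))))"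
proof (induction k arbitrary: F m)
  have ray: "c + t *\<^sub>R (x - c) \<in> ball c r" if "x \<in> ball c r" "t \<in> cbox 0 1" for x :: 'e and t ::
      real
  proof -
    have "\<bar>t\<bar> * norm (x - c) \<le> 1 * norm (x - c)" using that(2) by (intro mult_right_mono) auto
    then show ?thesis using that(1) by (simp add: dist_norm norm_minus_commute)
  qed
  have cr: "continuous_on (ball c r \<times> cbox (0::real) 1) (\<lambda>z. G (c + snd z *\<^sub>R (fst z - c)))"
    if "continuous_on (ball c r) G" for G :: "'e \<Rightarrow> 'z::topological_space"
    by (rule continuous_on_compose2[OF that]) (use ray in \<open>auto intro!: continuous_intros\<close>)
  {
    case 0
    have "continuous_on (ball c r \<times> cbox (0::real) 1) (\<lambda>(x, t). t ^ m * F (c + t *\<^sub>R (x - c)))"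
      using cr[of F] 0 by (auto simp: split_def intro!: continuous_intros)
    then show ?case unfolding Ck_on.simps by (rule integral_continuous_on_param)
  next
    case (Suc k)
    let ?D = "\<lambda>x. Blinfun (frechet_derivative F (at x))"
    have df: "F differentiable at x" if "x \<in> ball c r" for x
      using Suc.prems that unfolding Ck_on_Suc_iff[OF open_ball] by blast
    have cD: "continuous_on (ball c r) ?D"
      using Ck_on_continuous[OF Ck_on_Blinfun_derivative[OF open_ball Suc.prems]] .
    define fx where "fx x t = t ^ Suc m *\<^sub>R ?D (c + t *\<^sub>R (x - c))" for x t
    have cfx: "continuous_on (ball c r \<times> cbox 0 1) (\<lambda>(x, t). fx x t)"
      unfolding fx_def using cr[OF cD] by (auto simp: split_def intro!: continuous_intros)
    have cF: "continuous_on (ball c r) F" by (rule Ck_on_continuous[OF Suc.prems])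
    have d: "((\<lambda>x. integral (cbox 0 1) (\<lambda>t. t ^ m * F (c + t *\<^sub>R (x - c)))) has_derivative
        integral (cbox 0 1) (fx x)) (at x within ball c r)" if x: "x \<in> ball c r" for x
    proof (rule leibniz_rule[OF _ _ cfx x convex_ball])
      fix y :: 'e and t :: real assume y: "y \<in> ball c r" "t \<in> cbox 0 1"
      have 1: "((\<lambda>x. c + t *\<^sub>R (x - c)) has_derivative (\<lambda>h. t *\<^sub>R h)) (at y within ball c r)"
        by (auto intro!: derivative_eq_intros)
      have 2: "(F has_derivative ?D (c + t *\<^sub>R (y - c))) (at (c + t *\<^sub>R (y - c)))"
        using df[OF ray[OF y]] by (simp add: Blinfun_frechet_derivative frechet_derivative_works)
      have "((\<lambda>x. t ^ m * F (c + t *\<^sub>R (x - c))) has_derivative (\<lambda>h. t ^ m * ?D (c + t *\<^sub>R (y -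
          c)) (t *\<^sub>R h))) (at y within ball c r)"
        by (intro has_derivative_mult_right has_derivative_compose[OF 1 2])
      then show "((\<lambda>x. t ^ m * F (c + t *\<^sub>R (x - c))) has_derivative blinfun_apply (fx y t)) (at y
          within ball c r)"
        by (rule has_derivative_eq_rhs) (simp add: fx_def blinfun.bilinear_simps fun_eq_iff)
    next
      fix y assume y: "y \<in> ball c r"
      have "continuous_on (cbox 0 1) (\<lambda>t. F (c + t *\<^sub>R (y - c)))"
        by (rule continuous_on_compose2[OF cF]) (use ray[OF y] in \<open>auto intro!: continuous_intros\<close>)
      then show "(\<lambda>t. t ^ m * F (c + t *\<^sub>R (y - c))) integrable_on cbox 0 1"
        by (intro integrable_continuous continuous_intros)
    qed
    show ?case
    proof (rule Ck_on_SucI)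
      fix x assume "x \<in> ball c r"
      from d[OF this] this
      show "((\<lambda>x. integral (cbox 0 1) (\<lambda>t. t ^ m * F (c + t *\<^sub>R (x - c)))) has_derivative
        integral (cbox 0 1) (fx x)) (at x)" by (simp add: at_within_open[OF _ open_ball])
    next
      fix v
      have "Ck_on k (ball c r) (\<lambda>x. frechet_derivative F (at x) v)"
        using Suc.prems unfolding Ck_on_Suc_iff[OF open_ball] by blast
      from Suc.IH[OF this, of "Suc m"]
      have I: "Ck_on k (ball c r) (\<lambda>x. integral (cbox 0 1)
          (\<lambda>t. t ^ Suc m * frechet_derivative F (at (c + t *\<^sub>R (x - c))) v))" .
      have "blinfun_apply (integral (cbox 0 1) (fx x)) v = integral (cbox 0 1)
          (\<lambda>t. t ^ Suc m * frechet_derivative F (at (c + t *\<^sub>R (x - c))) v)" if x: "x \<in> ball c r"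
              for x
      proof -
        have "continuous_on (cbox 0 1) (\<lambda>t. case (x, t) of (x, t) \<Rightarrow> fx x t)"
          by (rule continuous_on_compose2[OF cfx continuous_on_Pair[OF continuous_on_const
              continuous_on_id]])
            (use x in auto)
        then have "continuous_on (cbox 0 1) (fx x)" by simp
        then have "blinfun_apply (integral (cbox 0 1) (fx x)) v = integral (cbox 0 1) (\<lambda>t.
            blinfun_apply (fx x t) v)"
          by (intro blinfun_apply_integral integrable_continuous)
        also have "\<dots> = integral (cbox 0 1)
          (\<lambda>t. t ^ Suc m * frechet_derivative F (at (c + t *\<^sub>R (x - c))) v)"
          by (rule integral_cong)
            (simp add: fx_def blinfun.bilinear_simps Blinfun_frechet_derivative[OF df[OF ray[OF
                x]]])
        finally show ?thesis .
      qed
      then show "Ck_on k (ball c r) (\<lambda>x. blinfun_apply (integral (cbox 0 1) (fx x)) v)"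
        using I Ck_on_cong[OF open_ball, of c r "\<lambda>x. blinfun_apply (integral (cbox 0 1) (fx x)) v"
          "\<lambda>x. integral (cbox 0 1) (\<lambda>t. t ^ Suc m * frechet_derivative F (at (c + t *\<^sub>R (x - c)))
              v)" k] by blast
    qed
  }
qed

text \<open>The fundamental theorem of calculus along the ray from \<open>c\<close> to
  \<open>x\<close>: the coefficient \<open>h i\<close> is the mean of the \<open>i\<close>-th
  partial derivative over that ray. The lemma serves to show that a derivation is determined by its
  values on coordinate functions.\<close>

lemma Hadamard_lemma:
  fixes f :: "'e::euclidean_space \<Rightarrow> real"
  assumes f: "smooth_on (ball c r) f" and r: "r > 0"
  obtains h where "\<And>i. smooth_on (ball c r) (h i)"
    "\<And>x. x \<in> ball c r \<Longrightarrow> f x = f c + (\<Sum>i\<in>Basis. ((x - c) \<bullet> i) * h i x)"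
    "\<And>i. h i c = frechet_derivative f (at c) i"
proof
  \<comment> \<open>The factor \<open>t ^ 0\<close> puts the coefficients into the form required by
    \<open>Ck_on_ray_integral\<close>.\<close>
  let ?h = "\<lambda>i x. integral (cbox 0 1) (\<lambda>t. t ^ 0 * frechet_derivative f (at (c + t *\<^sub>R (x - c))) i)"
  show "smooth_on (ball c r) (?h i)" for i
    using smooth_on_frechet_derivative[OF open_ball f, of i] Ck_on_ray_integral
    unfolding smooth_on_def by blast
  show "?h i c = frechet_derivative f (at c) i" for i by simp
  fix x assume x: "x \<in> ball c r"
  have ray: "c + t *\<^sub>R (x - c) \<in> ball c r" if "t \<in> {0..1}" for t :: real
  proof -
    have "\<bar>t\<bar> * norm (x - c) \<le> 1 * norm (x - c)" using that by (intro mult_right_mono) auto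
    then show ?thesis using x by (simp add: dist_norm norm_minus_commute)
  qed
  have "((\<lambda>t. frechet_derivative f (at (c + t *\<^sub>R (x - c))) (x - c)) has_integral
      f (c + 1 *\<^sub>R (x - c)) - f (c + 0 *\<^sub>R (x - c))) {0..1}"
  proof (rule fundamental_theorem_of_calculus)
    fix t :: real assume t: "t \<in> {0..1}"
    have 1: "((\<lambda>t. c + t *\<^sub>R (x - c)) has_derivative (\<lambda>s. s *\<^sub>R (x - c))) (at t within {0..1})"
      by (auto intro!: derivative_eq_intros)
    note d = smooth_on_has_derivative[OF f ray[OF t]]
    have "((\<lambda>t. f (c + t *\<^sub>R (x - c))) has_derivative
        (\<lambda>s. frechet_derivative f (at (c + t *\<^sub>R (x - c))) (s *\<^sub>R (x - c)))) (at t within {0..1})"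
      by (rule has_derivative_compose[OF 1 d])
    then show "((\<lambda>t. f (c + t *\<^sub>R (x - c))) has_vector_derivative
        frechet_derivative f (at (c + t *\<^sub>R (x - c))) (x - c)) (at t within {0..1})"
      unfolding has_vector_derivative_def
      by (simp add: linear_scale[OF has_derivative_linear[OF d]])
  qed simp
  then have "f x - f c = integral (cbox 0 1) (\<lambda>t. frechet_derivative f (at (c + t *\<^sub>R (x - c))) (x
      - c))"
    by (simp add: integral_unique)
  also have "\<dots> = integral (cbox 0 1) (\<lambda>t. \<Sum>i\<in>Basis. ((x - c) \<bullet> i) * frechet_derivative f (at (c +
      t *\<^sub>R (x - c))) i)"
    by (rule integral_cong) (use frechet_derivative_sum_Basis[OF smooth_on_differentiable[OF f
        ray]] in simp)
  also have "\<dots> = (\<Sum>i\<in>Basis. integral (cbox 0 1) (\<lambda>t. ((x - c) \<bullet> i) * frechet_derivative f (at (c +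
      t *\<^sub>R (x - c))) i))"
  proof (rule integral_sum)
    fix i :: 'e
    have "continuous_on (cbox 0 1) (\<lambda>t. frechet_derivative f (at (c + t *\<^sub>R (x - c))) i)"
      by (rule continuous_on_compose2[OF smooth_on_continuous[OF smooth_on_frechet_derivative[OF
          open_ball f]]])
        (use ray in \<open>auto intro!: continuous_intros\<close>)
    then show "(\<lambda>t. ((x - c) \<bullet> i) * frechet_derivative f (at (c + t *\<^sub>R (x - c))) i) integrable_on
        cbox 0 1"
      by (intro integrable_continuous continuous_intros)
  qed simp
  finally show "f x = f c + (\<Sum>i\<in>Basis. ((x - c) \<bullet> i) * ?h i x)" by simp
qed


subsection \<open>Flows of commuting vector fields\<close>

text \<open>Curves on the unit interval are represented by bounded continuous functions on the whole
  line. Clamping the upper limit freezes an indefinite integral outside the interval and so keeps it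
  bounded.\<close>

definition clamp01 :: "real \<Rightarrow> real" where "clamp01 s = max 0 (min 1 s)"

lemma clamp01_simps [simp]: "0 \<le> clamp01 s" "clamp01 s \<le> 1" "clamp01 (clamp01 s) = clamp01 s"
  "0 \<le> s \<Longrightarrow> s \<le> 1 \<Longrightarrow> clamp01 s = s"
  by (auto simp: clamp01_def)

lemma continuous_on_clamp01: "continuous_on S clamp01"
  unfolding clamp01_def by (intro continuous_intros)

section \<open>The Banach space of bounded continuous curves and operators on it\<close>

definition bcont_prod :: "('b \<Rightarrow> 'c \<Rightarrow> 'd) \<Rightarrow> (real \<Rightarrow>\<^sub>C 'b::real_normed_vector) \<Rightarrow>
    (real \<Rightarrow>\<^sub>C 'c::real_normed_vector) \<Rightarrow> (real \<Rightarrow>\<^sub>C 'd::real_normed_vector)" where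
  "bcont_prod prd f h = Bcontfun (\<lambda>t. prd (apply_bcontfun f t) (apply_bcontfun h t))"

lemma bcont_prod_apply:
  assumes "bounded_bilinear prd"
  shows "apply_bcontfun (bcont_prod prd f h) t = prd (apply_bcontfun f t) (apply_bcontfun h t)"
proof -
  interpret bounded_bilinear prd by (rule assms)
  obtain K where K: "K \<ge> 0" "\<And>a b. norm (prd a b) \<le> norm a * norm b * K"
    using nonneg_bounded by blast
  have "norm (prd (apply_bcontfun f x) (apply_bcontfun h x)) \<le> norm f * norm h * K" for x
    using K norm_bounded[of f x] norm_bounded[of h x]
    by (meson mult_mono mult_right_mono norm_ge_zero order_trans)
  then have "(\<lambda>t. prd (apply_bcontfun f t) (apply_bcontfun h t)) \<in> bcontfun"
    by (intro bcontfun_normI continuous_on) auto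
  then show ?thesis by (simp add: bcont_prod_def Bcontfun_inverse)
qed

lemma bounded_bilinear_bcont_prod:
  assumes "bounded_bilinear prd"
  shows "bounded_bilinear (bcont_prod prd)"
proof -
  interpret bounded_bilinear prd by (rule assms)
  obtain K where K: "K \<ge> 0" "\<And>a b. norm (prd a b) \<le> norm a * norm b * K"
    using nonneg_bounded by blast
  show ?thesis
  proof
    fix f h
    show "\<exists>K. \<forall>f h. norm (bcont_prod prd f h) \<le> norm f * norm h * K"
    proof (intro exI[of _ K] allI norm_bound)
      fix f h t
      show "norm (apply_bcontfun (bcont_prod prd f h) t) \<le> norm f * norm h * K"
        unfolding bcont_prod_apply[OF assms]
        using K norm_bounded[of f t] norm_bounded[of h t]
        by (meson mult_mono mult_right_mono norm_ge_zero order_trans)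
    qed
  qed (auto intro!: bcontfun_eqI simp: bcont_prod_apply[OF assms] add_left add_right scaleR_left
      scaleR_right)
qed

lemma bounded_linear_const_bcontfun: "bounded_linear const_bcontfun"
  by (rule bounded_linear_intro[of _ 1]) (auto intro!: bcontfun_eqI norm_bound)

lemma bounded_linear_apply_bcontfun: "bounded_linear (\<lambda>f. apply_bcontfun f t)"
  by (rule bounded_linear_intro[of _ 1]) (auto intro: norm_bounded)

lemma apply_bcontfun_sum: "apply_bcontfun (\<Sum>i\<in>I. f i) t = (\<Sum>i\<in>I. apply_bcontfun (f i) t)"
  by (induction I rule: infinite_finite_induct) auto

definition bcont_integral :: "(real \<Rightarrow>\<^sub>C 'e::euclidean_space) \<Rightarrow> (real \<Rightarrow>\<^sub>C 'e)" where
  "bcont_integral z = Bcontfun (\<lambda>s. integral {0..clamp01 s} (apply_bcontfun z))"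

lemma norm_integral_clamp01: "norm (integral {0..clamp01 s} (apply_bcontfun z)) \<le> norm z"
  for z :: "real \<Rightarrow>\<^sub>C 'e::euclidean_space"
proof -
  have "norm (integral {0..clamp01 s} (apply_bcontfun z)) \<le> norm z * (clamp01 s - 0)"
    by (rule integral_bound) (auto intro: norm_bounded)
  also have "\<dots> \<le> norm z * 1" by (intro mult_left_mono) auto
  finally show ?thesis by simp
qed

lemma bcont_integral_apply:
  "apply_bcontfun (bcont_integral z) s = integral {0..clamp01 s} (apply_bcontfun z)"
proof -
  have 1: "continuous_on {0..1} (\<lambda>x. integral {0..x} (apply_bcontfun z))"
    by (intro indefinite_integral_continuous_1 integrable_continuous_interval) simp
  have "continuous_on UNIV (\<lambda>s. integral {0..clamp01 s} (apply_bcontfun z))"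
    by (rule continuous_on_compose2[OF 1 continuous_on_clamp01]) auto
  then have "(\<lambda>s. integral {0..clamp01 s} (apply_bcontfun z)) \<in> bcontfun"
    by (rule bcontfun_normI) (rule norm_integral_clamp01)
  then show ?thesis by (simp add: bcont_integral_def Bcontfun_inverse)
qed

lemma norm_bcont_integral: "norm (bcont_integral z) \<le> norm z"
  by (rule norm_bound) (simp add: bcont_integral_apply norm_integral_clamp01)

lemma bounded_linear_bcont_integral: "bounded_linear bcont_integral"
proof (rule bounded_linear_intro[of _ 1])
  have i: "apply_bcontfun z integrable_on {0..s}" for z :: "real \<Rightarrow>\<^sub>C 'a" and s
    by (intro integrable_continuous_interval) simp
  show "bcont_integral (x + y) = bcont_integral x + bcont_integral y" for x y :: "real \<Rightarrow>\<^sub>C 'a"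
    by (rule bcontfun_eqI) (simp add: bcont_integral_apply integral_add i)
  show "bcont_integral (r *\<^sub>R x) = r *\<^sub>R bcont_integral x" for r and x :: "real \<Rightarrow>\<^sub>C 'a"
    by (rule bcontfun_eqI) (simp add: bcont_integral_apply)
qed (simp add: norm_bcont_integral)

text \<open>The superposition operator. Its value is the intended one only if the composite is a
  bounded continuous curve; this is why \<open>u\<close> is always required to stay in a closed
  ball, on which a continuous \<open>F\<close> is bounded.\<close>

definition nemytskii :: "('e \<Rightarrow> 'b) \<Rightarrow> (real \<Rightarrow>\<^sub>C 'e::euclidean_space) \<Rightarrow> (real \<Rightarrow>\<^sub>C
    'b::real_normed_vector)"
  where "nemytskii F u = Bcontfun (\<lambda>t. F (apply_bcontfun u t))"

lemma near_const_bcontfun: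
  assumes "norm (u - const_bcontfun c) \<le> r"
  shows "apply_bcontfun u t \<in> cball c r"
  using norm_bounded[of "u - const_bcontfun c" t] assms by (simp add: dist_norm norm_minus_commute)

lemma nemytskii_apply:
  assumes F: "continuous_on (cball c r) F" and u: "norm (u - const_bcontfun c) \<le> r"
  shows "apply_bcontfun (nemytskii F u) t = F (apply_bcontfun u t)"
proof -
  have "compact (F ` cball c r)" by (intro compact_continuous_image F) simp
  then obtain B where "\<And>x. x \<in> cball c r \<Longrightarrow> norm (F x) \<le> B"
    using compact_imp_bounded bounded_iff by (metis imageI)
  then have "norm (F (apply_bcontfun u x)) \<le> B" for x using near_const_bcontfun[OF u] by blast
  moreover have "continuous_on UNIV (\<lambda>t. F (apply_bcontfun u t))"
    by (rule continuous_on_compose2[OF F]) (use near_const_bcontfun[OF u] in auto)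
  ultimately have "(\<lambda>t. F (apply_bcontfun u t)) \<in> bcontfun" by (intro bcontfun_normI)
  then show ?thesis by (simp add: nemytskii_def Bcontfun_inverse)
qed

text \<open>The operator \<open>z \<mapsto> (t \<mapsto> F'(u t) (z t))\<close>, expanded in a
  basis. Each summand contains \<open>u\<close> only through the superposition operator of a partial
  derivative of \<open>F\<close>, so the induction in \<open>Ck_on_nemytskii\<close> applies to it
  again.\<close>

definition nemytskii_deriv :: "('e \<Rightarrow> 'b) \<Rightarrow> (real \<Rightarrow>\<^sub>C 'e::euclidean_space) \<Rightarrow> (real \<Rightarrow>\<^sub>C 'e) \<Rightarrow>
    (real \<Rightarrow>\<^sub>C 'b::real_normed_vector)" where
  "nemytskii_deriv F u z = (\<Sum>i\<in>Basis. bcont_prod scaleR (bcont_prod inner z (const_bcontfun i))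
     (nemytskii (\<lambda>x. frechet_derivative F (at x) i) u))"

lemma bounded_linear_nemytskii_deriv: "bounded_linear (nemytskii_deriv F u)"
proof -
  have "bounded_linear (\<lambda>z. bcont_prod scaleR (bcont_prod inner z (const_bcontfun i)) h)"
    for i :: 'a and h :: "real \<Rightarrow>\<^sub>C 'b"
    by (rule bounded_linear_compose[OF bounded_bilinear.bounded_linear_left
        bounded_bilinear.bounded_linear_left])
      (intro bounded_bilinear_bcont_prod bounded_bilinear_scaleR bounded_bilinear_inner)+
  then show ?thesis unfolding nemytskii_deriv_def by (intro bounded_linear_sum)
qed

lemma nemytskii_deriv_apply:
  assumes S: "open S" "cball c r \<subseteq> S" and F: "Ck_on (Suc 0) S F" and u: "norm (u - const_bcontfun
      c) \<le> r"
  shows "apply_bcontfun (nemytskii_deriv F u z) t =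
    frechet_derivative F (at (apply_bcontfun u t)) (apply_bcontfun z t)"
proof -
  have c: "continuous_on (cball c r) (\<lambda>x. frechet_derivative F (at x) i)" for i
    by (rule continuous_on_subset[OF _ S(2)]) (use F[unfolded Ck_on_Suc_iff[OF S(1)]] in simp)
  have "F differentiable at (apply_bcontfun u t)"
    using F S near_const_bcontfun[OF u] unfolding Ck_on_Suc_iff[OF S(1)] by blast
  from frechet_derivative_sum_Basis[OF this, of "apply_bcontfun z t"] show ?thesis
    by (simp add: nemytskii_deriv_def apply_bcontfun_sum bcont_prod_apply bounded_bilinear_scaleR
        bounded_bilinear_inner nemytskii_apply[OF c u])
qed

text \<open>The derivative of \<open>F\<close> is uniformly continuous on the compact ball, so the
  error of the linearisation is small uniformly in \<open>t\<close>. The second term in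
  \<open>d0\<close> keeps the perturbed curve inside the ball.\<close>

lemma has_derivative_nemytskii:
  assumes S: "open S" "cball c r \<subseteq> S" and F: "Ck_on (Suc 0) S F" and u: "norm (u - const_bcontfun
      c) < r"
  shows "(nemytskii F has_derivative nemytskii_deriv F u) (at u)"
  unfolding has_derivative_at_alt
proof (intro conjI allI impI bounded_linear_nemytskii_deriv)
  fix e :: real assume e: "e > 0"
  have cF: "continuous_on (cball c r) F" using Ck_on_continuous[OF F] S(2) continuous_on_subset by
      blast
  have d: "F differentiable at x" if "x \<in> cball c r" for x
    using F S that unfolding Ck_on_Suc_iff[OF S(1)] by blast
  let ?D = "\<lambda>x. Blinfun (frechet_derivative F (at x))"
  have "continuous_on (cball c r) ?D"
    using Ck_on_continuous[OF Ck_on_Blinfun_derivative[OF S(1) F]] S(2) continuous_on_subset by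
        blast
  then have "uniformly_continuous_on (cball c r) ?D" by (rule compact_uniformly_continuous) (rule
      compact_cball)
  then obtain \<delta> where \<delta>: "\<delta> > 0" "\<And>x y. x \<in> cball c r \<Longrightarrow> y \<in> cball c r \<Longrightarrow> dist y x < \<delta> \<Longrightarrow> dist (?D y)
      (?D x) < e"
    using e unfolding uniformly_continuous_on_def by meson
  define d0 where "d0 = min \<delta> (r - norm (u - const_bcontfun c))"
  show "\<exists>d>0. \<forall>v. norm (v - u) < d \<longrightarrow>
      norm (nemytskii F v - nemytskii F u - nemytskii_deriv F u (v - u)) \<le> e * norm (v - u)"
  proof (intro exI[of _ d0] conjI allI impI norm_bound)
    show "d0 > 0" using \<delta>(1) u by (simp add: d0_def)
    fix v t assume v: "norm (v - u) < d0"
    have v': "norm (v - const_bcontfun c) \<le> r"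
      using v norm_triangle_ineq[of "v - u" "u - const_bcontfun c"] by (simp add: d0_def)
    let ?x = "apply_bcontfun u t" and ?y = "apply_bcontfun v t"
    have xy: "?x \<in> cball c r" "?y \<in> cball c r" using near_const_bcontfun u v' by (metis
        less_imp_le)+
    have dxy: "norm (?y - ?x) \<le> norm (v - u)" using norm_bounded[of "v - u" t] by simp
    have "norm (F ?y - F ?x - frechet_derivative F (at ?x) (?y - ?x)) \<le> norm (?y - ?x) * e"
    proof (rule differentiable_bound_linearization[where S = "closed_segment ?x ?y"])
      have seg: "z \<in> cball c r" "dist z ?x < \<delta>" if "z \<in> closed_segment ?x ?y" for z
      proof -
        show "z \<in> cball c r" using that xy closed_segment_subset[OF _ _ convex_cball] by blast
        show "dist z ?x < \<delta>"
          using dist_in_closed_segment[OF that] dxy v unfolding d0_def by (simp add: dist_norm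
              norm_minus_commute)
      qed
      show "?x + s *\<^sub>R (?y - ?x) \<in> closed_segment ?x ?y" if "s \<in> {0..1}" for s
        using that by (auto simp: closed_segment_def algebra_simps intro!: exI[of _ s])
      show "(F has_derivative frechet_derivative F (at z)) (at z within closed_segment ?x ?y)"
        if "z \<in> closed_segment ?x ?y" for z
        using d[OF seg(1)[OF that]] by (simp add: frechet_derivative_works
            has_derivative_at_withinI)
      show "onorm (frechet_derivative F (at z) - frechet_derivative F (at ?x)) \<le> e"
        if "z \<in> closed_segment ?x ?y" for z
      proof -
        have "frechet_derivative F (at z) - frechet_derivative F (at ?x) = blinfun_apply (?D z -
            ?D ?x)"
          unfolding blinfun.diff_left[abs_def] fun_diff_def
          by (simp only: Blinfun_frechet_derivative[OF d[OF seg(1)[OF that]]]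
              Blinfun_frechet_derivative[OF d[OF xy(1)]])
        then have "onorm (frechet_derivative F (at z) - frechet_derivative F (at ?x)) = norm (?D z
            - ?D ?x)"
          by (simp add: norm_blinfun.rep_eq)
        also have "\<dots> < e" using \<delta>(2)[OF xy(1) seg(1)[OF that] seg(2)[OF that]] by (simp add:
            dist_norm)
        finally show ?thesis by simp
      qed
    qed simp
    also have "\<dots> \<le> norm (v - u) * e" using dxy e by (intro mult_right_mono) auto
    finally show "norm (apply_bcontfun (nemytskii F v - nemytskii F u - nemytskii_deriv F u (v -
        u)) t) \<le> e * norm (v - u)"
      using u v' by (simp add: nemytskii_apply[OF cF] nemytskii_deriv_apply[OF S F] mult.commute)
  qed
qed

text \<open>The derivative of the composite involves the partial derivatives of \<open>F\<close>, so
  \<open>F\<close> varies in the induction. Smoothness, unlike a fixed order of differentiability,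
  is inherited by them.\<close>

lemma Ck_on_nemytskii:
  assumes S: "open S" "cball c r \<subseteq> S" and Q: "open Q"
    and u: "\<And>s. s \<in> Q \<Longrightarrow> norm (u s - const_bcontfun c) < r"
  shows "smooth_on S F \<Longrightarrow> Ck_on k Q u \<Longrightarrow> Ck_on k Q (\<lambda>s. nemytskii F (u s))"
proof (induction k arbitrary: F)
  case 0
  have "isCont (\<lambda>s. nemytskii F (u s)) s" if s: "s \<in> Q" for s
  proof -
    have F1: "Ck_on (Suc 0) S F" using 0(1) smooth_on_def by blast
    have cu: "isCont u s" using 0(2) Q s continuous_on_eq_continuous_at by auto
    have "isCont (nemytskii F) (u s)"
      by (rule has_derivative_continuous[OF has_derivative_nemytskii[OF S F1 u[OF s]]])
    with cu show ?thesis by (rule isCont_o2)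
  qed
  then show ?case by (simp add: continuous_at_imp_continuous_on)
next
  case (Suc k)
  from Suc.prems(2) obtain u' where u': "\<And>x. x \<in> Q \<Longrightarrow> (u has_derivative u' x) (at x)"
    "\<And>v. Ck_on k Q (\<lambda>x. u' x v)" by (rule Ck_on_SucE) blast
  have F1: "Ck_on (Suc 0) S F" using Suc.prems(1) smooth_on_def by blast
  show ?case
  proof (rule Ck_on_SucI[of _ _ "\<lambda>s v. nemytskii_deriv F (u s) (u' s v)"])
    show "((\<lambda>s. nemytskii F (u s)) has_derivative (\<lambda>v. nemytskii_deriv F (u s) (u' s v))) (at s)"
      if "s \<in> Q" for s
      by (rule has_derivative_compose[OF u'(1)[OF that] has_derivative_nemytskii[OF S F1 u[OF
          that]]])
    show "Ck_on k Q (\<lambda>s. nemytskii_deriv F (u s) (u' s v))" for v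
      unfolding nemytskii_deriv_def
    proof (rule Ck_on_sum)
      fix i
      have 1: "Ck_on k Q (\<lambda>s. bcont_prod inner (u' s v) (const_bcontfun i))"
        by (rule Ck_on_bilinear[OF bounded_bilinear_bcont_prod[OF bounded_bilinear_inner] u'(2)
            Ck_on_const])
      have 2: "Ck_on k Q (\<lambda>s. nemytskii (\<lambda>x. frechet_derivative F (at x) i) (u s))"
        by (rule Suc.IH[OF smooth_on_frechet_derivative[OF S(1) Suc.prems(1)] Ck_on_SucD[OF
            Suc.prems(2)]])
      show "Ck_on k Q (\<lambda>s. bcont_prod scaleR (bcont_prod inner (u' s v) (const_bcontfun i))
          (nemytskii (\<lambda>x. frechet_derivative F (at x) i) (u s)))"
        by (rule Ck_on_bilinear[OF bounded_bilinear_bcont_prod[OF bounded_bilinear_scaleR] 1 2])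
    qed
  qed
qed

text \<open>The inverse of \<open>1 - L\<close> sends \<open>y\<close> to the fixed point of the
  contraction \<open>z \<mapsto> y + L z\<close>. Uniqueness of the fixed point makes this map
  linear, and its bound 2 is the sum of the geometric series with ratio 1/2.\<close>

lemma contraction_inverse:
  fixes L :: "'x::{real_normed_vector, complete_space} \<Rightarrow>\<^sub>L 'x"
  assumes L: "norm L \<le> 1/2"
  obtains R where "R o\<^sub>L (id_blinfun - L) = id_blinfun" "(id_blinfun - L) o\<^sub>L R = id_blinfun"
proof -
  have Lz: "norm (L z) \<le> 1/2 * norm z" for z
    using norm_blinfun[of L z] L mult_right_mono[OF L norm_ge_zero[of z]] by linarith
  have ex: "\<exists>!z. y + L z = z" for y
    by (rule banach_fix_type[of "1/2"]) (auto simp: dist_norm blinfun.diff_right[symmetric]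
        Lz[simplified])
  define f where "f y = (THE z. y + L z = z)" for y
  have f: "y + L (f y) = f y" for y using theI'[OF ex[of y]] by (simp add: f_def)
  have uniq: "z = f y" if "y + L z = z" for y z using ex[of y] f[of y] that by blast
  have "bounded_linear f"
  proof (rule bounded_linear_intro[of _ 2])
    show "f (x + y) = f x + f y" for x y
    proof (rule uniq[symmetric])
      have "(x + L (f x)) + (y + L (f y)) = f x + f y" by (simp only: f)
      then show "x + y + L (f x + f y) = f x + f y" by (simp add: blinfun.add_right algebra_simps)
    qed
    show "f (r *\<^sub>R x) = r *\<^sub>R f x" for r x
      using f[of x] by (intro uniq[symmetric]) (metis blinfun.scaleR_right scaleR_add_right)
    show "norm (f x) \<le> norm x * 2" for x
      using f[of x] Lz[of "f x"] norm_triangle_ineq[of x "L (f x)"] by simp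
  qed
  then have app: "blinfun_apply (Blinfun f) = f" by (rule bounded_linear_Blinfun_apply)
  show ?thesis
  proof (rule that[of "Blinfun f"])
    show "Blinfun f o\<^sub>L (id_blinfun - L) = id_blinfun"
      by (rule blinfun_eqI) (simp add: app blinfun.diff_left uniq[symmetric])
    show "(id_blinfun - L) o\<^sub>L Blinfun f = id_blinfun"
    proof (rule blinfun_eqI)
      show "blinfun_apply ((id_blinfun - L) o\<^sub>L Blinfun f) y = blinfun_apply id_blinfun y" for y
        using f[of y] by (simp add: app blinfun.diff_left algebra_simps)
    qed
  qed
qed

text \<open>The implicit function theorem for a fixed point equation, starting from mere continuity
  of \<open>u\<close>. The linear part \<open>L\<close> and a small multiple of the increment of
  \<open>u\<close> are absorbed on the left, which bounds that increment by a multiple of the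
  increment of \<open>s\<close>; then \<open>R\<close> solves the linearised equation.\<close>

lemma has_derivative_implicit_fixed_point:
  fixes \<Phi> :: "'s::real_normed_vector \<times> 'x::real_normed_vector \<Rightarrow> 'x"
  assumes \<Phi>: "(\<Phi> has_derivative (\<lambda>(h, z). A h + L z)) (at (s, u s))"
    and cont: "isCont u s" and Q: "open Q" "s \<in> Q" and fp: "\<And>s'. s' \<in> Q \<Longrightarrow> u s' = \<Phi> (s', u s')"
    and L: "\<And>z. norm (L z) \<le> 1/2 * norm z" and R: "\<And>z. blinfun_apply R (z - L z) = z"
  shows "(u has_derivative (\<lambda>h. R (A h))) (at s)"
proof -
  have bl: "bounded_linear (\<lambda>(h, z). A h + L z)" using \<Phi> by (rule has_derivative_bounded_linear)
  have L0: "L 0 = 0" using L[of 0] by simp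
  have blA: "bounded_linear A"
    using bounded_linear_compose[OF bl bounded_linear_Pair_left] by (simp add: L0)
  obtain a where a: "a > 0" "\<And>h. norm (A h) \<le> norm h * a"
    using bounded_linear.pos_bounded[OF blA] by blast
  show ?thesis unfolding has_derivative_at_alt
  proof (intro conjI allI impI)
    show "bounded_linear (\<lambda>h. R (A h))" by (rule bounded_linear_compose[OF
        blinfun.bounded_linear_right blA])
    fix e :: real assume e: "e > 0"
    \<comment> \<open>The constant of the final estimate: \<open>norm R + 1\<close> dominates the
      operator \<open>R\<close>, and \<open>1 + 4 * (a + 1)\<close> bounds
      \<open>norm h + norm z\<close> in terms of \<open>norm h\<close>.\<close>
    define m where "m = (norm R + 1) * (1 + 4 * (a + 1))"
    have m: "m > 0" using a(1) by (simp add: m_def add_nonneg_pos)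
    define e' where "e' = min (1/4) (e / m)"
    have e': "e' > 0" "e' \<le> 1/4" "e' * m \<le> e"
      using e m by (auto simp: e'_def min_def field_simps)
    obtain d1 where d1: "d1 > 0" "\<And>w. norm (w - (s, u s)) < d1 \<Longrightarrow>
        norm (\<Phi> w - \<Phi> (s, u s) - (\<lambda>(h, z). A h + L z) (w - (s, u s))) \<le> e' * norm (w - (s, u s))"
      using \<Phi> e'(1) unfolding has_derivative_at_alt by blast
    obtain d2 where d2: "d2 > 0" "\<And>s'. norm (s' - s) < d2 \<Longrightarrow> norm (u s' - u s) < d1 / 2"
      using cont d1(1) unfolding continuous_at_eps_delta dist_norm by (metis half_gt_zero)
    obtain d3 where d3: "d3 > 0" "\<And>s'. norm (s' - s) < d3 \<Longrightarrow> s' \<in> Q"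
      using Q unfolding open_dist dist_norm by blast
    show "\<exists>d>0. \<forall>s'. norm (s' - s) < d \<longrightarrow> norm (u s' - u s - R (A (s' - s))) \<le> e * norm (s' - s)"
    proof (intro exI[of _ "min (d1/2) (min d2 d3)"] conjI allI impI)
      show "min (d1/2) (min d2 d3) > 0" using d1 d2 d3 by simp
      fix s' assume s': "norm (s' - s) < min (d1/2) (min d2 d3)"
      define h z where "h = s' - s" and "z = u s' - u s"
      have hz: "norm (h, z) \<le> norm h + norm z" by (rule norm_Pair_le)
      have "norm ((s', u s') - (s, u s)) < d1"
        using norm_Pair_le[of "s' - s" "u s' - u s"] d2(2)[of s'] s' by (simp add: h_def z_def)
      from d1(2)[OF this] have "norm (z - (A h + L z)) \<le> e' * norm (h, z)"
        using fp[OF Q(2)] fp[OF d3(2)[of s']] s' by (simp add: h_def z_def)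
      also have "\<dots> \<le> e' * (norm h + norm z)" using hz e'(1) by (intro mult_left_mono) auto
      finally have E: "norm (z - (A h + L z)) \<le> e' * (norm h + norm z)" .
      also have "\<dots> \<le> 1/4 * (norm h + norm z)" using e'(2) by (intro mult_right_mono) auto
      finally have "norm z \<le> norm (A h) + norm (L z) + 1/4 * (norm h + norm z)"
        using norm_triangle_sub[of z "A h + L z"] norm_triangle_ineq[of "A h" "L z"] by linarith
      \<comment> \<open>After the terms \<open>1/2 * norm z\<close> and \<open>1/4 * norm z\<close>
        are absorbed, a quarter of \<open>norm z\<close> survives on the left; hence the factor
        4.\<close>
      moreover have "x \<le> 4 * q + y" if "x \<le> p + l + 1/4 * (y + x)" "p \<le> q" "l \<le> 1/2 * x" for x y p
          q l :: real
      proof -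
        have "4 * x \<le> 4 * (p + l + 1/4 * (y + x))" using that(1) by (rule mult_left_mono) simp
        also have "\<dots> = 4 * p + 4 * l + y + x" by (simp add: distrib_left)
        finally have "4 * x \<le> 4 * p + 4 * l + y + x" .
        moreover have "4 * l \<le> 2 * x" using that(3) by simp
        moreover have "4 * p \<le> 4 * q" using that(2) by simp
        ultimately show ?thesis by linarith
      qed
      ultimately have "norm z \<le> 4 * (norm h * a) + norm h" using a(2)[of h] L[of z] by blast
      also have "\<dots> \<le> 4 * (a + 1) * norm h" by (simp add: algebra_simps)
      finally have z: "norm h + norm z \<le> (1 + 4 * (a + 1)) * norm h" by (simp add: algebra_simps)
      have "z - R (A h) = R (z - (A h + L z))"
        using R[of z] by (simp add: blinfun.bilinear_simps algebra_simps)
      then have "norm (z - R (A h)) \<le> norm R * norm (z - (A h + L z))" by (metis norm_blinfun)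
      also have "\<dots> \<le> (norm R + 1) * (e' * (norm h + norm z))"
        using E by (intro mult_mono) auto
      also have "\<dots> \<le> (norm R + 1) * (e' * ((1 + 4 * (a + 1)) * norm h))"
        using z e'(1) by (intro mult_left_mono) auto
      also have "\<dots> = e' * m * norm h" by (simp add: m_def)
      also have "\<dots> \<le> e * norm h" using e'(3) by (intro mult_right_mono) auto
      finally show "norm (u s' - u s - R (A (s' - s))) \<le> e * norm (s' - s)" by (simp add: h_def
          z_def)
    qed
  qed
qed

text \<open>\<open>F x \<lambda>\<close> is a linear family of vector fields which commute with each other.  The integral curve
  \<open>u\<close> of \<open>F _ \<lambda>\<close> from \<open>x\<close> is the fixed point of a contraction on the bounded continuous functions,
  so that it depends smoothly on \<open>(\<lambda>, x)\<close>.  Since the fields commute, \<open>t \<mapsto> t F (u t) \<kappa>\<close> solves the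
  equation of first variation in the direction \<open>(\<kappa>, 0)\<close>.\<close>

lemma commuting_flow:
  fixes F :: "'e::euclidean_space \<Rightarrow> 'k::euclidean_space \<Rightarrow>\<^sub>L 'e"
  assumes S: "open S" "x0 \<in> S" and F: "smooth_on S F"
    and comm: "\<And>x \<kappa> \<mu>. x \<in> S \<Longrightarrow> blinfun_apply (frechet_derivative F (at x) (F x \<kappa>)) \<mu> =
      blinfun_apply (frechet_derivative F (at x) (F x \<mu>)) \<kappa>"
  obtains \<epsilon> \<phi> where "\<epsilon> > 0" "smooth_on (ball 0 \<epsilon> \<times> ball x0 \<epsilon>) \<phi>" "\<phi> ` (ball 0 \<epsilon> \<times> ball x0 \<epsilon>) \<subseteq> S"
    "\<And>x. x \<in> ball x0 \<epsilon> \<Longrightarrow> \<phi> (0, x) = x"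
    "\<And>s \<kappa>. s \<in> ball 0 \<epsilon> \<times> ball x0 \<epsilon> \<Longrightarrow> frechet_derivative \<phi> (at s) (\<kappa>, 0) = F (\<phi> s) \<kappa>"
proof -
  obtain r where r: "r > 0" "cball x0 r \<subseteq> S" using S open_contains_cball by blast
  have F1: "Ck_on (Suc 0) S F" using F smooth_on_def by blast
  have cF: "continuous_on (cball x0 r) F" using smooth_on_continuous[OF F] r(2)
      continuous_on_subset by blast
  have dF: "(F has_derivative frechet_derivative F (at x)) (at x)" if "x \<in> cball x0 r" for x
    using smooth_on_has_derivative[OF F] r(2) that by blast
  let ?D = "\<lambda>x. Blinfun (frechet_derivative F (at x))"
  have Dapp: "blinfun_apply (?D x) = frechet_derivative F (at x)" if "x \<in> cball x0 r" for x
    using dF[OF that] by (simp add: bounded_linear_Blinfun_apply has_derivative_bounded_linear)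
  have cD: "continuous_on (cball x0 r) ?D"
    using Ck_on_continuous[OF Ck_on_Blinfun_derivative[OF S(1) F1]] r(2) continuous_on_subset by
        blast
  have "bounded (F ` cball x0 r)" "bounded (?D ` cball x0 r)"
    by (intro compact_imp_bounded compact_continuous_image cF cD compact_cball)+
  then obtain B C where B: "B > 0" "\<And>x. x \<in> cball x0 r \<Longrightarrow> norm (F x) \<le> B"
    and C: "C > 0" "\<And>x. x \<in> cball x0 r \<Longrightarrow> norm (?D x) \<le> C"
    unfolding bounded_pos by blast
  \<comment> \<open>The starting point and the integral each move the curve by at most
    \<open>r / 4\<close>, by the first two bounds. Fixed points therefore lie in the ball of radius
    \<open>r / 2\<close>, strictly inside the region where the superposition operator is
    differentiable. The third bound makes the contraction factor 1/2.\<close>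
  define \<epsilon> where "\<epsilon> = min (r/4) (min (r / (4 * B)) (1 / (2 * C)))"
  have \<epsilon>: "\<epsilon> > 0" "\<epsilon> \<le> r / 4" "\<epsilon> \<le> r / (4 * B)" "\<epsilon> \<le> 1 / (2 * C)"
    using r B C by (auto simp: \<epsilon>_def)
  have \<epsilon>B: "B * \<epsilon> \<le> r / 4" using \<epsilon>(3) B(1) by (simp add: field_simps)
  have \<epsilon>C: "C * \<epsilon> \<le> 1 / 2" using \<epsilon>(4) C(1) by (simp add: field_simps)
  define Q where "Q = ball (0::'k) \<epsilon> \<times> ball x0 \<epsilon>"
  have oQ: "open Q" by (simp add: Q_def open_Times)
  have Q: "norm (fst s) < \<epsilon>" "norm (snd s - x0) < \<epsilon>" if "s \<in> Q" for s
    using that by (auto simp: Q_def dist_norm norm_minus_commute)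
  define c0 :: "real \<Rightarrow>\<^sub>C 'e" where "c0 = const_bcontfun x0"
  define app :: "(real \<Rightarrow>\<^sub>C 'k \<Rightarrow>\<^sub>L 'e) \<Rightarrow> 'k \<Rightarrow> (real \<Rightarrow>\<^sub>C 'e)"
    where "app f l = bcont_prod blinfun_apply f (const_bcontfun l)" for f l
  note bb = bounded_bilinear_bcont_prod[OF bounded_bilinear_blinfun_apply]
  have app_apply: "apply_bcontfun (app f l) t = blinfun_apply (apply_bcontfun f t) l" for f l t
    by (simp add: app_def bcont_prod_apply[OF bounded_bilinear_blinfun_apply])
  have bapp: "bounded_bilinear app"
    unfolding app_def by (rule bounded_bilinear.comp[OF bb bounded_linear_ident
        bounded_linear_const_bcontfun])
  interpret app: bounded_bilinear app by (rule bapp)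
  have napp: "norm (app f l) \<le> norm f * norm l" for f l
    by (rule norm_bound, unfold app_apply)
      (meson norm_blinfun norm_bounded mult_right_mono norm_ge_zero order_trans)
  note K = bounded_linear_bcont_integral
  interpret K: bounded_linear bcont_integral by (rule K)
  have nK: "norm (bcont_integral (app f l)) \<le> norm f * norm l" for f l
    using napp norm_bcont_integral order_trans by blast
  have bnd: "norm (nemytskii F v) \<le> B" if "norm (v - c0) \<le> r" for v
  proof (rule norm_bound)
    show "norm (apply_bcontfun (nemytskii F v) t) \<le> B" for t
      using B(2)[OF near_const_bcontfun] that by (simp add: c0_def nemytskii_apply[OF cF])
  qed
  have lip: "norm (nemytskii F v - nemytskii F w) \<le> C * norm (v - w)"
    if vw: "norm (v - c0) \<le> r" "norm (w - c0) \<le> r" for v w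
  proof (rule norm_bound)
    fix t
    have m: "apply_bcontfun v t \<in> cball x0 r" "apply_bcontfun w t \<in> cball x0 r"
      using vw near_const_bcontfun by (auto simp: c0_def)
    have "norm (F (apply_bcontfun v t) - F (apply_bcontfun w t)) \<le> C * norm (apply_bcontfun v t -
        apply_bcontfun w t)"
    proof (rule differentiable_bound[OF convex_cball _ _ m])
      show "(F has_derivative frechet_derivative F (at x)) (at x within cball x0 r)" if "x \<in> cball
          x0 r" for x
        using dF[OF that] by (rule has_derivative_at_withinI)
      show "onorm (frechet_derivative F (at x)) \<le> C" if "x \<in> cball x0 r" for x
        using C(2)[OF that] by (simp add: norm_blinfun.rep_eq Dapp[OF that])
    qed
    also have "\<dots> \<le> C * norm (v - w)"
      using norm_bounded[of "v - w" t] C(1) by (intro mult_left_mono) auto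
    finally show "norm (apply_bcontfun (nemytskii F v - nemytskii F w) t) \<le> C * norm (v - w)"
      using vw by (simp add: nemytskii_apply[OF cF] c0_def)
  qed
  \<comment> \<open>The Picard operator of \<open>u' = F u \<lambda>\<close> over the unit interval.
    As the equation is linear in \<open>\<lambda>\<close>, scaling \<open>\<lambda>\<close> replaces
    the flow time, so the joint flow for all times is read off at time 1.\<close>
  define \<Phi> where "\<Phi> w = const_bcontfun (snd (fst w)) + bcont_integral (app (nemytskii F (snd w))
      (fst (fst w)))" for w
  have small: "norm a * norm (fst s) \<le> 1/2 * x" if "s \<in> Q" "norm a \<le> C * x" "x \<ge> 0"
    for s x and a :: "real \<Rightarrow>\<^sub>C 'k \<Rightarrow>\<^sub>L 'e"
  proof -
    have "norm a * norm (fst s) \<le> (C * x) * \<epsilon>"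
      using that Q(1)[OF that(1)] \<epsilon>(1) C(1) by (intro mult_mono) auto
    also have "\<dots> = (C * \<epsilon>) * x" by simp
    also have "\<dots> \<le> 1/2 * x" using \<epsilon>C that(3) by (intro mult_right_mono) auto
    finally show ?thesis .
  qed
  have contr: "norm (\<Phi> (s, v) - \<Phi> (s, w)) \<le> 1/2 * norm (v - w)"
    if s: "s \<in> Q" and vw: "norm (v - c0) \<le> r" "norm (w - c0) \<le> r" for s v w
  proof -
    have "\<Phi> (s, v) - \<Phi> (s, w) = bcont_integral (app (nemytskii F v - nemytskii F w) (fst s))"
      by (simp add: \<Phi>_def K.diff app.diff_left)
    then have "norm (\<Phi> (s, v) - \<Phi> (s, w)) \<le> norm (nemytskii F v - nemytskii F w) * norm (fst s)"
      using nK by simp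
    also have "\<dots> \<le> 1/2 * norm (v - w)" by (rule small[OF s lip[OF vw]]) simp
    finally show ?thesis .
  qed
  have self: "norm (\<Phi> (s, v) - c0) \<le> r / 2" if s: "s \<in> Q" and v: "norm (v - c0) \<le> r" for s v
  proof -
    have "\<Phi> (s, v) - c0 = const_bcontfun (snd s - x0) + bcont_integral (app (nemytskii F v) (fst
        s))"
      by (auto simp: \<Phi>_def c0_def intro!: bcontfun_eqI)
    then have "norm (\<Phi> (s, v) - c0) \<le> norm (const_bcontfun (snd s - x0) :: real \<Rightarrow>\<^sub>C 'e) + norm
        (bcont_integral (app (nemytskii F v) (fst s)))"
      by (metis norm_triangle_ineq)
    moreover have "norm (const_bcontfun (snd s - x0) :: real \<Rightarrow>\<^sub>C 'e) \<le> r / 4"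
      by (rule norm_bound) (use Q(2)[OF s] \<epsilon>(2) in auto)
    moreover have "norm (bcont_integral (app (nemytskii F v) (fst s))) \<le> B * \<epsilon>"
      by (rule order_trans[OF nK]) (use bnd[OF v] Q(1)[OF s] B(1) in \<open>intro mult_mono, auto\<close>)
    ultimately show ?thesis using \<epsilon>B by simp
  qed
  have "\<exists>v. norm (v - c0) \<le> r / 2 \<and> \<Phi> (s, v) = v" if s: "s \<in> Q" for s
  proof -
    have "\<exists>!v\<in>cball c0 (r/2). \<Phi> (s, v) = v"
    proof (rule Banach_fix[of _ "1/2"])
      show "complete (cball c0 (r / 2))" by (simp add: complete_eq_closed)
      show "cball c0 (r / 2) \<noteq> {}" using r(1) by simp
      show "(\<lambda>v. \<Phi> (s, v)) ` cball c0 (r / 2) \<subseteq> cball c0 (r / 2)"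
        using self[OF s] r(1) by (auto simp: dist_norm norm_minus_commute)
      show "dist (\<Phi> (s, v)) (\<Phi> (s, w)) \<le> 1 / 2 * dist v w" if "v \<in> cball c0 (r / 2)" "w \<in> cball c0
          (r / 2)" for v w
        using contr[OF s, of v w] that r(1) by (auto simp: dist_norm norm_minus_commute)
    qed auto
    then show ?thesis by (auto simp: dist_norm norm_minus_commute)
  qed
  then obtain u where u: "\<And>s. s \<in> Q \<Longrightarrow> norm (u s - c0) \<le> r / 2" "\<And>s. s \<in> Q \<Longrightarrow> \<Phi> (s, u s) = u s"
    by metis
  have ur: "norm (u s - c0) < r" "norm (u s - c0) \<le> r" if "s \<in> Q" for s
    using u(1)[OF that] r(1) by auto
  have ucb: "apply_bcontfun (u s) t \<in> cball x0 r" if "s \<in> Q" for s t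
    using near_const_bcontfun ur(2)[OF that] by (auto simp: c0_def)
  define A where "A s h = const_bcontfun (snd h) + bcont_integral (app (nemytskii F (u s)) (fst
      h))" for s h
  have blA: "bounded_linear (A s)" for s
    unfolding A_def
    by (intro bounded_linear_add bounded_linear_compose[OF bounded_linear_const_bcontfun
        bounded_linear_snd]
        bounded_linear_compose[OF K bounded_linear_compose[OF app.bounded_linear_right
            bounded_linear_fst]])
  \<comment> \<open>Both \<open>u s'\<close> and \<open>u s\<close> are fixed points, for different
    parameters. Half of their distance is absorbed by the contraction; what remains is the change of
    \<open>\<Phi>\<close> in its parameter at the fixed curve \<open>u s\<close>, and this is linear
    in \<open>s' - s\<close>.\<close>
  have cu: "isCont u s" if s: "s \<in> Q" for s
  proof -
    have "eventually (\<lambda>s'. s' \<in> Q) (at s)" using oQ s eventually_at_topological by blast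
    then have "eventually (\<lambda>s'. norm (u s' - u s) \<le> 2 * norm (A s (s' - s))) (at s)"
    proof eventually_elim
      case (elim s')
      have "\<Phi> (s', u s) - \<Phi> (s, u s) = A s (s' - s)"
        by (auto simp: \<Phi>_def A_def K.diff app.diff_right intro!: bcontfun_eqI)
      then have "u s' - u s = (\<Phi> (s', u s') - \<Phi> (s', u s)) + A s (s' - s)"
        by (simp flip: \<open>\<Phi> (s', u s) - \<Phi> (s, u s) = A s (s' - s)\<close> add: u(2)[OF elim] u(2)[OF s])
      then have "norm (u s' - u s) \<le> norm (\<Phi> (s', u s') - \<Phi> (s', u s)) + norm (A s (s' - s))"
        by (metis norm_triangle_ineq)
      then show ?case using contr[OF elim ur(2)[OF elim] ur(2)[OF s]] by linarith
    qed
    moreover have "((\<lambda>s'. 2 * norm (A s (s' - s))) \<longlongrightarrow> 2 * norm (A s (s - s))) (at s)"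
      by (intro tendsto_intros bounded_linear.tendsto[OF blA])
    ultimately have "((\<lambda>s'. u s' - u s) \<longlongrightarrow> 0) (at s)"
      by (intro Lim_null_comparison[of "\<lambda>s'. u s' - u s" "\<lambda>s'. 2 * norm (A s (s' - s))"])
        (auto simp: linear_0[OF bounded_linear.linear[OF blA]])
    then show ?thesis unfolding isCont_def using Lim_null by blast
  qed
  define L where "L s z = bcont_integral (app (nemytskii_deriv F (u s) z) (fst s))" for s z
  have nL: "norm (L s z) \<le> 1/2 * norm z" if s: "s \<in> Q" for s z
  proof -
    have "norm (nemytskii_deriv F (u s) z) \<le> C * norm z"
    proof (rule norm_bound)
      fix t
      have "norm (frechet_derivative F (at (apply_bcontfun (u s) t)) (apply_bcontfun z t))
          \<le> norm (?D (apply_bcontfun (u s) t)) * norm (apply_bcontfun z t)"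
        using norm_blinfun[of "?D (apply_bcontfun (u s) t)" "apply_bcontfun z t"] by (simp add:
            Dapp[OF ucb[OF s]])
      also have "\<dots> \<le> C * norm z"
        using C(2)[OF ucb[OF s]] norm_bounded[of z t] C(1) by (intro mult_mono) auto
      finally show "norm (apply_bcontfun (nemytskii_deriv F (u s) z) t) \<le> C * norm z"
        using nemytskii_deriv_apply[OF S(1) r(2) F1] ur(2)[OF s] by (simp add: c0_def)
    qed
    then show ?thesis unfolding L_def using nK small[OF s] by (meson norm_ge_zero order_trans)
  qed
  have d\<Phi>: "(\<Phi> has_derivative (\<lambda>(h, z). A s h + L s z)) (at (s, u s))" if s: "s \<in> Q" for s
  proof -
    have dN: "(nemytskii F has_derivative nemytskii_deriv F (u s)) (at (u s))"
      by (rule has_derivative_nemytskii[OF S(1) r(2) F1]) (use ur(1)[OF s] in \<open>simp add: c0_def\<close>)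
    have d1: "((\<lambda>w. nemytskii F (snd w)) has_derivative (\<lambda>w. nemytskii_deriv F (u s) (snd w))) (at
        (s, u s))"
      by (rule has_derivative_compose[OF bounded_linear_imp_has_derivative[OF
          bounded_linear_snd]]) (simp add: dN)
    have d2: "((\<lambda>w. fst (fst w)) has_derivative (\<lambda>w. fst (fst w))) (at (s, u s))"
      by (rule bounded_linear_imp_has_derivative[OF bounded_linear_compose[OF bounded_linear_fst
          bounded_linear_fst]])
    have d3: "((\<lambda>w. const_bcontfun (snd (fst w))) has_derivative (\<lambda>w. const_bcontfun (snd (fst
        w)))) (at (s, u s))"
      by (rule bounded_linear_imp_has_derivative[OF bounded_linear_compose[OF
          bounded_linear_const_bcontfun
          bounded_linear_compose[OF bounded_linear_snd bounded_linear_fst]]])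
    show ?thesis
      unfolding \<Phi>_def
      by (rule has_derivative_eq_rhs[OF has_derivative_add[OF d3 K.has_derivative[OF app.FDERIV[OF
          d1 d2]]]])
        (simp add: fun_eq_iff A_def L_def K.add)
  qed
  let ?N = "\<lambda>i s. app (nemytskii (\<lambda>x. frechet_derivative F (at x) i) (u s)) (fst s)"
  have bs: "bounded_bilinear (bcont_prod (scaleR :: real \<Rightarrow> 'e \<Rightarrow> 'e))"
    and bi: "bounded_bilinear (bcont_prod (inner :: 'e \<Rightarrow> 'e \<Rightarrow> real))"
    by (intro bounded_bilinear_bcont_prod bounded_bilinear_scaleR bounded_bilinear_inner)+
  \<comment> \<open>The operator \<open>L s\<close>, assembled from bilinear operations on terms
    whose regularity in \<open>s\<close> is known. Thus its regularity can be read off, and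
    \<open>Ck_on_blinfun_inverse\<close> passes it on to the inverse \<open>R\<close> of
    \<open>1 - Lb\<close>.\<close>
  define Lb where "Lb s = (\<Sum>i\<in>Basis. Blinfun bcont_integral o\<^sub>L (bounded_bilinear.prod_left
      (bcont_prod scaleR) (?N i s)
    o\<^sub>L bounded_bilinear.prod_left (bcont_prod inner) (const_bcontfun i)))" for s
  have Lb: "blinfun_apply (Lb s) z = L s z" if s: "s \<in> Q" for s z
  proof -
    have "app (bcont_prod scaleR a f) l = bcont_prod scaleR a (app f l)" for a f l
      by (rule bcontfun_eqI) (simp add: app_apply bcont_prod_apply bounded_bilinear_scaleR
          blinfun.scaleR_left)
    then show ?thesis
      by (simp add: Lb_def L_def nemytskii_deriv_def blinfun.sum_left app.sum_left K.sum
          bounded_linear_Blinfun_apply[OF K] bounded_bilinear.prod_left.rep_eq[OF bs]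
              bounded_bilinear.prod_left.rep_eq[OF bi])
  qed
  have nLb: "norm (Lb s) \<le> 1/2" if "s \<in> Q" for s
    by (rule norm_blinfun_bound) (use nL[OF that] Lb[OF that] in auto)
  have "\<exists>R. R o\<^sub>L (id_blinfun - Lb s) = id_blinfun \<and> (id_blinfun - Lb s) o\<^sub>L R = id_blinfun" if "s
      \<in> Q" for s
    using contraction_inverse[OF nLb[OF that]] by blast
  then obtain R where R: "\<And>s. s \<in> Q \<Longrightarrow> R s o\<^sub>L (id_blinfun - Lb s) = id_blinfun"
    "\<And>s. s \<in> Q \<Longrightarrow> (id_blinfun - Lb s) o\<^sub>L R s = id_blinfun" by metis
  have RL: "R s (z - L s z) = z" if "s \<in> Q" for s z
  proof -
    have "blinfun_apply (R s o\<^sub>L (id_blinfun - Lb s)) z = z" using R(1)[OF that] by simp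
    then show ?thesis by (simp add: blinfun.diff_left Lb[OF that])
  qed
  have du: "(u has_derivative (\<lambda>h. R s (A s h))) (at s)" if s: "s \<in> Q" for s
    by (rule has_derivative_implicit_fixed_point[OF d\<Phi>[OF s] cu[OF s] oQ s _ nL[OF s] RL[OF s]])
        (simp add: u(2))
  \<comment> \<open>The derivative of \<open>u\<close> at \<open>s\<close> is
    \<open>R s (A s h)\<close>, where \<open>R\<close> and \<open>A\<close> are built from
    \<open>u\<close> itself without differentiating it. Each round of the induction therefore gains
    one order.\<close>
  have Cu: "Ck_on k Q u" for k
  proof (induction k)
    case 0 show ?case using cu by (simp add: continuous_at_imp_continuous_on)
  next
    case (Suc k)
    have fQ: "Ck_on k Q fst" by (rule Ck_on_linear[OF bounded_linear_fst])
    have cN: "Ck_on k Q (\<lambda>s. nemytskii G (u s))" if "smooth_on S G" for G :: "'e \<Rightarrow> 'k \<Rightarrow>\<^sub>L 'e"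
      by (rule Ck_on_nemytskii[OF S(1) r(2) oQ _ that Suc]) (use ur(1) in \<open>auto simp: c0_def\<close>)
    have cA: "Ck_on k Q (\<lambda>s. A s h)" for h
      unfolding A_def
      by (intro Ck_on_add Ck_on_const Ck_on_bounded_linear[OF K]
          Ck_on_bilinear[OF bapp cN[OF F] Ck_on_const])
    have "Ck_on k Q (\<lambda>s. ?N i s)" for i
      by (rule Ck_on_bilinear[OF bapp cN[OF smooth_on_frechet_derivative[OF S(1) F]] fQ])
    then have "Ck_on k Q Lb"
      unfolding Lb_def
      by (intro Ck_on_sum Ck_on_bilinear[OF bounded_bilinear_blinfun_compose] Ck_on_const
          Ck_on_bounded_linear[OF bounded_bilinear.bounded_linear_prod_left[OF bs]])
    then have "Ck_on k Q (\<lambda>s. id_blinfun + - Lb s)"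
      by (intro Ck_on_add Ck_on_const Ck_on_bounded_linear[OF bounded_linear_minus[OF
          bounded_linear_ident]])
    then have "Ck_on k Q R"
      by (intro Ck_on_blinfun_inverse[OF oQ R]) auto
    then show ?case
      by (intro Ck_on_SucI[OF du]) (auto intro: Ck_on_bilinear[OF bounded_bilinear_blinfun_apply _
          cA])
  qed
  define \<phi> where "\<phi> s = apply_bcontfun (u s) 1" for s
  have fp: "apply_bcontfun (u s) t = snd s + integral {0..clamp01 t} (\<lambda>q. blinfun_apply (F
      (apply_bcontfun (u s) q)) (fst s))"
    if s: "s \<in> Q" for s t
  proof -
    have "apply_bcontfun (u s) t = apply_bcontfun (\<Phi> (s, u s)) t" using u(2)[OF s] by simp
    also have "\<dots> = snd s + integral {0..clamp01 t} (apply_bcontfun (app (nemytskii F (u s)) (fst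
        s)))"
      by (simp add: \<Phi>_def bcont_integral_apply)
    also have "apply_bcontfun (app (nemytskii F (u s)) (fst s)) = (\<lambda>q. blinfun_apply (F
        (apply_bcontfun (u s) q)) (fst s))"
      using nemytskii_apply[OF cF] ur(2)[OF s] by (simp add: fun_eq_iff app_apply c0_def)
    finally show ?thesis .
  qed
  show ?thesis
  proof (rule that[OF \<epsilon>(1), of \<phi>, folded Q_def])
    show "smooth_on Q \<phi>"
      unfolding smooth_on_def \<phi>_def using Ck_on_bounded_linear[OF bounded_linear_apply_bcontfun
          Cu] by blast
    show "\<phi> ` Q \<subseteq> S" using ucb r(2) by (auto simp: \<phi>_def)
    show "\<phi> (0, x) = x" if "x \<in> ball x0 \<epsilon>" for x
      unfolding \<phi>_def using fp[of "(0, x)" 1] that \<epsilon>(1) by (simp add: Q_def)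
  next
    fix s \<kappa> assume s: "s \<in> Q"
    let ?u = "apply_bcontfun (u s)"
    have "(\<phi> has_derivative (\<lambda>h. apply_bcontfun (R s (A s h)) 1)) (at s)"
      unfolding \<phi>_def by (rule bounded_linear.has_derivative[OF bounded_linear_apply_bcontfun
          du[OF s]])
    then have fd: "frechet_derivative \<phi> (at s) = (\<lambda>h. apply_bcontfun (R s (A s h)) 1)"
      by (metis frechet_derivative_at)
    define cl where "cl = Bcontfun clamp01"
    have cl: "apply_bcontfun cl t = clamp01 t" for t
    proof -
      have "clamp01 \<in> bcontfun" by (rule bcontfun_normI[OF continuous_on_clamp01, of 1]) simp
      then show ?thesis by (simp add: cl_def Bcontfun_inverse)
    qed
    define y where "y = bcont_prod scaleR cl (app (nemytskii F (u s)) \<kappa>)"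
    have y: "apply_bcontfun y t = clamp01 t *\<^sub>R F (?u t) \<kappa>" for t
      using nemytskii_apply[OF cF] ur(2)[OF s]
      by (simp add: y_def bcont_prod_apply bounded_bilinear_scaleR cl app_apply c0_def)
    have "y = A s (\<kappa>, 0) + L s y"
    proof (rule bcontfun_eqI)
      fix t
      define c where "c = clamp01 t"
      have c: "0 \<le> c" "c \<le> 1" by (simp_all add: c_def)
      have du': "(?u has_vector_derivative F (?u q) (fst s)) (at q within {0..c})" if q: "q \<in>
          {0..c}" for q
      proof -
        have q1: "q \<in> {0..1}" using q c by auto
        have cI: "continuous_on {0..1} (\<lambda>q. F (?u q) (fst s))"
          by (rule continuous_on_compose2[OF bounded_linear.continuous_on[OF
              blinfun.bounded_linear_left cF]])
            (use ucb[OF s] in auto)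
        have "((\<lambda>t. snd s + integral {0..t} (\<lambda>q. F (?u q) (fst s))) has_vector_derivative F (?u q)
            (fst s)) (at q within {0..1})"
          using integral_has_vector_derivative[OF cI q1] by (auto intro!: derivative_eq_intros)
        then have "(?u has_vector_derivative F (?u q) (fst s)) (at q within {0..1})"
        proof (rule has_vector_derivative_transform[OF q1, rotated])
          fix t :: real assume "t \<in> {0..1}"
          then have "clamp01 t = t" by auto
          then show "?u t = snd s + integral {0..t} (\<lambda>q. F (?u q) (fst s))" using fp[OF s, of t]
              by (simp only:)
        qed
        then show ?thesis by (rule has_vector_derivative_within_subset) (use c in auto)
      qed
      \<comment> \<open>The derivative of \<open>q *\<^sub>R F (?u q) \<kappa>\<close> contains the
        derivative of \<open>F\<close> along \<open>F (?u q) (fst s)\<close>, applied to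
        \<open>\<kappa>\<close>. Commutation exchanges \<open>\<kappa>\<close> and
        \<open>fst s\<close>, so that this term becomes the derivative of \<open>F\<close> along
        \<open>y\<close>, as the equation of first variation requires.\<close>
      have "((\<lambda>q. F (?u q) \<kappa> + blinfun_apply (frechet_derivative F (at (?u q)) (apply_bcontfun y
          q)) (fst s))
          has_integral c *\<^sub>R F (?u c) \<kappa> - 0 *\<^sub>R F (?u 0) \<kappa>) {0..c}"
      proof (rule fundamental_theorem_of_calculus[OF c(1)])
        fix q assume q: "q \<in> {0..c}"
        have cq: "clamp01 q = q" using q c by auto
        have uS: "?u q \<in> S" using ucb[OF s] r(2) by blast
        have "((\<lambda>q. F (?u q)) has_derivative (\<lambda>h. frechet_derivative F (at (?u q)) (h *\<^sub>R F (?u q)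
            (fst s)))) (at q within {0..c})"
          using has_derivative_compose[OF du'[OF q, unfolded has_vector_derivative_def] dF[OF
              ucb[OF s]]] .
        then have 1: "((\<lambda>q. F (?u q) \<kappa>) has_derivative (\<lambda>h. blinfun_apply (frechet_derivative F
            (at (?u q)) (h *\<^sub>R F (?u q) (fst s))) \<kappa>)) (at q within {0..c})"
          by (rule bounded_linear.has_derivative[OF blinfun.bounded_linear_left])
        note lin = linear_scale[OF has_derivative_linear[OF dF[OF ucb[OF s]]]]
        have "((\<lambda>q. q *\<^sub>R F (?u q) \<kappa>) has_derivative (\<lambda>h. q *\<^sub>R blinfun_apply (frechet_derivative
            F (at (?u q)) (h *\<^sub>R F (?u q) (fst s))) \<kappa> + h *\<^sub>R F (?u q) \<kappa>)) (at q within {0..c})"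
          by (rule has_derivative_scaleR[OF has_derivative_ident 1])
        then show "((\<lambda>q. q *\<^sub>R F (?u q) \<kappa>) has_vector_derivative F (?u q) \<kappa> + blinfun_apply
            (frechet_derivative F (at (?u q)) (apply_bcontfun y q)) (fst s)) (at q within {0..c})"
          unfolding has_vector_derivative_def
          by (rule has_derivative_eq_rhs)
            (simp add: fun_eq_iff y cq lin blinfun.scaleR_left comm[OF uS] algebra_simps)
      qed
      then have I: "integral {0..c} (\<lambda>q. F (?u q) \<kappa> + blinfun_apply (frechet_derivative F (at (?u
          q)) (apply_bcontfun y q)) (fst s)) = c *\<^sub>R F (?u c) \<kappa>"
        by (simp add: integral_unique)
      have fN: "apply_bcontfun (app (nemytskii F (u s)) \<kappa>) q = F (?u q) \<kappa>" for q
        using nemytskii_apply[OF cF] ur(2)[OF s] by (simp add: app_apply c0_def)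
      have fD: "apply_bcontfun (app (nemytskii_deriv F (u s) y) (fst s)) q =
          blinfun_apply (frechet_derivative F (at (?u q)) (apply_bcontfun y q)) (fst s)" for q
        using nemytskii_deriv_apply[OF S(1) r(2) F1] ur(2)[OF s] by (simp add: app_apply c0_def)
      have "A s (\<kappa>, 0) + L s y = bcont_integral (app (nemytskii F (u s)) \<kappa> + app (nemytskii_deriv
          F (u s) y) (fst s))"
        by (simp add: A_def L_def K.add)
      then have "apply_bcontfun (A s (\<kappa>, 0) + L s y) t = c *\<^sub>R F (?u c) \<kappa>"
        by (simp only: bcont_integral_apply c_def[symmetric] plus_bcontfun.rep_eq fN fD I)
      also have "?u c = ?u t" using fp[OF s, of t] fp[OF s, of c] by (simp add: c_def)
      finally show "apply_bcontfun y t = apply_bcontfun (A s (\<kappa>, 0) + L s y) t" by (simp add: y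
          c_def)
    qed
    then have "y - L s y = A s (\<kappa>, 0)" by (simp add: algebra_simps)
    then have "R s (A s (\<kappa>, 0)) = y" using RL[OF s, of y] by simp
    then show "frechet_derivative \<phi> (at s) (\<kappa>, 0) = F (\<phi> s) \<kappa>"
      by (simp add: fd y \<phi>_def)
  qed
qed

text \<open>\<open>\<Psi>\<close> flows out of the affine slice through \<open>x0\<close> that is
  orthogonal to the fields at \<open>x0\<close>. At the origin its derivative is \<open>F x0\<close>
  on the first factor and an isometry onto the orthogonal complement of the range of
  \<open>F x0\<close> on the second. This map is injective, hence bijective by the dimension
  hypothesis, and the inverse function theorem applies.\<close>

lemma commuting_flow_box:
  fixes F :: "'e::euclidean_space \<Rightarrow> 'k::euclidean_space \<Rightarrow>\<^sub>L 'e"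
  assumes S: "open S" "x0 \<in> S" and F: "smooth_on S F"
    and comm: "\<And>x \<kappa> \<mu>. x \<in> S \<Longrightarrow> blinfun_apply (frechet_derivative F (at x) (F x \<kappa>)) \<mu> =
      blinfun_apply (frechet_derivative F (at x) (F x \<mu>)) \<kappa>"
    and inj: "inj (blinfun_apply (F x0))" and dim: "DIM('k) + DIM('f::euclidean_space) = DIM('e)"
  obtains r \<Psi> G where "r > 0" "smooth_on (ball 0 r \<times> ball (0::'f) r) \<Psi>"
    "\<Psi> ` (ball 0 r \<times> ball 0 r) \<subseteq> S" "\<Psi> (0, 0) = x0" "open (\<Psi> ` (ball 0 r \<times> ball 0 r))"
    "smooth_on (\<Psi> ` (ball 0 r \<times> ball 0 r)) G" "\<And>z. z \<in> ball 0 r \<times> ball 0 r \<Longrightarrow> G (\<Psi> z) = z"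
    "\<And>z \<kappa>. z \<in> ball 0 r \<times> ball 0 r \<Longrightarrow> frechet_derivative \<Psi> (at z) (\<kappa>, 0) = F (\<Psi> z) \<kappa>"
proof -
  obtain \<epsilon> \<phi> where \<epsilon>: "\<epsilon> > 0" and \<phi>: "smooth_on (ball 0 \<epsilon> \<times> ball x0 \<epsilon>) \<phi>"
    "\<phi> ` (ball 0 \<epsilon> \<times> ball x0 \<epsilon>) \<subseteq> S" "\<And>x. x \<in> ball x0 \<epsilon> \<Longrightarrow> \<phi> (0, x) = x"
    "\<And>s \<kappa>. s \<in> ball 0 \<epsilon> \<times> ball x0 \<epsilon> \<Longrightarrow> frechet_derivative \<phi> (at s) (\<kappa>, 0) = F (\<phi> s) \<kappa>"
    using commuting_flow[OF S F comm] by blast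
  let ?B = "ball (0::'k) \<epsilon> \<times> ball x0 \<epsilon>"
  have oB: "open ?B" by (simp add: open_Times)
  define T where "T = range (blinfun_apply (F x0))"
  define T' where "T' = {y. \<forall>x\<in>T. orthogonal x y}"
  have lF: "linear (blinfun_apply (F x0))" using blinfun.bounded_linear_right
      bounded_linear.linear by blast
  have sT: "subspace T" unfolding T_def using lF subspace_UNIV linear_subspace_image by blast
  have sT': "subspace T'" unfolding T'_def by (rule subspace_orthogonal_to_vectors)
  have "dim T = dim (UNIV :: 'k set)" unfolding T_def
    by (rule dim_image_eq[OF lF]) (use inj in simp)
  then have dT: "dim T = DIM('k)" by simp
  have "dim {y \<in> UNIV. \<forall>x\<in>T. orthogonal x y} + dim T = dim (UNIV :: 'e set)"
    by (rule dim_subspace_orthogonal_to_vectors[OF sT subspace_UNIV]) simp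
  then have dT': "dim T' = DIM('f)" using dT dim by (simp add: T'_def)
  obtain l where l: "linear l" "range l = T'" "inj (l :: 'f \<Rightarrow> 'e)"
  proof -
    obtain f g where "linear f" "linear g" "f ` (UNIV :: 'f set) = T'" "g ` T' = UNIV"
      "\<And>x. x \<in> (UNIV :: 'f set) \<Longrightarrow> norm (f x) = norm x" "\<And>y. y \<in> T' \<Longrightarrow> norm (g y) = norm y"
      "\<And>x. x \<in> (UNIV :: 'f set) \<Longrightarrow> g (f x) = x" "\<And>y. y \<in> T' \<Longrightarrow> f (g y) = y"
      by (rule isometries_subspaces[OF subspace_UNIV sT', where 'a = 'f]) (auto simp: dT')
    then show ?thesis using that[of f] by (metis UNIV_I inj_on_inverseI)
  qed
  have bl: "bounded_linear l" using l(1) by (simp add: linear_conv_bounded_linear)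
  have l0: "l 0 = 0" using l(1) by (rule linear_0)
  define w :: "'k \<times> 'f \<Rightarrow> 'k \<times> 'e" where "w z = (fst z, x0 + l (snd z))" for z
  have bll: "bounded_linear (\<lambda>z :: 'k \<times> 'f. l (snd z))" by (rule bounded_linear_compose[OF bl
      bounded_linear_snd])
  have dw: "(w has_derivative (\<lambda>h. (fst h, l (snd h)))) (at z)" for z
    unfolding w_def
    by (rule has_derivative_Pair[OF bounded_linear_imp_has_derivative[OF bounded_linear_fst]])
      (use has_derivative_add[OF has_derivative_const bounded_linear_imp_has_derivative[OF bll]]
          in simp)
  have sw: "smooth_on X w" for X
    unfolding w_def
    by (intro smooth_on_Pair smooth_on_add smooth_on_const smooth_on_linear[OF bll]
        smooth_on_linear[OF bounded_linear_fst])
  define P0 where "P0 = w -` ?B"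
  have oP0: "open P0"
    unfolding P0_def by (rule open_vimage[OF oB smooth_on_continuous[OF sw]])
  define \<Psi> where "\<Psi> z = \<phi> (w z)" for z
  have s\<Psi>: "smooth_on P0 \<Psi>"
    unfolding \<Psi>_def by (rule smooth_on_compose[OF sw \<phi>(1) oP0 oB]) (auto simp: P0_def)
  have d\<Psi>: "(\<Psi> has_derivative (\<lambda>h. frechet_derivative \<phi> (at (w z)) (fst h, l (snd h)))) (at z)" if
      "z \<in> P0" for z
    unfolding \<Psi>_def
    by (rule has_derivative_compose[OF dw]) (use that in \<open>auto simp: P0_def intro!:
        smooth_on_has_derivative[OF \<phi>(1)]\<close>)
  have z0: "(0, 0) \<in> P0" using \<epsilon> by (simp add: P0_def w_def l0)
  have w0: "w (0, 0) = (0, x0)" by (simp add: w_def l0)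
  have wB: "(0, x0) \<in> ?B" using \<epsilon> by simp
  have e1: "frechet_derivative \<phi> (at (0, x0)) (0, v) = v" for v
  proof -
    have 1: "((\<lambda>x. (0, x)) has_derivative (\<lambda>x. (0, x))) (at x0)"
      by (rule bounded_linear_imp_has_derivative[OF bounded_linear_Pair_right])
    have "((\<lambda>x. \<phi> (0, x)) has_derivative (\<lambda>v. frechet_derivative \<phi> (at (0, x0)) (0, v))) (at x0)"
      by (rule has_derivative_compose[OF 1 smooth_on_has_derivative[OF \<phi>(1) wB]])
    moreover have "((\<lambda>x. \<phi> (0, x)) has_derivative (\<lambda>v. v)) (at x0)"
      by (rule has_derivative_transform_within_open[OF has_derivative_ident open_ball[of x0 \<epsilon>]])
        (use \<epsilon> \<phi>(3) in auto)
    ultimately have "(\<lambda>v. frechet_derivative \<phi> (at (0, x0)) (0, v)) = (\<lambda>v. v)"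
      by (rule has_derivative_unique)
    then show ?thesis by (rule fun_cong)
  qed
  have e2: "frechet_derivative \<phi> (at (0, x0)) (\<kappa>, 0) = F x0 \<kappa>" for \<kappa>
    using \<phi>(4)[OF wB] \<phi>(3)[of x0] \<epsilon> by simp
  have e3: "frechet_derivative \<phi> (at (0, x0)) (\<kappa>, v) = F x0 \<kappa> + v" for \<kappa> v
    unfolding e2[symmetric] using e1[of v] linear_add[OF has_derivative_linear[OF
        smooth_on_has_derivative[OF \<phi>(1) wB]], of "(\<kappa>, 0)" "(0, v)"] by simp
  have d0: "(\<Psi> has_derivative (\<lambda>h. F x0 (fst h) + l (snd h))) (at (0, 0))"
    by (intro has_derivative_eq_rhs[OF d\<Psi>[OF z0]]) (simp add: w0 fun_eq_iff e3)
  have lin0: "linear (\<lambda>h :: 'k \<times> 'f. F x0 (fst h) + l (snd h))" using d0 by (rule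
      has_derivative_linear)
  have inj0: "inj (\<lambda>h :: 'k \<times> 'f. F x0 (fst h) + l (snd h))"
    unfolding linear_injective_0[OF lin0]
  proof (intro allI impI)
    fix h :: "'k \<times> 'f" assume h: "F x0 (fst h) + l (snd h) = 0"
    have "F x0 (fst h) \<in> T" by (simp add: T_def)
    moreover have "l (snd h) \<in> T'" using l(2) by auto
    ultimately have "F x0 (fst h) \<bullet> l (snd h) = 0" by (simp add: T'_def orthogonal_def)
    moreover have "F x0 (fst h) = - l (snd h)" using h by (simp add: eq_neg_iff_add_eq_0)
    ultimately have "l (snd h) = 0" "F x0 (fst h) = 0" by auto
    then have "snd h = 0" "fst h = 0"
      using linear_injective_0[OF l(1)] l(3) linear_injective_0[OF lF] inj by auto
    then show "h = 0" by (simp add: prod_eq_iff)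
  qed
  have "surj (\<lambda>h :: 'k \<times> 'f. F x0 (fst h) + l (snd h))"
  proof -
    have "dim (range (\<lambda>h :: 'k \<times> 'f. F x0 (fst h) + l (snd h))) = dim (UNIV :: ('k \<times> 'f) set)"
      by (rule dim_image_eq[OF lin0]) (use inj0 in simp)
    then have "span (range (\<lambda>h :: 'k \<times> 'f. F x0 (fst h) + l (snd h))) = UNIV"
      using dim by (simp add: dim_eq_full[symmetric])
    moreover have "span (range (\<lambda>h :: 'k \<times> 'f. F x0 (fst h) + l (snd h))) = range (\<lambda>h :: 'k \<times> 'f.
        F x0 (fst h) + l (snd h))"
      unfolding span_eq_iff by (rule linear_subspace_image[OF lin0 subspace_UNIV])
    ultimately show ?thesis by simp
  qed
  with inj0 have bij: "bij (\<lambda>h :: 'k \<times> 'f. F x0 (fst h) + l (snd h))" by (simp add: bij_def)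
  obtain U' V g where U': "open U'" "U' \<subseteq> P0" "(0, 0) \<in> U'" "open V" "\<Psi> (0, 0) \<in> V"
    "homeomorphism U' V \<Psi> g" "smooth_on V g"
    using oP0 s\<Psi> z0 d0 bij by (rule smooth_inverse_function)
  obtain r where r: "r > 0" "ball (0::'k) r \<times> ball (0::'f) r \<subseteq> U'"
  proof -
    obtain A B where AB0: "open A" "open B" "(0, 0) \<in> A \<times> B" "A \<times> B \<subseteq> U'"
      using U'(1,3) by (rule open_prod_elim)
    then have AB: "open A" "open B" "0 \<in> A" "0 \<in> B" "A \<times> B \<subseteq> U'" by auto
    obtain a where a: "a > 0" "ball 0 a \<subseteq> A" using AB(1,3) openE by blast
    obtain b where b: "b > 0" "ball 0 b \<subseteq> B" using AB(2,4) openE by blast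
    have "ball 0 (min a b) \<subseteq> A" "ball 0 (min a b) \<subseteq> B"
      using subset_ball[of "min a b" a] subset_ball[of "min a b" b] a b by auto
    then have "ball 0 (min a b) \<times> ball 0 (min a b) \<subseteq> U'" using AB(5) by blast
    moreover have "min a b > 0" using a b by simp
    ultimately show ?thesis using that by blast
  qed
  let ?P = "ball (0::'k) r \<times> ball (0::'f) r"
  have PV: "\<Psi> ` ?P = V \<inter> g -` ?P" using U'(6) r(2) by (auto simp: homeomorphism_def image_iff;
      force)
  have oP: "open (\<Psi> ` ?P)"
    unfolding PV using continuous_on_open_vimage[OF U'(4)] smooth_on_continuous[OF U'(7)]
        open_Times[OF open_ball open_ball]
    by (metis Int_commute)
  show ?thesis
  proof (rule that[of r \<Psi> g])
    show "smooth_on ?P \<Psi>" using s\<Psi> r(2) U'(2) smooth_on_subset by blast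
    show "\<Psi> ` ?P \<subseteq> S" using r(2) U'(2) \<phi>(2) unfolding \<Psi>_def P0_def by blast
    show "\<Psi> (0, 0) = x0" using w0 \<phi>(3)[of x0] \<epsilon> by (simp add: \<Psi>_def)
    show "smooth_on (\<Psi> ` ?P) g" using U'(7) smooth_on_subset PV by blast
    show "g (\<Psi> z) = z" if "z \<in> ?P" for z using U'(6) r(2) that by (auto simp: homeomorphism_def)
    fix z \<kappa> assume "z \<in> ?P"
    then have z: "z \<in> P0" using r(2) U'(2) by blast
    have "frechet_derivative \<Psi> (at z) = (\<lambda>h. frechet_derivative \<phi> (at (w z)) (fst h, l (snd h)))"
      using d\<Psi>[OF z] by (metis frechet_derivative_at)
    then show "frechet_derivative \<Psi> (at z) (\<kappa>, 0) = F (\<Psi> z) \<kappa>"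
      using \<phi>(4)[of "w z" \<kappa>] z by (simp add: l0 \<Psi>_def P0_def)
  qed (use r oP in auto)
qed


subsection \<open>Charts and smooth functions\<close>

text \<open>A coordinate map compatible with the atlas but not necessarily a member of it, with
  values in an arbitrary Euclidean space. Both freedoms are needed: flow box coordinates take values
  in \<open>(real \<times> real) \<times> 'f\<close>, while the atlas is modelled on
  \<open>'e\<close>.\<close>

locale smooth_chart =
  fixes M :: "('a, 'e::euclidean_space) mfd" and U :: "'a set" and \<theta> :: "'a \<Rightarrow> 'h::euclidean_space"
  assumes manifold: "smooth_manifold M" and open_dom: "openin (mtop M) U" and inj: "inj_on \<theta> U"
    and open_iff: "\<And>W. W \<subseteq> U \<Longrightarrow> openin (mtop M) W \<longleftrightarrow> open (\<theta> ` W)"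
    and trans1: "\<And>C \<phi>. (C, \<phi>) \<in> atlas M \<Longrightarrow> smooth_on (\<phi> ` (C \<inter> U)) (\<lambda>x. \<theta> (inv_into C \<phi> x))"
    and trans2: "\<And>C \<phi>. (C, \<phi>) \<in> atlas M \<Longrightarrow> smooth_on (\<theta> ` (C \<inter> U)) (\<lambda>x. \<phi> (inv_into U \<theta> x))"

lemma manifold_point_chart:
  assumes "smooth_manifold M" "p \<in> topspace (mtop M)"
  obtains C \<phi> where "(C, \<phi>) \<in> atlas M" "p \<in> C"
  using assms unfolding smooth_manifold_def by blast

lemma atlas_smooth_chart:
  assumes M: "smooth_manifold M" and C: "(C, \<phi>) \<in> atlas M"
  shows "smooth_chart M C \<phi>"
proof -
  have o: "openin (mtop M) C" "open (\<phi> ` C)"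
    and hm: "homeomorphic_map (subtopology (mtop M) C) (top_of_set (\<phi> ` C)) \<phi>"
  proof -
    have "\<forall>(C, \<phi>) \<in> atlas M. openin (mtop M) C \<and> open (\<phi> ` C) \<and>
        homeomorphic_map (subtopology (mtop M) C) (top_of_set (\<phi> ` C)) \<phi>"
      using M unfolding smooth_manifold_def by blast
    from bspec[OF this C] show "openin (mtop M) C" "open (\<phi> ` C)"
      "homeomorphic_map (subtopology (mtop M) C) (top_of_set (\<phi> ` C)) \<phi>" by simp_all
  qed
  have tr: "smooth_on (\<phi>' ` (C' \<inter> D)) (\<psi> \<circ> inv_into C' \<phi>')"
    if "(C', \<phi>') \<in> atlas M" "(D, \<psi>) \<in> atlas M" for C' \<phi>' D \<psi>
  proof -
    have "\<forall>(C, \<phi>) \<in> atlas M. \<forall>(D, \<psi>) \<in> atlas M. smooth_on (\<phi> ` (C \<inter> D)) (\<psi> \<circ> inv_into C \<phi>)"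
      using M[unfolded smooth_manifold_def] by (elim conjE)
    from bspec[OF this that(1), unfolded prod.case]
    have "\<forall>(D, \<psi>) \<in> atlas M. smooth_on (\<phi>' ` (C' \<inter> D)) (\<psi> \<circ> inv_into C' \<phi>')" .
    from bspec[OF this that(2), unfolded prod.case] show ?thesis .
  qed
  have ts: "topspace (subtopology (mtop M) C) = C"
    using o(1) openin_subset by (metis topspace_subtopology_subset)
  show ?thesis
  proof
    show "inj_on \<phi> C" using homeomorphic_imp_injective_map[OF hm] ts by simp
    show "openin (mtop M) W \<longleftrightarrow> open (\<phi> ` W)" if W: "W \<subseteq> C" for W
    proof -
      have "openin (mtop M) W \<longleftrightarrow> openin (subtopology (mtop M) C) W"
        using openin_open_subtopology[OF o(1)] W by auto
      also have "\<dots> \<longleftrightarrow> openin (top_of_set (\<phi> ` C)) (\<phi> ` W)"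
        using homeomorphic_map_openness[OF hm, of W] W ts by auto
      also have "\<dots> \<longleftrightarrow> open (\<phi> ` W)" using openin_open_eq[OF o(2)] W by auto
      finally show ?thesis .
    qed
    show "smooth_on (\<phi>' ` (C' \<inter> C)) (\<lambda>x. \<phi> (inv_into C' \<phi>' x))" if "(C', \<phi>') \<in> atlas M" for C' \<phi>'
      using tr[OF that C] by (simp add: o_def)
    show "smooth_on (\<phi> ` (C' \<inter> C)) (\<lambda>x. \<phi>' (inv_into C \<phi> x))" if "(C', \<phi>') \<in> atlas M" for C' \<phi>'
      using tr[OF C that] by (simp add: o_def Int_commute)
  qed (use M o in auto)
qed

context smooth_chart
begin

abbreviation "\<Omega> \<equiv> inv_into U \<theta>"

lemma \<Omega>_\<theta> [simp]: "p \<in> U \<Longrightarrow> \<Omega> (\<theta> p) = p" using inj by simp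
lemma \<theta>_\<Omega> [simp]: "x \<in> \<theta> ` U \<Longrightarrow> \<theta> (\<Omega> x) = x" by (rule f_inv_into_f)
lemma \<Omega>_in: "W \<subseteq> U \<Longrightarrow> x \<in> \<theta> ` W \<Longrightarrow> \<Omega> x \<in> W" using \<Omega>_\<theta> by auto

lemma smooth_fun_iff:
  assumes W: "W \<subseteq> U" "openin (mtop M) W"
  shows "smooth_fun M W f \<longleftrightarrow> smooth_on (\<theta> ` W) (\<lambda>x. f (\<Omega> x))"
proof
  assume f: "smooth_fun M W f"
  show "smooth_on (\<theta> ` W) (\<lambda>x. f (\<Omega> x))"
  proof (rule smooth_on_local)
    show oW: "open (\<theta> ` W)" using W open_iff by blast
    fix x assume "x \<in> \<theta> ` W"
    then obtain p where p: "p \<in> W" "x = \<theta> p" by blast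
    then have "p \<in> topspace (mtop M)" using W(2) openin_subset by blast
    then obtain C \<phi> where C: "(C, \<phi>) \<in> atlas M" "p \<in> C" by (rule manifold_point_chart[OF manifold])
    interpret C: smooth_chart M C \<phi> by (rule atlas_smooth_chart[OF manifold C(1)])
    have o: "openin (mtop M) (C \<inter> W)" using C.open_dom W(2) by blast
    have 1: "smooth_on (\<phi> ` (C \<inter> W)) (\<lambda>y. f (inv_into C \<phi> y))"
      using f C(1) unfolding smooth_fun_def by (auto simp: o_def)
    have 2: "smooth_on (\<theta> ` (C \<inter> W)) (\<lambda>x. \<phi> (\<Omega> x))"
      by (rule smooth_on_subset[OF trans2[OF C(1)]]) (use W in auto)
    have oo: "open (\<theta> ` (C \<inter> W))" "open (\<phi> ` (C \<inter> W))"
      using o open_iff[of "C \<inter> W"] C.open_iff[of "C \<inter> W"] W by auto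
    have im: "\<Omega> y \<in> C \<inter> W" if "y \<in> \<theta> ` (C \<inter> W)" for y using \<Omega>_in[of "C \<inter> W"] W that by auto
    have "smooth_on (\<theta> ` (C \<inter> W)) (\<lambda>x. f (inv_into C \<phi> (\<phi> (\<Omega> x))))"
      by (rule smooth_on_compose[OF 2 1 oo]) (use im in auto)
    then have "smooth_on (\<theta> ` (C \<inter> W)) (\<lambda>x. f (\<Omega> x))"
      by (subst smooth_on_cong[OF oo(1), of _ "\<lambda>x. f (inv_into C \<phi> (\<phi> (\<Omega> x)))"]) (use im in auto)
    then have "smooth_on (\<theta> ` W \<inter> \<theta> ` (C \<inter> W)) (\<lambda>x. f (\<Omega> x))" by (rule smooth_on_subset) auto
    then show "\<exists>T. open T \<and> x \<in> T \<and> smooth_on (\<theta> ` W \<inter> T) (\<lambda>x. f (\<Omega> x))"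
      using oo(1) p C(2) by blast
  qed
next
  assume f: "smooth_on (\<theta> ` W) (\<lambda>x. f (\<Omega> x))"
  show "smooth_fun M W f" unfolding smooth_fun_def
  proof (intro conjI W(2) ballI, clarify)
    fix C \<phi> assume C: "(C, \<phi>) \<in> atlas M"
    interpret C: smooth_chart M C \<phi> by (rule atlas_smooth_chart[OF manifold C])
    have o: "openin (mtop M) (C \<inter> W)" using C.open_dom W(2) by blast
    have oo: "open (\<phi> ` (C \<inter> W))" "open (\<theta> ` W)"
      using o open_iff[of W] C.open_iff[of "C \<inter> W"] W by auto
    have im: "inv_into C \<phi> y \<in> C \<inter> W" if "y \<in> \<phi> ` (C \<inter> W)" for y using C.\<Omega>_in[of "C \<inter> W"] that by
        auto
    have 1: "smooth_on (\<phi> ` (C \<inter> W)) (\<lambda>x. \<theta> (inv_into C \<phi> x))"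
      by (rule smooth_on_subset[OF trans1[OF C]]) (use W in auto)
    have "smooth_on (\<phi> ` (C \<inter> W)) (\<lambda>x. f (\<Omega> (\<theta> (inv_into C \<phi> x))))"
      by (rule smooth_on_compose[OF 1 f oo]) (use im in auto)
    moreover have "\<Omega> (\<theta> (inv_into C \<phi> x)) = inv_into C \<phi> x" if "x \<in> \<phi> ` (C \<inter> W)" for x
      using im[OF that] W by auto
    ultimately have "smooth_on (\<phi> ` (C \<inter> W)) (\<lambda>x. f (inv_into C \<phi> x))"
      using smooth_on_cong[OF oo(1), of "\<lambda>x. f (\<Omega> (\<theta> (inv_into C \<phi> x)))" "\<lambda>x. f (inv_into C \<phi> x)"]
          by simp
    then show "smooth_on (\<phi> ` (C \<inter> W)) (f \<circ> inv_into C \<phi>)" by (simp add: o_def)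
  qed
qed

end

lemma smooth_funD: "smooth_fun M W f \<Longrightarrow> openin (mtop M) W"
  by (simp add: smooth_fun_def)

lemma smooth_fun_subset:
  assumes "smooth_fun M W f" "W' \<subseteq> W" "openin (mtop M) W'"
  shows "smooth_fun M W' f"
proof -
  have "smooth_on (\<phi> ` (C \<inter> W')) (f \<circ> inv_into C \<phi>)" if "(C, \<phi>) \<in> atlas M" for C \<phi>
    by (rule smooth_on_subset[of "\<phi> ` (C \<inter> W)"]) (use assms that in \<open>auto simp: smooth_fun_def\<close>)
  then show ?thesis using assms(3) by (auto simp: smooth_fun_def)
qed

lemma atlas_image_open:
  assumes "smooth_manifold M" "(C, \<phi>) \<in> atlas M" "openin (mtop M) W"
  shows "open (\<phi> ` (C \<inter> W))"
proof -
  interpret C: smooth_chart M C \<phi> by (rule atlas_smooth_chart[OF assms(1,2)])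
  show ?thesis using C.open_iff[of "C \<inter> W"] C.open_dom assms(3) by auto
qed

lemma smooth_fun_cong:
  assumes M: "smooth_manifold M" and eq: "\<And>x. x \<in> W \<Longrightarrow> f x = h x"
  shows "smooth_fun M W f \<longleftrightarrow> smooth_fun M W h"
proof -
  have "smooth_on (\<phi> ` (C \<inter> W)) (f \<circ> inv_into C \<phi>) \<longleftrightarrow> smooth_on (\<phi> ` (C \<inter> W)) (h \<circ> inv_into C \<phi>)"
    if o: "openin (mtop M) W" and C: "(C, \<phi>) \<in> atlas M" for C \<phi>
  proof (rule smooth_on_cong[OF atlas_image_open[OF M C o]])
    interpret C: smooth_chart M C \<phi> by (rule atlas_smooth_chart[OF M C])
    show "(f \<circ> inv_into C \<phi>) x = (h \<circ> inv_into C \<phi>) x" if "x \<in> \<phi> ` (C \<inter> W)" for x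
      using C.\<Omega>_in[of "C \<inter> W"] that eq by auto
  qed
  then show ?thesis by (auto simp: smooth_fun_def)
qed

lemma smooth_fun_const: "openin (mtop M) W \<Longrightarrow> smooth_fun M W (\<lambda>x. c)"
  by (auto simp: smooth_fun_def o_def smooth_on_const)

lemma smooth_fun_add: "smooth_fun M W f \<Longrightarrow> smooth_fun M W h \<Longrightarrow> smooth_fun M W (\<lambda>x. f x + h x)"
  and smooth_fun_mult: "smooth_fun M W f \<Longrightarrow> smooth_fun M W h \<Longrightarrow> smooth_fun M W (\<lambda>x. f x * h x)"
  unfolding smooth_fun_def by (auto simp: o_def intro!: smooth_on_add smooth_on_mult)

lemma smooth_fun_cmult: "smooth_fun M W f \<Longrightarrow> smooth_fun M W (\<lambda>x. c * f x)"
  using smooth_fun_mult[OF smooth_fun_const[OF smooth_funD]] by blast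

lemma smooth_fun_diff: "smooth_fun M W f \<Longrightarrow> smooth_fun M W h \<Longrightarrow> smooth_fun M W (\<lambda>x. f x - h x)"
  using smooth_fun_add[of M W f "\<lambda>x. -1 * h x"] smooth_fun_cmult[of M W h "-1"] by simp

lemma smooth_nearI: "smooth_fun M W f \<Longrightarrow> p \<in> W \<Longrightarrow> smooth_near M p f"
  unfolding smooth_near_def by blast

lemma smooth_nearE:
  assumes "smooth_near M p f" "openin (mtop M) A" "p \<in> A"
  obtains W where "smooth_fun M W f" "W \<subseteq> A" "p \<in> W"
proof -
  obtain W where W: "smooth_fun M W f" "p \<in> W" using assms(1) unfolding smooth_near_def by blast
  then have "smooth_fun M (W \<inter> A) f"
    using smooth_fun_subset[OF W(1)] smooth_funD[OF W(1)] assms(2) by auto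
  then show ?thesis using that[of "W \<inter> A"] W assms by auto
qed

lemma smooth_near_topspace: "smooth_near M p f \<Longrightarrow> p \<in> topspace (mtop M)"
  unfolding smooth_near_def using smooth_funD openin_subset by blast

lemma smooth_near_lin:
  assumes "smooth_near M p f" "smooth_near M p h"
  shows "smooth_near M p (\<lambda>x. a * f x + b * h x)" "smooth_near M p (\<lambda>x. f x * h x)"
proof -
  obtain W where W: "smooth_fun M W f" "p \<in> W" using assms(1) unfolding smooth_near_def by blast
  obtain W' where W': "smooth_fun M W' h" "W' \<subseteq> W" "p \<in> W'"
    by (rule smooth_nearE[OF assms(2) smooth_funD[OF W(1)] W(2)])
  have f: "smooth_fun M W' f" using smooth_fun_subset[OF W(1) W'(2) smooth_funD[OF W'(1)]] .
  show "smooth_near M p (\<lambda>x. a * f x + b * h x)"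
    by (rule smooth_nearI[OF smooth_fun_add[OF smooth_fun_cmult[OF f] smooth_fun_cmult[OF W'(1)]]
        W'(3)])
  show "smooth_near M p (\<lambda>x. f x * h x)"
    by (rule smooth_nearI[OF smooth_fun_mult[OF f W'(1)] W'(3)])
qed

lemma smooth_near_const: "p \<in> topspace (mtop M) \<Longrightarrow> smooth_near M p (\<lambda>x. c)"
  by (rule smooth_nearI[OF smooth_fun_const[OF openin_topspace]])

lemma smooth_near_cong:
  assumes M: "smooth_manifold M" and W: "openin (mtop M) W" "p \<in> W" and eq: "\<And>x. x \<in> W \<Longrightarrow> f x = h x"
  shows "smooth_near M p f \<longleftrightarrow> smooth_near M p h"
proof -
  have "smooth_near M p h'" if f: "smooth_near M p f'" and eq: "\<And>x. x \<in> W \<Longrightarrow> f' x = h' x" for f' h'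
  proof -
    obtain W' where W': "smooth_fun M W' f'" "W' \<subseteq> W" "p \<in> W'" by (rule smooth_nearE[OF f W])
    then have "smooth_fun M W' h'" using smooth_fun_cong[OF M, of W' f' h'] eq by blast
    then show ?thesis using W'(3) by (rule smooth_nearI)
  qed
  from this[of f h] this[of h f] show ?thesis using eq by auto
qed

subsection \<open>Tangent vectors\<close>

lemma tangent_not_smooth: "v \<in> tangent_space M p \<Longrightarrow> \<not> smooth_near M p f \<Longrightarrow> v f = 0"
  by (simp add: tangent_space_def)

lemma tangent_lin: "v \<in> tangent_space M p \<Longrightarrow> smooth_near M p f \<Longrightarrow> smooth_near M p h \<Longrightarrow>
    v (\<lambda>x. a * f x + b * h x) = a * v f + b * v h"
  by (simp add: tangent_space_def)

lemma tangent_mult: "v \<in> tangent_space M p \<Longrightarrow> smooth_near M p f \<Longrightarrow> smooth_near M p h \<Longrightarrow>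
    v (\<lambda>x. f x * h x) = f p * v h + h p * v f"
  by (simp add: tangent_space_def)

lemma tangent_add: "v \<in> tangent_space M p \<Longrightarrow> smooth_near M p f \<Longrightarrow> smooth_near M p h \<Longrightarrow>
    v (\<lambda>x. f x + h x) = v f + v h"
  using tangent_lin[of v M p f h 1 1] by simp

lemma tangent_diff: "v \<in> tangent_space M p \<Longrightarrow> smooth_near M p f \<Longrightarrow> smooth_near M p h \<Longrightarrow>
    v (\<lambda>x. f x - h x) = v f - v h"
  using tangent_lin[of v M p f h 1 "-1"] by simp

lemma tangent_const:
  assumes v: "v \<in> tangent_space M p"
  shows "v (\<lambda>x. c) = 0"
proof (cases "p \<in> topspace (mtop M)")
  case True
  note s = smooth_near_const[OF True]
  have "v (\<lambda>x. 1) = 0" using tangent_mult[OF v s s, of 1 1] by simp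
  then show ?thesis using tangent_lin[OF v s s, of c 1 0 1] by simp
next
  case False
  then show ?thesis by (intro tangent_not_smooth[OF v] notI) (drule smooth_near_topspace, simp)
qed

text \<open>A function that vanishes near \<open>p\<close> equals its product with the indicator function of the
  complement of a neighbourhood of \<open>p\<close>, so the Leibniz rule makes derivations local without any
  bump functions.\<close>

lemma tangent_cong:
  assumes M: "smooth_manifold M" and v: "v \<in> tangent_space M p"
    and W: "openin (mtop M) W" "p \<in> W" and eq: "\<And>x. x \<in> W \<Longrightarrow> f x = h x"
  shows "v f = v h"
proof -
  have iff: "smooth_near M p f \<longleftrightarrow> smooth_near M p h" by (rule smooth_near_cong[OF M W]) (rule eq)
  show ?thesis
  proof (cases "smooth_near M p f")
    case False
    then have "\<not> smooth_near M p h" using iff by simp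
    then show ?thesis using False tangent_not_smooth[OF v] by simp
  next
    case True
    then have h: "smooth_near M p h" using iff by simp
    define ind :: "'a \<Rightarrow> real" where "ind x = (if x \<in> W then 0 else 1)" for x
    have "smooth_fun M W ind" using smooth_fun_const[OF W(1), of 0] smooth_fun_cong[OF M, of W ind
        "\<lambda>x. 0"] by (simp add: ind_def)
    then have ind: "smooth_near M p ind" using W(2) by (rule smooth_nearI)
    let ?d = "\<lambda>x. 1 * f x + (-1) * h x"
    have d: "smooth_near M p ?d" by (rule smooth_near_lin(1)[OF True h])
    have "?d = (\<lambda>x. ?d x * ind x)" using eq by (auto simp: ind_def)
    then have "v ?d = v (\<lambda>x. ?d x * ind x)" by simp
    also have "\<dots> = 0" using tangent_mult[OF v d ind] W(2) eq by (simp add: ind_def)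
    finally show ?thesis using tangent_lin[OF v True h, of 1 "-1"] by simp
  qed
qed

lemma tangent_sum:
  assumes v: "v \<in> tangent_space M p" and p: "p \<in> topspace (mtop M)" and I: "finite I"
    and f: "\<And>i. i \<in> I \<Longrightarrow> smooth_near M p (f i)"
  shows "v (\<lambda>x. \<Sum>i\<in>I. f i x) = (\<Sum>i\<in>I. v (f i)) \<and> smooth_near M p (\<lambda>x. \<Sum>i\<in>I. f i x)"
  using I f
proof (induction I)
  case empty then show ?case using tangent_const[OF v] smooth_near_const[OF p] by simp
next
  case (insert i I)
  then have IH: "v (\<lambda>x. \<Sum>i\<in>I. f i x) = (\<Sum>i\<in>I. v (f i))" "smooth_near M p (\<lambda>x. \<Sum>i\<in>I. f i x)"
    and i: "smooth_near M p (f i)" by auto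
  have "smooth_near M p (\<lambda>x. f i x + (\<Sum>i\<in>I. f i x))" using smooth_near_lin(1)[OF i IH(2), of 1 1]
      by simp
  then show ?case using tangent_add[OF v i IH(2)] IH(1) insert.hyps by simp
qed

lemma tangent_zero: "0 \<in> tangent_space M p"
  by (simp add: tangent_space_def)

lemma tangent_plus: "u \<in> tangent_space M p \<Longrightarrow> v \<in> tangent_space M p \<Longrightarrow> u + v \<in> tangent_space M p"
  by (simp add: tangent_space_def algebra_simps)

lemma tangent_scale: "u \<in> tangent_space M p \<Longrightarrow> tscale c u \<in> tangent_space M p"
  by (simp add: tangent_space_def tscale_def algebra_simps)

lemma tangent_uminus: "u \<in> tangent_space M p \<Longrightarrow> - u \<in> tangent_space M p"
  by (simp add: tangent_space_def algebra_simps)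

lemma tangent_minus: "u \<in> tangent_space M p \<Longrightarrow> v \<in> tangent_space M p \<Longrightarrow> u - v \<in> tangent_space M p"
  using tangent_plus[OF _ tangent_uminus] by (metis diff_conv_add_uminus)

lemma tscale_1 [simp]: "tscale 1 u = u"
  and tscale_0 [simp]: "tscale 0 u = 0" "tscale c 0 = 0"
  by (auto simp: tscale_def)

lemma tscale_m1: "tscale (-1) u = - u"
  by (auto simp: tscale_def)

subsection \<open>Coordinate vectors\<close>

context smooth_chart
begin

definition cvec :: "'a \<Rightarrow> 'h \<Rightarrow> 'a tvec" where
  "cvec p w = (\<lambda>f. if smooth_near M p f then frechet_derivative (\<lambda>x. f (\<Omega> x)) (at (\<theta> p)) w else 0)"

definition ccomp :: "'a tvec \<Rightarrow> 'h" where
  "ccomp v = (\<Sum>i\<in>Basis. v (\<lambda>q. \<theta> q \<bullet> i) *\<^sub>R i)"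

lemma U_topspace: "U \<subseteq> topspace (mtop M)" using open_dom by (rule openin_subset)

lemma smooth_near_chart:
  assumes "smooth_near M p f" "p \<in> U"
  obtains W where "openin (mtop M) W" "W \<subseteq> U" "p \<in> W" "open (\<theta> ` W)" "smooth_on (\<theta> ` W) (\<lambda>x. f (\<Omega>
      x))"
    "smooth_fun M W f"
proof -
  obtain W where W: "smooth_fun M W f" "W \<subseteq> U" "p \<in> W" by (rule smooth_nearE[OF assms(1) open_dom
      assms(2)])
  then show ?thesis using that[of W] smooth_funD[OF W(1)] open_iff smooth_fun_iff by blast
qed

lemma chart_differentiable:
  assumes "smooth_near M p f" "p \<in> U"
  shows "((\<lambda>x. f (\<Omega> x)) has_derivative frechet_derivative (\<lambda>x. f (\<Omega> x)) (at (\<theta> p))) (at (\<theta> p))"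
proof -
  obtain W where W: "openin (mtop M) W" "W \<subseteq> U" "p \<in> W" "open (\<theta> ` W)" "smooth_on (\<theta> ` W) (\<lambda>x. f
      (\<Omega> x))"
    "smooth_fun M W f"
    by (rule smooth_near_chart[OF assms])
  show ?thesis by (rule smooth_on_has_derivative[OF W(5)]) (use W in auto)
qed

lemma cvec_tangent: assumes p: "p \<in> U" shows "cvec p w \<in> tangent_space M p"
proof -
  let ?D = "\<lambda>f. frechet_derivative (\<lambda>x. f (\<Omega> x)) (at (\<theta> p))"
  have "cvec p w (\<lambda>x. a * f x + b * h x) = a * cvec p w f + b * cvec p w h"
    "cvec p w (\<lambda>x. f x * h x) = f p * cvec p w h + h p * cvec p w f"
    if fh: "smooth_near M p f" "smooth_near M p h" for f h a b
  proof -
    note d = chart_differentiable[OF fh(1) p] chart_differentiable[OF fh(2) p]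
    have "((\<lambda>x. a * f (\<Omega> x) + b * h (\<Omega> x)) has_derivative (\<lambda>w. a * ?D f w + b * ?D h w)) (at (\<theta> p))"
      by (intro has_derivative_add has_derivative_mult_right d)
    then have 1: "?D (\<lambda>x. a * f x + b * h x) = (\<lambda>w. a * ?D f w + b * ?D h w)" by (rule
        frechet_derivative_at[symmetric])
    have "((\<lambda>x. f (\<Omega> x) * h (\<Omega> x)) has_derivative (\<lambda>w. f (\<Omega> (\<theta> p)) * ?D h w + ?D f w * h (\<Omega> (\<theta>
        p)))) (at (\<theta> p))"
      by (intro has_derivative_mult d)
    then have 2: "?D (\<lambda>x. f x * h x) = (\<lambda>w. f (\<Omega> (\<theta> p)) * ?D h w + ?D f w * h (\<Omega> (\<theta> p)))" by (rule
        frechet_derivative_at[symmetric])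
    show "cvec p w (\<lambda>x. a * f x + b * h x) = a * cvec p w f + b * cvec p w h"
      using smooth_near_lin(1)[OF fh] fh by (simp add: cvec_def 1)
    show "cvec p w (\<lambda>x. f x * h x) = f p * cvec p w h + h p * cvec p w f"
      using smooth_near_lin(2)[OF fh] fh p by (simp add: cvec_def 2)
  qed
  then show ?thesis by (simp add: tangent_space_def cvec_def)
qed

lemma cvec_lin: "p \<in> U \<Longrightarrow> cvec p (a *\<^sub>R w + b *\<^sub>R z) = tscale a (cvec p w) + tscale b (cvec p z)"
  using has_derivative_linear[OF chart_differentiable]
  by (auto simp: cvec_def tscale_def fun_eq_iff linear_add linear_scale)

lemma cvec_zero: "p \<in> U \<Longrightarrow> cvec p 0 = 0"
  using cvec_lin[of p 0 0 0 0] by simp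

lemma coord_smooth: "smooth_fun M U (\<lambda>q. \<theta> q \<bullet> i)"
proof -
  have o: "open (\<theta> ` U)" using open_iff open_dom by blast
  have "smooth_on (\<theta> ` U) (\<lambda>x. x \<bullet> i)" by (rule smooth_on_linear[OF bounded_linear_inner_left])
  then have "smooth_on (\<theta> ` U) (\<lambda>x. \<theta> (\<Omega> x) \<bullet> i)"
    by (subst smooth_on_cong[OF o, of _ "\<lambda>x. x \<bullet> i"]) auto
  then show ?thesis using smooth_fun_iff[OF order_refl open_dom] by blast
qed

lemma ccomp_cvec: assumes p: "p \<in> U" shows "ccomp (cvec p w) = w"
proof -
  have o: "open (\<theta> ` U)" using open_iff open_dom by blast
  have "cvec p w (\<lambda>q. \<theta> q \<bullet> i) = w \<bullet> i" for i
  proof -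
    have "((\<lambda>x. \<theta> (\<Omega> x) \<bullet> i) has_derivative (\<lambda>w. w \<bullet> i)) (at (\<theta> p))"
      by (rule has_derivative_transform_within_open[OF bounded_linear_imp_has_derivative[OF
          bounded_linear_inner_left] o])
        (use p in auto)
    then have "frechet_derivative (\<lambda>x. \<theta> (\<Omega> x) \<bullet> i) (at (\<theta> p)) = (\<lambda>w. w \<bullet> i)" by (rule
        frechet_derivative_at[symmetric])
    then show ?thesis using smooth_nearI[OF coord_smooth p] by (simp add: cvec_def)
  qed
  then show ?thesis by (simp add: ccomp_def euclidean_representation)
qed

text \<open>By Hadamard's lemma \<open>f\<close> is a constant plus a sum of products of functions
  vanishing at \<open>p\<close> with smooth coefficients. A derivation kills the constant, and the
  Leibniz rule leaves only the values of the coefficients at \<open>p\<close>, which are the partial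
  derivatives of \<open>f\<close>.\<close>

lemma tangent_eq_cvec:
  assumes p: "p \<in> U" and v: "v \<in> tangent_space M p"
  shows "v = cvec p (ccomp v)"
proof
  fix f show "v f = cvec p (ccomp v) f"
  proof (cases "smooth_near M p f")
    case False then show ?thesis using tangent_not_smooth[OF v] by (simp add: cvec_def)
  next
    case True
    let ?F = "\<lambda>x. f (\<Omega> x)" and ?c = "\<theta> p"
    obtain W where W: "openin (mtop M) W" "W \<subseteq> U" "p \<in> W" "open (\<theta> ` W)" "smooth_on (\<theta> ` W) ?F"
      "smooth_fun M W f"
      by (rule smooth_near_chart[OF True p])
    obtain r where r: "r > 0" "ball ?c r \<subseteq> \<theta> ` W" using W(3,4) openE by blast
    obtain h where h: "\<And>i. smooth_on (ball ?c r) (h i)"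
      "\<And>x. x \<in> ball ?c r \<Longrightarrow> ?F x = ?F ?c + (\<Sum>i\<in>Basis. ((x - ?c) \<bullet> i) * h i x)"
      "\<And>i. h i ?c = frechet_derivative ?F (at ?c) i"
      by (rule Hadamard_lemma[OF smooth_on_subset[OF W(5) r(2)] r(1)]) blast
    define B where "B = {q \<in> W. \<theta> q \<in> ball ?c r}"
    have BW: "B \<subseteq> W" "B \<subseteq> U" using W by (auto simp: B_def)
    have \<theta>B: "\<theta> ` B = ball ?c r" using r(2) by (force simp: B_def)
    have oB: "openin (mtop M) B" using open_iff[OF BW(2)] \<theta>B by simp
    have pB: "p \<in> B" using W(3) r(1) by (simp add: B_def)
    have sh: "smooth_near M p (\<lambda>q. h i (\<theta> q))" for i
    proof -
      have "\<theta> (\<Omega> x) = x" if "x \<in> ball ?c r" for x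
        using r(2) W(2) that by (intro \<theta>_\<Omega>) blast
      then have "smooth_on (\<theta> ` B) (\<lambda>x. h i (\<theta> (\<Omega> x)))"
        unfolding \<theta>B by (subst smooth_on_cong[OF open_ball, of _ _ _ "h i"]) (simp_all add: h(1))
      then have "smooth_fun M B (\<lambda>q. h i (\<theta> q))" using smooth_fun_iff[OF BW(2) oB] by blast
      then show ?thesis using pB by (rule smooth_nearI)
    qed
    have pt: "p \<in> topspace (mtop M)" using p U_topspace by blast
    note sc = smooth_near_const[OF pt]
    have s\<theta>: "smooth_near M p (\<lambda>q. \<theta> q \<bullet> i)" for i using smooth_nearI[OF coord_smooth p] .
    have s\<theta>c: "smooth_near M p (\<lambda>q. \<theta> q \<bullet> i - ?c \<bullet> i)"
      and v\<theta>c: "v (\<lambda>q. \<theta> q \<bullet> i - ?c \<bullet> i) = v (\<lambda>q. \<theta> q \<bullet> i)" for i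
      using smooth_near_lin(1)[OF s\<theta> sc, of 1 i "-1" "?c \<bullet> i"] tangent_diff[OF v s\<theta> sc, of i "?c \<bullet>
          i"] tangent_const[OF v]
      by simp_all
    have sp: "smooth_near M p (\<lambda>q. (\<theta> q \<bullet> i - ?c \<bullet> i) * h i (\<theta> q))" for i
      by (rule smooth_near_lin(2)[OF s\<theta>c sh])
    have vp: "v (\<lambda>q. (\<theta> q \<bullet> i - ?c \<bullet> i) * h i (\<theta> q)) = frechet_derivative ?F (at ?c) i * v (\<lambda>q. \<theta>
        q \<bullet> i)" for i
      using tangent_mult[OF v s\<theta>c sh, of i i] by (simp add: v\<theta>c h(3))
    have sum: "v (\<lambda>q. \<Sum>i\<in>Basis. (\<theta> q \<bullet> i - ?c \<bullet> i) * h i (\<theta> q)) = (\<Sum>i\<in>Basis. v (\<lambda>q. (\<theta> q \<bullet> i - ?c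
        \<bullet> i) * h i (\<theta> q)))
        \<and> smooth_near M p (\<lambda>q. \<Sum>i\<in>Basis. (\<theta> q \<bullet> i - ?c \<bullet> i) * h i (\<theta> q))"
      by (rule tangent_sum[OF v pt finite_Basis sp])
    have "v f = v (\<lambda>q. f p + (\<Sum>i\<in>Basis. (\<theta> q \<bullet> i - ?c \<bullet> i) * h i (\<theta> q)))"
    proof (rule tangent_cong[OF manifold v oB pB])
      fix q assume q: "q \<in> B"
      then have "\<theta> q \<in> ball ?c r" "q \<in> U" using BW by (auto simp: B_def)
      then show "f q = f p + (\<Sum>i\<in>Basis. (\<theta> q \<bullet> i - ?c \<bullet> i) * h i (\<theta> q))"
        using h(2)[of "\<theta> q"] p by (simp add: inner_diff_left)
    qed
    also have "\<dots> = (\<Sum>i\<in>Basis. v (\<lambda>q. \<theta> q \<bullet> i) * frechet_derivative ?F (at ?c) i)"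
      by (simp only: tangent_add[OF v sc conjunct2[OF sum]] tangent_const[OF v] conjunct1[OF sum]
          vp)
        (simp add: mult.commute)
    also have "\<dots> = frechet_derivative ?F (at ?c) (ccomp v)"
    proof -
      have lin: "linear (frechet_derivative ?F (at ?c))" using chart_differentiable[OF True p]
          has_derivative_linear by blast
      show ?thesis by (simp add: ccomp_def linear_sum[OF lin] linear_scale[OF lin])
    qed
    also have "\<dots> = cvec p (ccomp v) f" using True by (simp add: cvec_def)
    finally show ?thesis .
  qed
qed

end

subsection \<open>Vector fields and the Lie bracket\<close>

lemma smooth_vf_open: "smooth_vf M U X \<Longrightarrow> openin (mtop M) U"
  and smooth_vf_tangent: "smooth_vf M U X \<Longrightarrow> p \<in> U \<Longrightarrow> X p \<in> tangent_space M p"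
  by (auto simp: smooth_vf_def)

lemma smooth_vf_fun: "smooth_vf M U X \<Longrightarrow> smooth_fun M W f \<Longrightarrow> W \<subseteq> U \<Longrightarrow> smooth_fun M W (\<lambda>p. X p f)"
  by (auto simp: smooth_vf_def)

lemma smooth_vf_near:
  assumes "smooth_vf M U X" "p \<in> U" "smooth_near M p f"
  shows "smooth_near M p (\<lambda>q. X q f)"
  using smooth_nearE[OF assms(3) smooth_vf_open[OF assms(1)] assms(2)] smooth_vf_fun[OF assms(1)]
      smooth_nearI
  by metis

lemma smooth_vf_subset: "smooth_vf M U X \<Longrightarrow> openin (mtop M) W \<Longrightarrow> W \<subseteq> U \<Longrightarrow> smooth_vf M W X"
  unfolding smooth_vf_def by blast

lemma smooth_vf_cong:
  assumes M: "smooth_manifold M" and eq: "\<And>p. p \<in> U \<Longrightarrow> X p = Y p"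
  shows "smooth_vf M U X \<longleftrightarrow> smooth_vf M U Y"
proof -
  have "smooth_fun M W (\<lambda>p. X p f) \<longleftrightarrow> smooth_fun M W (\<lambda>p. Y p f)" if "W \<subseteq> U" for W f
    using smooth_fun_cong[OF M, of W "\<lambda>p. X p f" "\<lambda>p. Y p f"] eq that by (metis subsetD)
  then show ?thesis using eq unfolding smooth_vf_def by auto
qed

lemma smooth_vf_add: "smooth_vf M U X \<Longrightarrow> smooth_vf M U Y \<Longrightarrow> smooth_vf M U (X + Y)"
  unfolding smooth_vf_def by (auto intro: tangent_plus smooth_fun_add)

lemma smooth_vf_fscale:
  assumes X: "smooth_vf M U X" and h: "smooth_fun M U h"
  shows "smooth_vf M U (fscale h X)"
proof -
  have "smooth_fun M W (\<lambda>p. fscale h X p f)" if "W \<subseteq> U" "smooth_fun M W f" for W f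
    using smooth_fun_mult[OF smooth_fun_subset[OF h that(1) smooth_funD[OF that(2)]]
        smooth_vf_fun[OF X that(2,1)]]
    by (simp add: fscale_def tscale_def)
  then show ?thesis using X unfolding smooth_vf_def by (auto simp: fscale_def intro: tangent_scale)
qed

lemma smooth_vf_uminus: "smooth_vf M U X \<Longrightarrow> smooth_vf M U (- X)"
proof -
  assume X: "smooth_vf M U X"
  have "- X = fscale (\<lambda>p. -1) X" by (simp add: fscale_def tscale_def fun_eq_iff)
  then show ?thesis using smooth_vf_fscale[OF X smooth_fun_const[OF smooth_vf_open[OF X], of
      "-1"]] by simp
qed

lemma smooth_vf_minus: "smooth_vf M U X \<Longrightarrow> smooth_vf M U Y \<Longrightarrow> smooth_vf M U (X - Y)"
  using smooth_vf_add[OF _ smooth_vf_uminus, of M U X Y] by (metis diff_conv_add_uminus)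

lemma lie_bracket_not_smooth: "\<not> smooth_near M p f \<Longrightarrow> lie_bracket M X Y p f = 0"
  by (simp add: lie_bracket_def)

lemma lie_bracket_apply: "smooth_near M p f \<Longrightarrow> lie_bracket M X Y p f = X p (\<lambda>q. Y q f) - Y p (\<lambda>q. X
    q f)"
  by (simp add: lie_bracket_def)

lemma lie_bracket_cong:
  assumes M: "smooth_manifold M" and W: "openin (mtop M) W" "p \<in> W"
    and X: "X p \<in> tangent_space M p" and Y: "Y p \<in> tangent_space M p"
    and eq: "\<And>q. q \<in> W \<Longrightarrow> X q = X' q" "\<And>q. q \<in> W \<Longrightarrow> Y q = Y' q"
  shows "lie_bracket M X Y p = lie_bracket M X' Y' p"
proof
  fix f
  have "X p (\<lambda>q. Y q f) = X p (\<lambda>q. Y' q f)" "Y p (\<lambda>q. X q f) = Y p (\<lambda>q. X' q f)"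
    by (rule tangent_cong[OF M X W], simp add: eq, rule tangent_cong[OF M Y W], simp add: eq)
  then show "lie_bracket M X Y p f = lie_bracket M X' Y' p f"
    using eq W(2) by (simp add: lie_bracket_def)
qed

lemma lie_bracket_antisym: "lie_bracket M X Y = - lie_bracket M Y X"
  by (auto simp: lie_bracket_def fun_eq_iff)

lemma lie_bracket_self: "lie_bracket M X X = 0"
  by (auto simp: lie_bracket_def fun_eq_iff)

lemma lie_bracket_tangent:
  assumes M: "smooth_manifold M" and X: "smooth_vf M U X" and Y: "smooth_vf M U Y" and p: "p \<in> U"
  shows "lie_bracket M X Y p \<in> tangent_space M p"
proof -
  \<comment> \<open>The mixed products of first derivatives in the second identity are symmetric in
    \<open>A\<close> and \<open>B\<close>. They cancel in the commutator, and the Leibniz rule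
    remains.\<close>
  have *: "A p (\<lambda>q. B q (\<lambda>x. a * f x + b * h x)) = a * A p (\<lambda>q. B q f) + b * A p (\<lambda>q. B q h)"
      "A p (\<lambda>q. B q (\<lambda>x. f x * h x)) = f p * A p (\<lambda>q. B q h) + B p h * A p f + (h p * A p (\<lambda>q. B q
          f) + B p f * A p h)"
    if A: "smooth_vf M U A" and B: "smooth_vf M U B" and f: "smooth_near M p f" and h:
        "smooth_near M p h" for A B f h a b
  proof -
    obtain W1 where W1: "smooth_fun M W1 f" "W1 \<subseteq> U" "p \<in> W1"
      by (rule smooth_nearE[OF f smooth_vf_open[OF A] p])
    obtain W where W: "smooth_fun M W h" "W \<subseteq> W1" "p \<in> W"
      by (rule smooth_nearE[OF h smooth_funD[OF W1(1)] W1(3)])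
    have oW: "openin (mtop M) W" using smooth_funD[OF W(1)] .
    have sf: "smooth_near M q f" "smooth_near M q h" "q \<in> U" if "q \<in> W" for q
      using smooth_nearI[OF W1(1)] smooth_nearI[OF W(1)] that W(2) W1(2) by auto
    note vA = smooth_vf_tangent[OF A p]
    note nB = smooth_vf_near[OF B p f] smooth_vf_near[OF B p h]
    have "A p (\<lambda>q. B q (\<lambda>x. a * f x + b * h x)) = A p (\<lambda>q. a * B q f + b * B q h)"
      by (rule tangent_cong[OF M vA oW W(3)]) (rule tangent_lin[OF smooth_vf_tangent[OF B sf(3)]
          sf(1,2)])
    then show "A p (\<lambda>q. B q (\<lambda>x. a * f x + b * h x)) = a * A p (\<lambda>q. B q f) + b * A p (\<lambda>q. B q h)"
      using tangent_lin[OF vA nB] by simp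
    have "A p (\<lambda>q. B q (\<lambda>x. f x * h x)) = A p (\<lambda>q. f q * B q h + h q * B q f)"
      by (rule tangent_cong[OF M vA oW W(3)]) (rule tangent_mult[OF smooth_vf_tangent[OF B sf(3)]
          sf(1,2)])
    also have "\<dots> = A p (\<lambda>q. f q * B q h) + A p (\<lambda>q. h q * B q f)"
      by (rule tangent_add[OF vA smooth_near_lin(2)[OF f nB(2)] smooth_near_lin(2)[OF h nB(1)]])
    finally show "A p (\<lambda>q. B q (\<lambda>x. f x * h x)) = f p * A p (\<lambda>q. B q h) + B p h * A p f + (h p * A
        p (\<lambda>q. B q f) + B p f * A p h)"
      using tangent_mult[OF vA f nB(2)] tangent_mult[OF vA h nB(1)] by simp
  qed
  show ?thesis
    unfolding tangent_space_def mem_Collect_eq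
  proof (intro conjI allI impI lie_bracket_not_smooth)
    fix f h a b assume "smooth_near M p f \<and> smooth_near M p h"
    then have f: "smooth_near M p f" and h: "smooth_near M p h" by simp_all
    show "lie_bracket M X Y p (\<lambda>x. a * f x + b * h x) = a * lie_bracket M X Y p f + b *
        lie_bracket M X Y p h"
      by (simp only: lie_bracket_apply[OF smooth_near_lin(1)[OF f h]] lie_bracket_apply[OF f]
          lie_bracket_apply[OF h]
          *(1)[OF X Y f h] *(1)[OF Y X f h]) (simp add: algebra_simps)
    show "lie_bracket M X Y p (\<lambda>x. f x * h x) = f p * lie_bracket M X Y p h + h p * lie_bracket M
        X Y p f"
      by (simp only: lie_bracket_apply[OF smooth_near_lin(2)[OF f h]] lie_bracket_apply[OF f]
          lie_bracket_apply[OF h]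
          *(2)[OF X Y f h] *(2)[OF Y X f h]) (simp add: algebra_simps)
  qed
qed

lemma smooth_vf_lie_bracket:
  assumes M: "smooth_manifold M" and X: "smooth_vf M U X" and Y: "smooth_vf M U Y"
  shows "smooth_vf M U (lie_bracket M X Y)"
  unfolding smooth_vf_def
proof (intro conjI ballI allI impI smooth_vf_open[OF X] lie_bracket_tangent[OF M X Y])
  fix W f assume W: "W \<subseteq> U \<and> smooth_fun M W f"
  then have "smooth_fun M W (\<lambda>p. X p (\<lambda>q. Y q f) - Y p (\<lambda>q. X q f))"
    by (intro smooth_fun_diff smooth_vf_fun[OF X] smooth_vf_fun[OF Y]) auto
  moreover have "smooth_near M p f" if "p \<in> W" for p
    by (rule smooth_nearI[OF conjunct2[OF W] that])
  ultimately show "smooth_fun M W (\<lambda>p. lie_bracket M X Y p f)"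
    using smooth_fun_cong[OF M, of W "\<lambda>p. lie_bracket M X Y p f" "\<lambda>p. X p (\<lambda>q. Y q f) - Y p (\<lambda>q. X
        q f)"]
    by (simp add: lie_bracket_apply)
qed

lemma lie_bracket_jacobi:
  assumes M: "smooth_manifold M" and X: "smooth_vf M U X" and Y: "smooth_vf M U Y" and Z:
      "smooth_vf M U Z"
    and p: "p \<in> U"
  shows "lie_bracket M X (lie_bracket M Y Z) p + lie_bracket M Y (lie_bracket M Z X) p +
    lie_bracket M Z (lie_bracket M X Y) p = 0"
proof
  fix f
  show "(lie_bracket M X (lie_bracket M Y Z) p + lie_bracket M Y (lie_bracket M Z X) p +
    lie_bracket M Z (lie_bracket M X Y) p) f = 0 f"
  proof (cases "smooth_near M p f")
    case True
    have *: "lie_bracket M A (lie_bracket M B C) p f =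
        A p (\<lambda>q. B q (\<lambda>r. C r f)) - A p (\<lambda>q. C q (\<lambda>r. B r f)) - (B p (\<lambda>q. C q (\<lambda>r. A r f)) - C p
            (\<lambda>q. B q (\<lambda>r. A r f)))"
      if A: "smooth_vf M U A" and B: "smooth_vf M U B" and C: "smooth_vf M U C" for A B C
    proof -
      obtain W where W: "smooth_fun M W f" "W \<subseteq> U" "p \<in> W"
        by (rule smooth_nearE[OF True smooth_vf_open[OF X] p])
      note vA = smooth_vf_tangent[OF A p]
      have "A p (\<lambda>q. lie_bracket M B C q f) = A p (\<lambda>q. B q (\<lambda>r. C r f) - C q (\<lambda>r. B r f))"
        by (rule tangent_cong[OF M vA smooth_funD[OF W(1)] W(3)])
          (rule lie_bracket_apply[OF smooth_nearI[OF W(1)]])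
      also have "\<dots> = A p (\<lambda>q. B q (\<lambda>r. C r f)) - A p (\<lambda>q. C q (\<lambda>r. B r f))"
        by (rule tangent_diff[OF vA]) (intro smooth_vf_near[OF B p] smooth_vf_near[OF C p] True)+
      finally show ?thesis
        using True smooth_vf_near[OF A p True] by (simp add: lie_bracket_apply)
    qed
    show ?thesis by (simp add: *[OF X Y Z] *[OF Y Z X] *[OF Z X Y])
  qed (simp add: lie_bracket_not_smooth)
qed

lemma (in smooth_chart) smooth_vf_cvec:
  assumes W: "W \<subseteq> U" "openin (mtop M) W" and c: "smooth_on (\<theta> ` W) (\<lambda>x. c (\<Omega> x))"
    and X: "\<And>p. p \<in> W \<Longrightarrow> X p = cvec p (c p)"
  shows "smooth_vf M W X"
  unfolding smooth_vf_def
proof (intro conjI ballI allI impI W(2))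
  show "X p \<in> tangent_space M p" if "p \<in> W" for p using X[OF that] cvec_tangent that W(1) by auto
  fix W' f assume W': "W' \<subseteq> W \<and> smooth_fun M W' f"
  then have o': "openin (mtop M) W'" and W'U: "W' \<subseteq> U" using smooth_funD W by blast+
  have oo: "open (\<theta> ` W')" using open_iff[OF W'U] o' by simp
  have f: "smooth_on (\<theta> ` W') (\<lambda>x. f (\<Omega> x))" using smooth_fun_iff[OF W'U o'] W' by blast
  have "smooth_on (\<theta> ` W') (\<lambda>x. frechet_derivative (\<lambda>x. f (\<Omega> x)) (at x) (c (\<Omega> x)))"
    by (rule smooth_on_frechet_derivative_vf[OF oo f smooth_on_subset[OF c]]) (use W' in blast)
  moreover have "X (\<Omega> x) f = frechet_derivative (\<lambda>x. f (\<Omega> x)) (at x) (c (\<Omega> x))" if x: "x \<in> \<theta> ` W'"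
      for x
  proof -
    have q: "\<Omega> x \<in> W'" using \<Omega>_in[OF W'U x] .
    have "\<theta> (\<Omega> x) = x" using x W'U by auto
    then show ?thesis using X[of "\<Omega> x"] q W' smooth_nearI[of M W' f] by (auto simp: cvec_def)
  qed
  ultimately have "smooth_on (\<theta> ` W') (\<lambda>x. X (\<Omega> x) f)"
    using smooth_on_cong[OF oo, of "\<lambda>x. X (\<Omega> x) f"
      "\<lambda>x. frechet_derivative (\<lambda>x. f (\<Omega> x)) (at x) (c (\<Omega> x))"] by blast
  then show "smooth_fun M W' (\<lambda>p. X p f)" using smooth_fun_iff[OF W'U o', of "\<lambda>p. X p f"] by blast
qed

subsection \<open>Straightening two commuting vector fields\<close>

text \<open>Images under \<open>G\<close> become preimages under \<open>\<Psi>\<close> and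
  conversely, so openness can be transferred in both directions by continuity alone.\<close>

lemma image_left_inverse:
  assumes "\<And>z. z \<in> P \<Longrightarrow> G (\<Psi> z) = z" "A \<subseteq> \<Psi> ` P"
  shows "G ` A = \<Psi> -` A \<inter> P" "A = G -` (G ` A) \<inter> \<Psi> ` P"
proof -
  have *: "\<exists>z\<in>P. a = \<Psi> z \<and> G a = z" if "a \<in> A" for a using assms that by fastforce
  show "G ` A = \<Psi> -` A \<inter> P"
  proof (intro equalityI subsetI)
    fix z assume "z \<in> \<Psi> -` A \<inter> P"
    then show "z \<in> G ` A" using assms(1)[of z] by (metis IntE imageI vimageE)
  qed (use * in auto)
  show "A = G -` (G ` A) \<inter> \<Psi> ` P"
  proof (intro equalityI subsetI)
    fix y assume "y \<in> G -` (G ` A) \<inter> \<Psi> ` P"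
    then obtain a z where "a \<in> A" "G y = G a" "z \<in> P" "y = \<Psi> z" by auto
    then show "y \<in> A" using *[of a] assms(1) by metis
  qed (use assms(2) in auto)
qed

lemma smooth_chart_compose:
  fixes \<Psi> :: "'h::euclidean_space \<Rightarrow> 'e::euclidean_space" and M :: "('a, 'd::euclidean_space) mfd"
  assumes C: "smooth_chart M C \<phi>" and P: "open P" and \<Psi>: "smooth_on P \<Psi>" "open (\<Psi> ` P)" "\<Psi> ` P \<subseteq> \<phi>
      ` C"
    and G: "smooth_on (\<Psi> ` P) G" "\<And>z. z \<in> P \<Longrightarrow> G (\<Psi> z) = z"
  defines "U \<equiv> {p \<in> C. \<phi> p \<in> \<Psi> ` P}"
  shows "smooth_chart M U (\<lambda>p. G (\<phi> p))" "(\<lambda>p. G (\<phi> p)) ` U = P"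
    "\<And>z. z \<in> P \<Longrightarrow> inv_into U (\<lambda>p. G (\<phi> p)) z = inv_into C \<phi> (\<Psi> z)"
proof -
  interpret C: smooth_chart M C \<phi> by (rule C)
  have UC: "U \<subseteq> C" by (auto simp: U_def)
  have \<phi>U: "\<phi> ` U = \<Psi> ` P"
  proof (intro equalityI subsetI)
    fix y assume y: "y \<in> \<Psi> ` P"
    then obtain c where "c \<in> C" "y = \<phi> c" using \<Psi>(3) by blast
    then show "y \<in> \<phi> ` U" using y by (auto simp: U_def)
  qed (auto simp: U_def)
  have \<Psi>G: "\<Psi> (G y) = y" if "y \<in> \<Psi> ` P" for y using that G(2) by auto
  show img: "(\<lambda>p. G (\<phi> p)) ` U = P"
  proof -
    have "(\<lambda>p. G (\<phi> p)) ` U = G ` \<phi> ` U" by (simp add: image_image)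
    also have "\<dots> = P" unfolding \<phi>U using G(2) by (simp add: image_image)
    finally show ?thesis .
  qed
  have inj: "inj_on (\<lambda>p. G (\<phi> p)) U"
  proof (rule inj_onI)
    fix p q assume "p \<in> U" "q \<in> U" "G (\<phi> p) = G (\<phi> q)"
    then have "\<phi> p = \<phi> q" using \<Psi>G \<phi>U by (metis imageI)
    then show "p = q" using C.inj UC \<open>p \<in> U\<close> \<open>q \<in> U\<close> by (auto dest: inj_onD)
  qed
  have \<Omega>: "inv_into C \<phi> (\<Psi> z) \<in> U" "\<phi> (inv_into C \<phi> (\<Psi> z)) = \<Psi> z" if "z \<in> P" for z
  proof -
    show 1: "\<phi> (inv_into C \<phi> (\<Psi> z)) = \<Psi> z" using that \<Psi>(3) by (intro C.\<theta>_\<Omega>) auto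
    show "inv_into C \<phi> (\<Psi> z) \<in> U" using 1 that \<Psi>(3) C.\<Omega>_in[OF order_refl, of "\<Psi> z"] by (auto simp:
        U_def)
  qed
  show inv: "inv_into U (\<lambda>p. G (\<phi> p)) z = inv_into C \<phi> (\<Psi> z)" if "z \<in> P" for z
    by (rule inv_into_f_eq[OF inj \<Omega>(1)[OF that]]) (simp add: \<Omega>(2)[OF that] G(2)[OF that])
  have oU: "openin (mtop M) U" using C.open_iff[OF UC] \<phi>U \<Psi>(2) by simp
  show "smooth_chart M U (\<lambda>p. G (\<phi> p))"
  proof
    show "openin (mtop M) W \<longleftrightarrow> open ((\<lambda>p. G (\<phi> p)) ` W)" if W: "W \<subseteq> U" for W
    proof -
      have "openin (mtop M) W \<longleftrightarrow> open (\<phi> ` W)" using C.open_iff W UC by blast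
      also have "\<dots> \<longleftrightarrow> open (G ` \<phi> ` W)"
      proof
        have \<phi>W: "\<phi> ` W \<subseteq> \<Psi> ` P" using W \<phi>U by blast
        assume o: "open (\<phi> ` W)"
        have "G ` \<phi> ` W = \<Psi> -` (\<phi> ` W) \<inter> P" by (rule image_left_inverse(1)) (use G(2) \<phi>W in auto)
        then show "open (G ` \<phi> ` W)"
          using continuous_on_open_vimage[OF P, of \<Psi>] smooth_on_continuous[OF \<Psi>(1)] o by simp
      next
        have \<phi>W: "\<phi> ` W \<subseteq> \<Psi> ` P" using W \<phi>U by blast
        assume o: "open (G ` \<phi> ` W)"
        have "\<phi> ` W = G -` (G ` \<phi> ` W) \<inter> \<Psi> ` P" by (rule image_left_inverse(2)) (use G(2) \<phi>W in
            auto)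
        then show "open (\<phi> ` W)"
          using continuous_on_open_vimage[OF \<Psi>(2), of G] smooth_on_continuous[OF G(1)] o by metis
      qed
      finally show ?thesis by (simp add: image_image)
    qed
    fix D \<psi> assume D: "(D, \<psi>) \<in> atlas M"
    interpret D: smooth_chart M D \<psi> by (rule atlas_smooth_chart[OF C.manifold D])
    have oD: "open (\<psi> ` (D \<inter> U))" by (rule atlas_image_open[OF C.manifold D oU])
    show "smooth_on (\<psi> ` (D \<inter> U)) (\<lambda>x. G (\<phi> (inv_into D \<psi> x)))"
      by (rule smooth_on_compose[OF smooth_on_subset[OF C.trans1[OF D]] G(1) oD \<Psi>(2)])
        (use UC \<phi>U D.\<Omega>_in[of "D \<inter> U"] in auto)
    have oDU: "openin (mtop M) (D \<inter> U)" using D.open_dom oU by blast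
    have "G ` \<phi> ` (D \<inter> U) = \<Psi> -` (\<phi> ` (D \<inter> U)) \<inter> P"
      by (rule image_left_inverse(1)) (use G(2) \<phi>U in auto)
    moreover have "open (\<phi> ` (D \<inter> U))" using C.open_iff[of "D \<inter> U"] oDU UC by blast
    ultimately have oDU': "open ((\<lambda>p. G (\<phi> p)) ` (D \<inter> U))"
      using continuous_on_open_vimage[OF P, of \<Psi>] smooth_on_continuous[OF \<Psi>(1)] by (simp add:
          image_image)
    have sub: "(\<lambda>p. G (\<phi> p)) ` (D \<inter> U) \<subseteq> P" using img by blast
    have "smooth_on ((\<lambda>p. G (\<phi> p)) ` (D \<inter> U)) (\<lambda>z. \<psi> (inv_into C \<phi> (\<Psi> z)))"
    proof (rule smooth_on_compose[OF smooth_on_subset[OF \<Psi>(1) sub] C.trans2[OF D] oDU'])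
      show "open (\<phi> ` (D \<inter> C))" using C.open_iff[of "D \<inter> C"] D.open_dom C.open_dom by auto
      show "\<Psi> ` (\<lambda>p. G (\<phi> p)) ` (D \<inter> U) \<subseteq> \<phi> ` (D \<inter> C)"
      proof clarify
        fix w assume w: "w \<in> D" "w \<in> U"
        then have "\<Psi> (G (\<phi> w)) = \<phi> w" using \<phi>U by (intro \<Psi>G) blast
        then show "\<Psi> (G (\<phi> w)) \<in> \<phi> ` (D \<inter> C)" using w UC by auto
      qed
    qed
    then show "smooth_on ((\<lambda>p. G (\<phi> p)) ` (D \<inter> U)) (\<lambda>x. \<psi> (inv_into U (\<lambda>p. G (\<phi> p)) x))"
      by (subst smooth_on_cong[OF oDU', of _ "\<lambda>z. \<psi> (inv_into C \<phi> (\<Psi> z))"]) (use inv sub in auto)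
  qed (use C.manifold oU inj in auto)
qed


text \<open>In coordinates the components of \<open>[V,W]\<close> are those of
  \<open>DW(V) - DV(W)\<close>, so a vanishing bracket is exactly the symmetry that
  \<open>commuting_flow_box\<close> asks of the family
  \<open>F x (a, b) = a V + b W\<close>.\<close>

lemma flow_box_chart:
  fixes M :: "('a, 'e::euclidean_space) mfd"
  assumes M: "smooth_manifold M" and p0: "p0 \<in> topspace (mtop M)"
    and V: "smooth_vf M (topspace (mtop M)) V" and W: "smooth_vf M (topspace (mtop M)) W"
    and comm: "\<And>p. p \<in> topspace (mtop M) \<Longrightarrow> lie_bracket M V W p = 0"
    and indep: "\<And>a b. tscale a (V p0) + tscale b (W p0) = 0 \<Longrightarrow> a = 0 \<and> b = 0"
    and dim: "DIM('f::euclidean_space) + 2 = DIM('e)"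
  obtains U and \<theta> :: "'a \<Rightarrow> (real \<times> real) \<times> 'f::euclidean_space" and r where "r > 0" "smooth_chart
      M U \<theta>"
    "\<theta> ` U = ball 0 r \<times> ball 0 r" "p0 \<in> U"
    "\<And>p. p \<in> U \<Longrightarrow> V p = smooth_chart.cvec M U \<theta> p ((1, 0), 0)"
    "\<And>p. p \<in> U \<Longrightarrow> W p = smooth_chart.cvec M U \<theta> p ((0, 1), 0)"
proof -
  obtain C \<phi> where C: "(C, \<phi>) \<in> atlas M" "p0 \<in> C" by (rule manifold_point_chart[OF M p0])
  interpret C: smooth_chart M C \<phi> by (rule atlas_smooth_chart[OF M C(1)])
  let ?O = "\<phi> ` C"
  have oO: "open ?O" using C.open_iff C.open_dom by blast
  have x0: "\<phi> p0 \<in> ?O" using C(2) by blast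
  have CU: "C \<subseteq> topspace (mtop M)" by (rule C.U_topspace)
  define cv where "cv X x = C.ccomp (X (C.\<Omega> x))" for X x
  have cv: "X p = C.cvec p (cv X (\<phi> p))" "smooth_on ?O (cv X)" 
    if X: "smooth_vf M (topspace (mtop M)) X" and p: "p \<in> C" for X p
  proof -
    show "X p = C.cvec p (cv X (\<phi> p))"
      using C.tangent_eq_cvec[OF p smooth_vf_tangent[OF X]] p CU by (auto simp: cv_def)
    have "smooth_fun M C (\<lambda>q. X q (\<lambda>q. \<phi> q \<bullet> i))" for i by (rule smooth_vf_fun[OF X C.coord_smooth
        CU])
    then have s: "smooth_on ?O (\<lambda>x. X (C.\<Omega> x) (\<lambda>q. \<phi> q \<bullet> i))" for i
      using C.smooth_fun_iff[OF order_refl C.open_dom, of "\<lambda>q. X q (\<lambda>q. \<phi> q \<bullet> i)" for i] by blast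
    show "smooth_on ?O (cv X)"
      unfolding cv_def C.ccomp_def by (intro smooth_on_sum smooth_on_scaleR s smooth_on_const)
  qed
  note sV = cv(2)[OF V C(2)] and sW = cv(2)[OF W C(2)]
  let ?D = "\<lambda>f x. frechet_derivative f (at x)"
  have vw: "?D (cv V) x (cv W x) = ?D (cv W) x (cv V x)" if x: "x \<in> ?O" for x
  proof -
    obtain p where p: "p \<in> C" "x = \<phi> p" using x by blast
    have coord: "X q (\<lambda>q. \<phi> q \<bullet> i) = cv X (\<phi> q) \<bullet> i" if "smooth_vf M (topspace (mtop M)) X" "q \<in>
        C" "i \<in> Basis" for X q i
      using that by (simp add: cv_def C.ccomp_def inner_sum_left inner_Basis if_distrib cong:
          if_cong)
    have app: "X p (\<lambda>q. Y q (\<lambda>q. \<phi> q \<bullet> i)) = ?D (cv Y) x (cv X x) \<bullet> i"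
      if X: "smooth_vf M (topspace (mtop M)) X" and Y: "smooth_vf M (topspace (mtop M)) Y" and i:
          "i \<in> Basis" for X Y i
    proof -
      have sm: "smooth_near M p (\<lambda>q. Y q (\<lambda>q. \<phi> q \<bullet> i))"
        using smooth_vf_near[OF Y _ smooth_nearI[OF C.coord_smooth p(1)]] p(1) CU by blast
      have "((\<lambda>x. cv Y x \<bullet> i) has_derivative (\<lambda>h. ?D (cv Y) x h \<bullet> i)) (at x)"
        by (rule bounded_linear.has_derivative[OF bounded_linear_inner_left
            smooth_on_has_derivative[OF cv(2)[OF Y p(1)] x]])
      then have "((\<lambda>x. Y (C.\<Omega> x) (\<lambda>q. \<phi> q \<bullet> i)) has_derivative (\<lambda>h. ?D (cv Y) x h \<bullet> i)) (at x)"
        by (rule has_derivative_transform_within_open[OF _ oO x]) (use coord[OF Y _ i] in auto)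
      from frechet_derivative_at[OF this] have fd: "?D (\<lambda>x. Y (C.\<Omega> x) (\<lambda>q. \<phi> q \<bullet> i)) x = (\<lambda>h. ?D
          (cv Y) x h \<bullet> i)" by (rule sym)
      have "X p (\<lambda>q. Y q (\<lambda>q. \<phi> q \<bullet> i)) = C.cvec p (cv X (\<phi> p)) (\<lambda>q. Y q (\<lambda>q. \<phi> q \<bullet> i))"
        using cv(1)[OF X p(1)] by simp
      also have "\<dots> = ?D (\<lambda>x. Y (C.\<Omega> x) (\<lambda>q. \<phi> q \<bullet> i)) x (cv X x)" using sm p(2) by (simp add:
          C.cvec_def)
      finally show ?thesis by (simp add: fd)
    qed
    show ?thesis
    proof (rule euclidean_eqI)
      fix i :: 'e assume i: "i \<in> Basis"
      have "lie_bracket M V W p (\<lambda>q. \<phi> q \<bullet> i) = 0" using comm p(1) CU by (metis subsetD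
          zero_fun_apply)
      then have "V p (\<lambda>q. W q (\<lambda>q. \<phi> q \<bullet> i)) = W p (\<lambda>q. V q (\<lambda>q. \<phi> q \<bullet> i))"
        using lie_bracket_apply[OF smooth_nearI[OF C.coord_smooth p(1)], of V W i] by simp
      then show "?D (cv V) x (cv W x) \<bullet> i = ?D (cv W) x (cv V x) \<bullet> i"
        using app[OF V W i] app[OF W V i] by simp
    qed
  qed
  define F :: "'e \<Rightarrow> (real \<times> real) \<Rightarrow>\<^sub>L 'e" where
    "F x = (blinfun_scaleR_left (cv V x) o\<^sub>L fst_blinfun) + (blinfun_scaleR_left (cv W x) o\<^sub>L
        snd_blinfun)" for x
  have F: "F x \<kappa> = fst \<kappa> *\<^sub>R cv V x + snd \<kappa> *\<^sub>R cv W x" for x \<kappa>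
    by (simp add: F_def blinfun.add_left)
  have bl: "bounded_linear (\<lambda>c. blinfun_scaleR_left c o\<^sub>L A)" for A :: "(real \<times> real) \<Rightarrow>\<^sub>L real"
    by (rule bounded_linear_compose[OF bounded_bilinear.bounded_linear_left[OF
        bounded_bilinear_blinfun_compose]
          bounded_linear_blinfun_scaleR_left])
  have sF: "smooth_on ?O F"
    unfolding F_def by (intro smooth_on_add smooth_on_bounded_linear[OF bl] sV sW)
  have dF: "blinfun_apply (?D F x h) \<mu> = fst \<mu> *\<^sub>R ?D (cv V) x h + snd \<mu> *\<^sub>R ?D (cv W) x h" if x:
      "x \<in> ?O" for x h \<mu>
  proof -
    have "((\<lambda>x. F x \<mu>) has_derivative (\<lambda>h. blinfun_apply (?D F x h) \<mu>)) (at x)"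
      by (rule bounded_linear.has_derivative[OF blinfun.bounded_linear_left
          smooth_on_has_derivative[OF sF x]])
    moreover have "((\<lambda>x. F x \<mu>) has_derivative (\<lambda>h. fst \<mu> *\<^sub>R ?D (cv V) x h + snd \<mu> *\<^sub>R ?D (cv W)
        x h)) (at x)"
      unfolding F by (intro has_derivative_add has_derivative_scaleR_right
          smooth_on_has_derivative[OF sV x]
          smooth_on_has_derivative[OF sW x])
    ultimately show ?thesis using has_derivative_unique by (metis (no_types, lifting))
  qed
  have lin: "linear (?D (cv V) x)" "linear (?D (cv W) x)" if x: "x \<in> ?O" for x
    using smooth_on_has_derivative[OF sV x] smooth_on_has_derivative[OF sW x]
        has_derivative_linear by blast+
  have commF: "blinfun_apply (?D F x (F x \<kappa>)) \<mu> = blinfun_apply (?D F x (F x \<mu>)) \<kappa>" if x: "x \<in> ?O"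
      for x \<kappa> \<mu>
    unfolding dF[OF x] F
    by (simp add: linear_add[OF lin(1)[OF x]] linear_add[OF lin(2)[OF x]] linear_scale[OF
        lin(1)[OF x]]
        linear_scale[OF lin(2)[OF x]] vw[OF x] algebra_simps)
  have cF: "C.cvec p (F (\<phi> p) \<kappa>) = tscale (fst \<kappa>) (V p) + tscale (snd \<kappa>) (W p)" if "p \<in> C" for p \<kappa>
    unfolding F C.cvec_lin[OF that] cv(1)[OF V that, symmetric] cv(1)[OF W that, symmetric] ..
  have injF: "inj (blinfun_apply (F (\<phi> p0)))"
    unfolding linear_injective_0[OF bounded_linear.linear[OF blinfun.bounded_linear_right]]
  proof (intro allI impI)
    fix \<kappa> assume "F (\<phi> p0) \<kappa> = 0"
    then have "tscale (fst \<kappa>) (V p0) + tscale (snd \<kappa>) (W p0) = 0"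
      using cF[OF C(2), of \<kappa>] C.cvec_zero[OF C(2)] by simp
    then show "\<kappa> = 0" using indep by (simp add: prod_eq_iff)
  qed
  have d: "DIM(real \<times> real) + DIM('f) = DIM('e)" using dim by simp
  obtain r \<Psi> G where r: "r > 0" "smooth_on (ball 0 r \<times> ball (0::'f) r) \<Psi>"
    "\<Psi> ` (ball 0 r \<times> ball 0 r) \<subseteq> ?O" "\<Psi> (0, 0) = \<phi> p0" "open (\<Psi> ` (ball 0 r \<times> ball 0 r))"
    "smooth_on (\<Psi> ` (ball 0 r \<times> ball 0 r)) G" "\<And>z. z \<in> ball 0 r \<times> ball 0 r \<Longrightarrow> G (\<Psi> z) = z"
    "\<And>z \<kappa>. z \<in> ball 0 r \<times> ball 0 r \<Longrightarrow> frechet_derivative \<Psi> (at z) (\<kappa>, 0) = F (\<Psi> z) \<kappa>"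
  proof (rule commuting_flow_box[OF oO x0 sF _ injF d], goal_cases)
    case (1 x \<kappa> \<mu>)
    show ?case by (rule commF[OF 1(2)])
  next
    case (2 r \<Psi> G)
    show ?case by (rule 2(1)[OF 2(2-9)])
  qed
  let ?P = "ball (0::real \<times> real) r \<times> ball (0::'f) r"
  have oP: "open ?P" by (simp add: open_Times)
  define U where "U = {p \<in> C. \<phi> p \<in> \<Psi> ` ?P}"
  define \<theta> where "\<theta> p = G (\<phi> p)" for p
  note comp = smooth_chart_compose[OF C.smooth_chart_axioms oP r(2,5,3,6,7), folded U_def
      \<theta>_def[abs_def]]
  interpret U: smooth_chart M U \<theta> by (rule comp(1))
  \<comment> \<open>By the chain rule, differentiation in the direction \<open>(\<kappa>, 0)\<close>
    of the new coordinates is differentiation in the old ones along the derivative of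
    \<open>\<Psi>\<close> in that direction. The flow equation says that this is
    \<open>F (\<phi> p) \<kappa>\<close>, so \<open>V\<close> and \<open>W\<close> become coordinate
    fields.\<close>
  have cU: "U.cvec p (\<kappa>, 0) = tscale (fst \<kappa>) (V p) + tscale (snd \<kappa>) (W p)" if p: "p \<in> U" for p \<kappa>
  proof -
    have pC: "p \<in> C" using p by (simp add: U_def)
    have z: "\<theta> p \<in> ?P" using comp(2) p by blast
    obtain z' where z': "z' \<in> ?P" "\<phi> p = \<Psi> z'" using p by (auto simp: U_def)
    have \<Psi>\<theta>: "\<Psi> (\<theta> p) = \<phi> p" using r(7)[OF z'(1)] z'(2) by (simp add: \<theta>_def)
    have "U.cvec p (\<kappa>, 0) f = C.cvec p (F (\<phi> p) \<kappa>) f" for f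
    proof (cases "smooth_near M p f")
      case True
      let ?f = "\<lambda>x. f (C.\<Omega> x)"
      have "((\<lambda>z. ?f (\<Psi> z)) has_derivative (\<lambda>h. ?D ?f (\<Psi> (\<theta> p)) (?D \<Psi> (\<theta> p) h))) (at (\<theta> p))"
        by (rule has_derivative_compose[OF smooth_on_has_derivative[OF r(2) z]])
          (simp add: \<Psi>\<theta> C.chart_differentiable[OF True pC])
      then have "((\<lambda>z. f (U.\<Omega> z)) has_derivative (\<lambda>h. ?D ?f (\<Psi> (\<theta> p)) (?D \<Psi> (\<theta> p) h))) (at (\<theta> p))"
        by (rule has_derivative_transform_within_open[OF _ oP z]) (simp add: comp(3))
      from frechet_derivative_at[OF this]
      have "?D (\<lambda>z. f (U.\<Omega> z)) (\<theta> p) (\<kappa>, 0) = ?D ?f (\<phi> p) (F (\<phi> p) \<kappa>)"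
        using r(8)[OF z, of \<kappa>] \<Psi>\<theta> by metis
      then show ?thesis using True by (simp add: U.cvec_def C.cvec_def)
    qed (simp add: U.cvec_def C.cvec_def)
    then show ?thesis using cF[OF pC, of \<kappa>] by (simp add: fun_eq_iff)
  qed
  show ?thesis
  proof (rule that[OF r(1) comp(1,2)])
    show "p0 \<in> U" unfolding U_def using C(2) r(1,4) by (force intro!: image_eqI[of _ _ "(0, 0)"])
    show "V p = U.cvec p ((1, 0), 0)" "W p = U.cvec p ((0, 1), 0)" if "p \<in> U" for p
      using cU[OF that] by simp_all
  qed
qed

subsection \<open>Open subsets of a Euclidean space\<close>

definition euclidean_mfd :: "'f::euclidean_space set \<Rightarrow> ('f, 'f) mfd" where
  "euclidean_mfd B = \<lparr>mtop = top_of_set B, atlas = {(B, \<lambda>x. x)}\<rparr>"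

lemma mtop_euclidean_mfd [simp]: "mtop (euclidean_mfd B) = top_of_set B"
  and atlas_euclidean_mfd [simp]: "atlas (euclidean_mfd B) = {(B, \<lambda>x. x)}"
  by (simp_all add: euclidean_mfd_def)

lemma inv_into_id [simp]: "x \<in> B \<Longrightarrow> inv_into B (\<lambda>x. x) x = x"
  by (rule inv_into_f_eq) auto

lemma smooth_manifold_euclidean:
  fixes B :: "'f::euclidean_space set"
  assumes B: "open B"
  shows "smooth_manifold (euclidean_mfd B)"
proof -
  have "second_countable (euclidean :: 'f topology)"
  proof -
    obtain \<B> :: "'f set set" where \<B>: "countable \<B>" "topological_basis \<B>" using ex_countable_basis
        by blast
    show ?thesis unfolding second_countable_def
    proof (intro exI conjI ballI allI impI)
      show "openin euclidean T" if "T \<in> \<B>" for T using topological_basis_open[OF \<B>(2) that] by simp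
      show "\<exists>T\<in>\<B>. x \<in> T \<and> T \<subseteq> A" if "openin euclidean A \<and> x \<in> A" for A x
        using topological_basisE[OF \<B>(2), of A x] that by (metis open_openin)
    qed (rule \<B>(1))
  qed
  then have 1: "second_countable (top_of_set B)" by (rule second_countable_subtopology)
  have 2: "Hausdorff_space (top_of_set B)" by (simp add: Hausdorff_space_subtopology)
  have "smooth_on B (\<lambda>x. inv_into B (\<lambda>x. x) x)"
    by (subst smooth_on_cong[OF B, of _ "\<lambda>x. x"]) (auto intro: smooth_on_id)
  moreover have "homeomorphic_map (top_of_set B) (top_of_set B) (\<lambda>x. x)"
    using homeomorphic_map_id[of "top_of_set B" "top_of_set B"] by (simp add: id_def)
  ultimately show ?thesis
    using 1 2 B by (auto simp: smooth_manifold_def o_def subtopology_subtopology)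
qed

lemma smooth_chart_euclidean: "open B \<Longrightarrow> smooth_chart (euclidean_mfd B) B (\<lambda>x. x)"
  by (rule atlas_smooth_chart[OF smooth_manifold_euclidean]) auto

lemma openin_euclidean_mfd: "open B \<Longrightarrow> openin (mtop (euclidean_mfd B)) W \<longleftrightarrow> open W \<and> W \<subseteq> B"
  by (simp add: openin_open_eq)

lemma smooth_fun_euclidean:
  assumes B: "open B"
  shows "smooth_fun (euclidean_mfd B) W f \<longleftrightarrow> open W \<and> W \<subseteq> B \<and> smooth_on W f"
proof -
  have "smooth_on (B \<inter> W) (f \<circ> inv_into B (\<lambda>x. x)) \<longleftrightarrow> smooth_on (B \<inter> W) f" if "open W"
    using that B by (intro smooth_on_cong) auto
  then show ?thesis using openin_euclidean_mfd[OF B, of W] by (auto simp: smooth_fun_def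
      Int_absorb1)
qed


subsection \<open>Hermitian manifolds with closed Bismut torsion\<close>

lemma lie_bracket_zero_right:
  assumes "smooth_vf M U X" "p \<in> U"
  shows "lie_bracket M X 0 p = 0"
  using tangent_const[OF smooth_vf_tangent[OF assms], of 0] by (simp add: lie_bracket_def
      fun_eq_iff)

lemma lie_bracket_uminus_right:
  assumes X: "smooth_vf M U X" and Y: "smooth_vf M U Y" and p: "p \<in> U"
  shows "lie_bracket M X (- Y) p = - lie_bracket M X Y p"
proof
  fix f
  show "lie_bracket M X (- Y) p f = (- lie_bracket M X Y p) f"
  proof (cases "smooth_near M p f")
    case True
    have t: "p \<in> topspace (mtop M)" using p smooth_vf_open[OF X] openin_subset by blast
    show ?thesis
      using tangent_diff[OF smooth_vf_tangent[OF X p] smooth_near_const[OF t] smooth_vf_near[OF Y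
          p True], of 0]
        tangent_const[OF smooth_vf_tangent[OF X p], of 0] True
      by (simp add: lie_bracket_apply)
  qed (simp add: lie_bracket_not_smooth)
qed

lemma ext_deriv_4:
  "ext_deriv M \<omega> [A, B, C, D] p =
     A p (\<omega> [B, C, D]) - B p (\<omega> [A, C, D]) + C p (\<omega> [A, B, D]) - D p (\<omega> [A, B, C])
     - \<omega> [lie_bracket M A B, C, D] p + \<omega> [lie_bracket M A C, B, D] p - \<omega> [lie_bracket M A D, B, C] p
     - \<omega> [lie_bracket M B C, A, D] p + \<omega> [lie_bracket M B D, A, C] p - \<omega> [lie_bracket M C D, A, B]
         p"
  by (simp add: ext_deriv_def omit_def lessThan_Suc numeral_eq_Suc)

locale bismut_manifold =
  fixes M :: "('a, 'e::euclidean_space) mfd" and g :: "'a metric_tensor" and J :: "'a endo_field"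
    and nab :: "'a conn"
  assumes hermitian: "hermitian_manifold M g J" and bismut: "bismut_connection M g J nab"
    and torsion_closed: "closed_form M 3 (torsion_form M g nab)"
begin

abbreviation "S \<equiv> topspace (mtop M)"
abbreviation "TM \<equiv> tangent_space M"
abbreviation "br \<equiv> lie_bracket M"
abbreviation "T X Y Z \<equiv> torsion_form M g nab [X, Y, Z]"

lemma manifold: "smooth_manifold M" using hermitian by (simp add: hermitian_manifold_def)

lemma vf_point: "smooth_vf M U X \<Longrightarrow> p \<in> U \<Longrightarrow> p \<in> S"
  using smooth_vf_open openin_subset by blast

lemma g_sym: "p \<in> S \<Longrightarrow> u \<in> TM p \<Longrightarrow> v \<in> TM p \<Longrightarrow> g p u v = g p v u"
  and g_pos: "p \<in> S \<Longrightarrow> u \<in> TM p \<Longrightarrow> u \<noteq> 0 \<Longrightarrow> g p u u > 0"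
  and g_lin: "p \<in> S \<Longrightarrow> u \<in> TM p \<Longrightarrow> v \<in> TM p \<Longrightarrow> w \<in> TM p \<Longrightarrow>
    g p (tscale a u + tscale b v) w = a * g p u w + b * g p v w"
  and g_smooth: "smooth_vf M U X \<Longrightarrow> smooth_vf M U Y \<Longrightarrow> smooth_fun M U (\<lambda>p. g p (X p) (Y p))"
  using hermitian by (simp_all add: hermitian_manifold_def riemannian_metric_def)

lemma g_lin_right: "p \<in> S \<Longrightarrow> u \<in> TM p \<Longrightarrow> v \<in> TM p \<Longrightarrow> w \<in> TM p \<Longrightarrow>
    g p w (tscale a u + tscale b v) = a * g p w u + b * g p w v"
  using g_lin g_sym by (simp add: tangent_plus tangent_scale)

lemma g_add: "p \<in> S \<Longrightarrow> u \<in> TM p \<Longrightarrow> v \<in> TM p \<Longrightarrow> w \<in> TM p \<Longrightarrow> g p (u + v) w = g p u w + g p v w"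
  and g_scale: "p \<in> S \<Longrightarrow> u \<in> TM p \<Longrightarrow> w \<in> TM p \<Longrightarrow> g p (tscale a u) w = a * g p u w"
  and g_minus: "p \<in> S \<Longrightarrow> u \<in> TM p \<Longrightarrow> v \<in> TM p \<Longrightarrow> w \<in> TM p \<Longrightarrow> g p (u - v) w = g p u w - g p v w"
  and g_zero: "p \<in> S \<Longrightarrow> w \<in> TM p \<Longrightarrow> g p 0 w = 0"
  using g_lin[of p u v w 1 1] g_lin[of p u 0 w a 0] g_lin[of p u v w 1 "-1"] g_lin[of p 0 0 w 0 0]
  by (simp_all add: tangent_zero tscale_m1)

lemma g_minus_right: "p \<in> S \<Longrightarrow> u \<in> TM p \<Longrightarrow> v \<in> TM p \<Longrightarrow> w \<in> TM p \<Longrightarrow> g p w (u - v) = g p w u - g p w v"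
  and g_uminus_right: "p \<in> S \<Longrightarrow> u \<in> TM p \<Longrightarrow> w \<in> TM p \<Longrightarrow> g p w (- u) = - g p w u"
  and g_zero_right: "p \<in> S \<Longrightarrow> w \<in> TM p \<Longrightarrow> g p w 0 = 0"
  using g_lin_right[of p u v w 1 "-1"]
    g_lin_right[of p u 0 w "-1" 0] g_lin_right[of p 0 0 w 0 0]
  by (simp_all add: tangent_zero tscale_m1)

lemma g_self_zero: "p \<in> S \<Longrightarrow> u \<in> TM p \<Longrightarrow> g p u u = 0 \<Longrightarrow> u = 0"
  using g_pos by fastforce

lemma J_tangent: "p \<in> S \<Longrightarrow> u \<in> TM p \<Longrightarrow> J p u \<in> TM p"
  and J_J: "p \<in> S \<Longrightarrow> u \<in> TM p \<Longrightarrow> J p (J p u) = - u"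
  and J_lin: "p \<in> S \<Longrightarrow> u \<in> TM p \<Longrightarrow> v \<in> TM p \<Longrightarrow> J p (tscale a u + tscale b v) = tscale a (J p u) +
      tscale b (J p v)"
  and J_smooth: "smooth_vf M U X \<Longrightarrow> smooth_vf M U (endo_app J X)"
  and g_J: "p \<in> S \<Longrightarrow> u \<in> TM p \<Longrightarrow> v \<in> TM p \<Longrightarrow> g p (J p u) (J p v) = g p u v"
  and nijenhuis_zero: "smooth_vf M U X \<Longrightarrow> smooth_vf M U Y \<Longrightarrow> p \<in> U \<Longrightarrow> nijenhuis M J X Y p = 0"
  using hermitian by (simp_all add: hermitian_manifold_def integrable_complex_structure_def
      almost_complex_structure_def)

lemma J_minus: "p \<in> S \<Longrightarrow> u \<in> TM p \<Longrightarrow> v \<in> TM p \<Longrightarrow> J p (u - v) = J p u - J p v"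
  and J_zero: "p \<in> S \<Longrightarrow> J p 0 = 0"
  using J_lin[of p u v 1 "-1"] J_lin[of p 0 0 0 0]
  by (simp_all add: tangent_zero tscale_m1)

lemma g_J_skew:
  assumes "p \<in> S" "u \<in> TM p" "v \<in> TM p"
  shows "g p (J p u) v = - g p u (J p v)"
proof -
  have "- g p (J p u) v = g p (J p u) (J p (J p v))"
    using assms by (simp add: J_J g_uminus_right J_tangent)
  also have "\<dots> = g p u (J p v)" using assms by (simp add: g_J J_tangent)
  finally show ?thesis by simp
qed

lemma g_J_self: "p \<in> S \<Longrightarrow> u \<in> TM p \<Longrightarrow> g p (J p u) u = 0"
  using g_J_skew[of p u u] g_sym[of p "J p u" u] J_tangent by simp

lemma affine: "affine_connection M nab" using bismut by (simp add: bismut_connection_def)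

lemma nab_smooth: "smooth_vf M U X \<Longrightarrow> smooth_vf M U Y \<Longrightarrow> smooth_vf M U (nab X Y)"
proof -
  assume X: "smooth_vf M U X" and Y: "smooth_vf M U Y"
  note c = smooth_fun_const[OF smooth_vf_open[OF X], of 0]
  show ?thesis using affine X Y c unfolding affine_connection_def by blast
qed

lemma nab_add_left: "smooth_vf M U X \<Longrightarrow> smooth_vf M U Y \<Longrightarrow> smooth_vf M U Z \<Longrightarrow> p \<in> U \<Longrightarrow>
    nab (X + Y) Z p = nab X Z p + nab Y Z p"
  and nab_add_right: "smooth_vf M U X \<Longrightarrow> smooth_vf M U Y \<Longrightarrow> smooth_vf M U Z \<Longrightarrow> p \<in> U \<Longrightarrow>
    nab X (Y + Z) p = nab X Y p + nab X Z p"
  using affine smooth_fun_const[OF smooth_vf_open[of M U X], of 0] unfolding affine_connection_def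
      by blast+

lemma nab_fscale_left: "smooth_vf M U X \<Longrightarrow> smooth_vf M U Y \<Longrightarrow> smooth_fun M U h \<Longrightarrow> p \<in> U \<Longrightarrow>
    nab (fscale h X) Y p = tscale (h p) (nab X Y p)"
  and nab_fscale_right: "smooth_vf M U X \<Longrightarrow> smooth_vf M U Y \<Longrightarrow> smooth_fun M U h \<Longrightarrow> p \<in> U \<Longrightarrow>
    nab X (fscale h Y) p = tscale (X p h) (Y p) + tscale (h p) (nab X Y p)"
  using affine unfolding affine_connection_def by blast+

text \<open>Multiplying by the indicator function of \<open>U\<close>, which is smooth on \<open>U\<close>, erases the values
  of vector fields outside \<open>U\<close>.\<close>

lemma nab_cong:
  assumes X: "smooth_vf M U X" and Y: "smooth_vf M U Y" and p: "p \<in> U"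
    and eq: "\<And>q. q \<in> U \<Longrightarrow> X q = X' q" "\<And>q. q \<in> U \<Longrightarrow> Y q = Y' q"
  shows "nab X Y p = nab X' Y' p"
proof -
  define ind :: "'a \<Rightarrow> real" where "ind q = (if q \<in> U then 1 else 0)" for q
  note oU = smooth_vf_open[OF X]
  have ind: "smooth_fun M U ind"
    using smooth_fun_const[OF oU, of 1] smooth_fun_cong[OF manifold, of U ind "\<lambda>x. 1"] by (simp
        add: ind_def)
  have X': "smooth_vf M U X'" and Y': "smooth_vf M U Y'"
    using X Y smooth_vf_cong[OF manifold, of U X X'] smooth_vf_cong[OF manifold, of U Y Y'] eq by
        auto
  have f: "fscale ind X = fscale ind X'" "fscale ind Y = fscale ind Y'"
    using eq by (auto simp: fscale_def fun_eq_iff ind_def tscale_def)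
  have d: "X' p ind = 0"
  proof -
    have "X' p ind = X' p (\<lambda>x. 1)"
      by (rule tangent_cong[OF manifold smooth_vf_tangent[OF X' p] oU p]) (simp add: ind_def)
    then show ?thesis using tangent_const[OF smooth_vf_tangent[OF X' p]] by simp
  qed
  have i: "ind p = 1" using p by (simp add: ind_def)
  have "nab X Y p = nab (fscale ind X) Y p" using nab_fscale_left[OF X Y ind p] i by simp
  also have "\<dots> = nab X' Y p" unfolding f using nab_fscale_left[OF X' Y ind p] i by simp
  also have "\<dots> = nab X' (fscale ind Y) p" using nab_fscale_right[OF X' Y ind p] i d by simp
  also have "\<dots> = nab X' Y' p" unfolding f using nab_fscale_right[OF X' Y' ind p] i d by simp
  finally show ?thesis .
qed

lemma metric_compat: "smooth_vf M U X \<Longrightarrow> smooth_vf M U Y \<Longrightarrow> smooth_vf M U Z \<Longrightarrow> p \<in> U \<Longrightarrow>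
    X p (\<lambda>q. g q (Y q) (Z q)) = g p (nab X Y p) (Z p) + g p (Y p) (nab X Z p)"
  and T_antisym12: "smooth_vf M U X \<Longrightarrow> smooth_vf M U Y \<Longrightarrow> smooth_vf M U Z \<Longrightarrow> p \<in> U \<Longrightarrow> T X Y Z p = - T
      Y X Z p"
  and T_antisym23: "smooth_vf M U X \<Longrightarrow> smooth_vf M U Y \<Longrightarrow> smooth_vf M U Z \<Longrightarrow> p \<in> U \<Longrightarrow> T X Y Z p = - T
      X Z Y p"
  using bismut unfolding bismut_connection_def by blast+

lemma nab_J: "smooth_vf M U X \<Longrightarrow> smooth_vf M U Y \<Longrightarrow> p \<in> U \<Longrightarrow> nab X (endo_app J Y) p = J p (nab X Y p)"
  using bismut unfolding bismut_connection_def by blast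

lemma T_eq:
  assumes X: "smooth_vf M U X" and Y: "smooth_vf M U Y" and Z: "smooth_vf M U Z" and p: "p \<in> U"
  shows "T X Y Z p = g p (nab X Y p) (Z p) - g p (nab Y X p) (Z p) - g p (br X Y p) (Z p)"
  using p vf_point[OF X p]
  by (simp add: torsion_form_def torsion_def g_minus tangent_minus smooth_vf_tangent[OF
      nab_smooth[OF X Y]]
      smooth_vf_tangent[OF nab_smooth[OF Y X]] smooth_vf_tangent[OF smooth_vf_lie_bracket[OF
          manifold X Y]]
      smooth_vf_tangent[OF Z])

lemma T_smooth:
  assumes X: "smooth_vf M U X" and Y: "smooth_vf M U Y" and Z: "smooth_vf M U Z"
  shows "smooth_fun M U (T X Y Z)"
proof -
  have "smooth_vf M U (torsion M nab X Y)"
    unfolding torsion_def by (intro smooth_vf_minus nab_smooth X Y smooth_vf_lie_bracket[OF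
        manifold])
  from g_smooth[OF this Z] show ?thesis by (simp add: torsion_form_def[abs_def])
qed

text \<open>The computation for the Levi-Civita connection, with torsion kept. It produces
  \<open>T X Y Z - T X Z Y - T Y Z X\<close>, which total skew-symmetry reduces to the single term
  \<open>T X Y Z\<close>.\<close>

lemma Koszul:
  assumes X: "smooth_vf M U X" and Y: "smooth_vf M U Y" and Z: "smooth_vf M U Z" and p: "p \<in> U"
  shows "2 * g p (nab X Y p) (Z p) = X p (\<lambda>q. g q (Y q) (Z q)) + Y p (\<lambda>q. g q (X q) (Z q)) - Z p
      (\<lambda>q. g q (X q) (Y q))
    + g p (br X Y p) (Z p) - g p (br X Z p) (Y p) - g p (br Y Z p) (X p) + T X Y Z p"
proof -
  note S = vf_point[OF X p]
  note t = smooth_vf_tangent[OF X p] smooth_vf_tangent[OF Y p] smooth_vf_tangent[OF Z p]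
  have n: "nab A B p \<in> TM p" if "smooth_vf M U A" "smooth_vf M U B" for A B
    using smooth_vf_tangent[OF nab_smooth[OF that] p] .
  have 1: "T X Z Y p = - T X Y Z p" "T Y Z X p = T X Y Z p"
    using T_antisym23[OF X Z Y p] T_antisym23[OF Y Z X p] T_antisym12[OF Y X Z p] by simp_all
  note s = g_sym[OF S t(2) n[OF X Z]] g_sym[OF S t(1) n[OF Y Z]] g_sym[OF S t(1) n[OF Z Y]]
  show ?thesis
    using 1 s T_eq[OF X Y Z p] T_eq[OF X Z Y p] T_eq[OF Y Z X p]
      metric_compat[OF X Y Z p] metric_compat[OF Y X Z p] metric_compat[OF Z X Y p]
    by linarith
qed

section \<open>Parallel vector fields and their action on metric, torsion and connection\<close>

context
  fixes \<xi> :: "'a vfield" and U :: "'a set"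
  assumes \<xi>: "smooth_vf M U \<xi>" and par: "parallel M nab \<xi>"
begin

lemma nab_parallel: "smooth_vf M U X \<Longrightarrow> p \<in> U \<Longrightarrow> nab X \<xi> p = 0"
  using par unfolding parallel_def by blast

text \<open>This is the Killing property. As \<open>\<xi>\<close> is parallel,
  \<open>g(\<nabla>\<^sub>\<xi>A, B)\<close> differs from \<open>g([\<xi>,A], B)\<close> only by
  \<open>T \<xi> A B\<close>, and the two torsion terms cancel by skew-symmetry.\<close>

lemma parallel_g:
  assumes A: "smooth_vf M U A" and B: "smooth_vf M U B" and p: "p \<in> U"
  shows "\<xi> p (\<lambda>q. g q (A q) (B q)) = g p (br \<xi> A p) (B p) + g p (A p) (br \<xi> B p)"
proof -
  note S = vf_point[OF A p]
  note t = smooth_vf_tangent[OF A p] smooth_vf_tangent[OF B p]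
  have "g p (nab \<xi> A p) (B p) = T \<xi> A B p + g p (br \<xi> A p) (B p)"
    "g p (nab \<xi> B p) (A p) = T \<xi> B A p + g p (br \<xi> B p) (A p)"
    using T_eq[OF \<xi> A B p] T_eq[OF \<xi> B A p] by (simp_all add: nab_parallel A B p g_zero[OF S] t)
  moreover have "T \<xi> B A p = - T \<xi> A B p" by (rule T_antisym23[OF \<xi> B A p])
  moreover have "g p (A p) (nab \<xi> B p) = g p (nab \<xi> B p) (A p)" "g p (A p) (br \<xi> B p) = g p (br \<xi>
      B p) (A p)"
    using g_sym[OF S t(1)] smooth_vf_tangent[OF nab_smooth[OF \<xi> B] p]
      smooth_vf_tangent[OF smooth_vf_lie_bracket[OF manifold \<xi> B] p] by simp_all
  ultimately show ?thesis using metric_compat[OF \<xi> A B p] by simp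
qed

text \<open>Skew-symmetry gives \<open>T \<xi> A B = T A B \<xi>\<close>. Since \<open>\<xi>\<close>
  is parallel, the products of \<open>\<nabla>\<^sub>AB\<close> and \<open>\<nabla>\<^sub>BA\<close>
  with \<open>\<xi>\<close> are derivatives of \<open>g B \<xi>\<close> and
  \<open>g A \<xi>\<close>, which leaves the formula for the exterior derivative of a
  1-form.\<close>

lemma parallel_T:
  assumes A: "smooth_vf M U A" and B: "smooth_vf M U B" and p: "p \<in> U"
  shows "T \<xi> A B p = A p (\<lambda>q. g q (B q) (\<xi> q)) - B p (\<lambda>q. g q (A q) (\<xi> q)) - g p (br A B p) (\<xi> p)"
proof -
  note S = vf_point[OF A p]
  have "T \<xi> A B p = T A B \<xi> p"
    using T_antisym12[OF \<xi> A B p] T_antisym23[OF A \<xi> B p] by simp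
  then show ?thesis
    using T_eq[OF A B \<xi> p] metric_compat[OF A B \<xi> p] metric_compat[OF B A \<xi> p]
    by (simp add: nab_parallel A B p g_zero_right[OF S] smooth_vf_tangent[OF A p]
        smooth_vf_tangent[OF B p])
qed

text \<open>By the Jacobi identity the fields commuting with \<open>\<xi>\<close> are closed under
  brackets. This handles the bracket terms of the Koszul formula.\<close>

lemma br_br_zero:
  assumes A: "smooth_vf M U A" and B: "smooth_vf M U B"
    and zero: "\<And>q. q \<in> U \<Longrightarrow> br \<xi> A q = 0" "\<And>q. q \<in> U \<Longrightarrow> br \<xi> B q = 0" and p: "p \<in> U"
  shows "br \<xi> (br A B) p = 0"
proof -
  note oU = smooth_vf_open[OF A]
  have z: "br X Y p = 0" if X: "smooth_vf M U X" and Y: "smooth_vf M U Y" and 0: "\<And>q. q \<in> U \<Longrightarrow> Y q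
      = 0" for X Y
  proof -
    have "br X Y p = br X 0 p"
      by (rule lie_bracket_cong[OF manifold oU p]) (simp_all add: smooth_vf_tangent[OF X p]
          smooth_vf_tangent[OF Y p] 0)
    then show ?thesis using lie_bracket_zero_right[OF X p] by simp
  qed
  have 1: "br A (br B \<xi>) p = 0"
    by (rule z[OF A smooth_vf_lie_bracket[OF manifold B \<xi>]]) (use zero(2) in \<open>simp add:
        lie_bracket_antisym[of M B \<xi>]\<close>)
  have 2: "br B (br \<xi> A) p = 0"
    by (rule z[OF B smooth_vf_lie_bracket[OF manifold \<xi> A] zero(1)])
  show ?thesis using lie_bracket_jacobi[OF manifold \<xi> A B p] 1 2 by simp
qed

text \<open>For parallel \<open>\<xi>\<close> and skew-symmetric torsion, \<open>\<iota>\<^sub>\<xi>T\<close> is the exterior derivative of the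
  1-form dual to \<open>\<xi>\<close>, so \<open>dT = 0\<close> gives \<open>L\<^sub>\<xi>T = d(\<iota>\<^sub>\<xi>T) = 0\<close>.\<close>

lemma parallel_T_invariant:
  assumes X: "smooth_vf M U X" and Y: "smooth_vf M U Y" and Z: "smooth_vf M U Z"
    and zero: "\<And>q. q \<in> U \<Longrightarrow> br \<xi> X q = 0" "\<And>q. q \<in> U \<Longrightarrow> br \<xi> Y q = 0" "\<And>q. q \<in> U \<Longrightarrow> br \<xi> Z q = 0"
    and orth: "\<And>q. q \<in> U \<Longrightarrow> g q (X q) (\<xi> q) = 0" "\<And>q. q \<in> U \<Longrightarrow> g q (Y q) (\<xi> q) = 0" "\<And>q. q \<in> U \<Longrightarrow> g q
        (Z q) (\<xi> q) = 0"
    and p: "p \<in> U"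
  shows "\<xi> p (T X Y Z) = 0"
proof -
  note oU = smooth_vf_open[OF X] and S = vf_point[OF X p]
  note br = smooth_vf_lie_bracket[OF manifold]
  have d0: "A p (\<lambda>q. f q) = 0" if A: "smooth_vf M U A" and f: "\<And>q. q \<in> U \<Longrightarrow> f q = 0" for A f
    using tangent_cong[OF manifold smooth_vf_tangent[OF A p] oU p, of f "\<lambda>q. 0"] f
        tangent_const[OF smooth_vf_tangent[OF A p]] by simp
  have d1: "A p (T \<xi> B C) = - A p (\<lambda>q. g q (br B C q) (\<xi> q))"
    if A: "smooth_vf M U A" and B: "smooth_vf M U B" and C: "smooth_vf M U C"
      and o: "\<And>q. q \<in> U \<Longrightarrow> g q (B q) (\<xi> q) = 0" "\<And>q. q \<in> U \<Longrightarrow> g q (C q) (\<xi> q) = 0" for A B C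
  proof -
    have "A p (T \<xi> B C) = A p (\<lambda>q. 0 - g q (br B C q) (\<xi> q))"
    proof (rule tangent_cong[OF manifold smooth_vf_tangent[OF A p] oU p])
      fix q assume q: "q \<in> U"
      have *: "D q (\<lambda>q. g q (E q) (\<xi> q)) = 0" if D: "smooth_vf M U D" and E: "\<And>q. q \<in> U \<Longrightarrow> g q (E
          q) (\<xi> q) = 0" for D E
        using tangent_cong[OF manifold smooth_vf_tangent[OF D q] oU q, of "\<lambda>q. g q (E q) (\<xi> q)"
            "\<lambda>q. 0"] E
          tangent_const[OF smooth_vf_tangent[OF D q]] by simp
      show "T \<xi> B C q = 0 - g q (br B C q) (\<xi> q)"
        using parallel_T[OF B C q] *[OF B o(2)] *[OF C o(1)] by simp
    qed
    also have "\<dots> = - A p (\<lambda>q. g q (br B C q) (\<xi> q))"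
      using tangent_diff[OF smooth_vf_tangent[OF A p] smooth_near_const[OF S] smooth_nearI[OF
          g_smooth[OF br[OF B C] \<xi>] p], of 0]
        tangent_const[OF smooth_vf_tangent[OF A p]] by simp
    finally show ?thesis .
  qed
  have t0: "T (br \<xi> A) B C p = 0"
    if A: "smooth_vf M U A" and B: "smooth_vf M U B" and C: "smooth_vf M U C" and z: "br \<xi> A p =
        0" for A B C
  proof -
    note bA = br[OF \<xi> A]
    have "T (br \<xi> A) B C p = T B C (br \<xi> A) p"
      using T_antisym12[OF bA B C p] T_antisym23[OF B bA C p] by simp
    also have "\<dots> = g p (torsion M nab B C p) 0" using z by (simp add: torsion_form_def)
    also have "\<dots> = 0"
      by (rule g_zero_right[OF S])
        (simp add: torsion_def tangent_minus smooth_vf_tangent[OF _ p] nab_smooth br B C)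
    finally show ?thesis .
  qed
  have t1: "T (br A B) \<xi> C p = C p (\<lambda>q. g q (br A B q) (\<xi> q)) + g p (br (br A B) C p) (\<xi> p)"
    if A: "smooth_vf M U A" and B: "smooth_vf M U B" and C: "smooth_vf M U C"
      and o: "\<And>q. q \<in> U \<Longrightarrow> g q (C q) (\<xi> q) = 0" for A B C
    using T_antisym12[OF br[OF A B] \<xi> C p] parallel_T[OF br[OF A B] C p] d0[OF br[OF A B] o] by simp
  have "ext_deriv M (torsion_form M g nab) [\<xi>, X, Y, Z] p = 0"
    using torsion_closed \<xi> X Y Z p unfolding closed_form_def by simp
  \<comment> \<open>The derivatives of products such as \<open>g [Y,Z] \<xi>\<close> occur once from
    \<open>d1\<close> and once, with the opposite sign, from \<open>t1\<close>. Only double brackets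
    survive, and their sum vanishes by the Jacobi identity in \<open>j\<close>.\<close>
  then have e: "\<xi> p (T X Y Z) = g p (br (br X Y) Z p) (\<xi> p) - g p (br (br X Z) Y p) (\<xi> p) + g p
      (br (br Y Z) X p) (\<xi> p)"
    unfolding ext_deriv_4
    using d1[OF X Y Z orth(2,3)] d1[OF Y X Z orth(1,3)] d1[OF Z X Y orth(1,2)]
      t0[OF X Y Z zero(1)[OF p]] t0[OF Y X Z zero(2)[OF p]] t0[OF Z X Y zero(3)[OF p]]
      t1[OF X Y Z orth(3)] t1[OF X Z Y orth(2)] t1[OF Y Z X orth(1)] by linarith
  have tb: "br A B p \<in> TM p" if "smooth_vf M U A" "smooth_vf M U B" for A B
    using smooth_vf_tangent[OF br[OF that] p] .
  have j: "br (br X Y) Z p - br (br X Z) Y p + br (br Y Z) X p = 0"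
  proof -
    have "br (br X Y) Z p = - br Z (br X Y) p" "br (br Y Z) X p = - br X (br Y Z) p"
      by (simp_all add: lie_bracket_antisym[of M "br X Y" Z] lie_bracket_antisym[of M "br Y Z" X])
    moreover have "br (br X Z) Y p = br Y (br Z X) p"
    proof -
      have "br (br X Z) Y p = - br Y (br X Z) p" by (simp add: lie_bracket_antisym[of M "br X Z" Y])
      also have "br Y (br X Z) p = br Y (- br Z X) p" by (simp add: lie_bracket_antisym[of M X Z])
      also have "\<dots> = - br Y (br Z X) p" by (rule lie_bracket_uminus_right[OF Y br[OF Z X] p])
      finally show ?thesis by simp
    qed
    moreover have "br X (br Y Z) p + br Y (br Z X) p + br Z (br X Y) p = 0"
      by (rule lie_bracket_jacobi[OF manifold X Y Z p])
    ultimately show ?thesis by (simp add: algebra_simps add_eq_0_iff)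
  qed
  have "g p (br (br X Y) Z p - br (br X Z) Y p + br (br Y Z) X p) (\<xi> p) =
      g p (br (br X Y) Z p) (\<xi> p) - g p (br (br X Z) Y p) (\<xi> p) + g p (br (br Y Z) X p) (\<xi> p)"
    using S by (simp add: g_add g_minus tangent_minus tb br X Y Z smooth_vf_tangent[OF \<xi> p])
  then show ?thesis using e j g_zero[OF S smooth_vf_tangent[OF \<xi> p]] by simp
qed

text \<open>Every term on the right of the Koszul formula is annihilated by \<open>\<xi>\<close>:
  products of fields that commute with \<open>\<xi>\<close> because \<open>\<xi>\<close> is Killing,
  their derivatives along such fields because these commute with \<open>\<xi>\<close>, and the
  torsion by \<open>parallel_T_invariant\<close>.\<close>

lemma parallel_nab_invariant:
  assumes X: "smooth_vf M U X" and Y: "smooth_vf M U Y" and Z: "smooth_vf M U Z"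
    and zero: "\<And>q. q \<in> U \<Longrightarrow> br \<xi> X q = 0" "\<And>q. q \<in> U \<Longrightarrow> br \<xi> Y q = 0" "\<And>q. q \<in> U \<Longrightarrow> br \<xi> Z q = 0"
    and orth: "\<And>q. q \<in> U \<Longrightarrow> g q (X q) (\<xi> q) = 0" "\<And>q. q \<in> U \<Longrightarrow> g q (Y q) (\<xi> q) = 0" "\<And>q. q \<in> U \<Longrightarrow> g q
        (Z q) (\<xi> q) = 0"
    and p: "p \<in> U"
  shows "\<xi> p (\<lambda>q. g q (nab X Y q) (Z q)) = 0"
proof -
  note oU = smooth_vf_open[OF X] and S = vf_point[OF X p]
  note br = smooth_vf_lie_bracket[OF manifold]
  note t\<xi> = smooth_vf_tangent[OF \<xi> p]
  \<comment> \<open>Smoothness is part of \<open>null\<close> because derivations are additive only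
    on functions that are smooth near \<open>p\<close>.\<close>
  define null where "null f \<longleftrightarrow> smooth_near M p f \<and> \<xi> p f = 0" for f
  have null_add: "null (\<lambda>q. f q + h q)" and null_diff: "null (\<lambda>q. f q - h q)" if "null f" "null h"
      for f h
    using that smooth_near_lin(1)[of M p f h 1 1] smooth_near_lin(1)[of M p f h 1 "-1"]
      tangent_add[OF t\<xi>, of f h] tangent_diff[OF t\<xi>, of f h] by (simp_all add: null_def)
  have null_g: "null (\<lambda>q. g q (A q) (B q))"
    if A: "smooth_vf M U A" and B: "smooth_vf M U B" and z: "br \<xi> A p = 0" "br \<xi> B p = 0" for A B
    using smooth_nearI[OF g_smooth[OF A B] p] parallel_g[OF A B p] z g_zero[OF S] g_zero_right[OF S]
      smooth_vf_tangent[OF A p] smooth_vf_tangent[OF B p] by (simp add: null_def)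
  have null_Xg: "null (\<lambda>q. A q (\<lambda>r. g r (B r) (C r)))"
    if A: "smooth_vf M U A" and B: "smooth_vf M U B" and C: "smooth_vf M U C"
      and z: "\<And>q. q \<in> U \<Longrightarrow> br \<xi> A q = 0" "\<And>q. q \<in> U \<Longrightarrow> br \<xi> B q = 0" "\<And>q. q \<in> U \<Longrightarrow> br \<xi> C q = 0" for
          A B C
  proof -
    let ?k = "\<lambda>r. g r (B r) (C r)"
    have k: "smooth_near M p ?k" using smooth_nearI[OF g_smooth[OF B C] p] .
    have "\<xi> q ?k = 0" if q: "q \<in> U" for q
      using parallel_g[OF B C q] z that g_zero[OF vf_point[OF A q]] g_zero_right[OF vf_point[OF A
          q]]
        smooth_vf_tangent[OF B q] smooth_vf_tangent[OF C q] by simp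
    then have "A p (\<lambda>q. \<xi> q ?k) = 0"
      using tangent_cong[OF manifold smooth_vf_tangent[OF A p] oU p, of "\<lambda>q. \<xi> q ?k" "\<lambda>q. 0"]
        tangent_const[OF smooth_vf_tangent[OF A p]] by simp
    moreover have "br \<xi> A p ?k = 0" using z(1)[OF p] by simp
    ultimately have "\<xi> p (\<lambda>q. A q ?k) = 0" using lie_bracket_apply[OF k, of \<xi> A] by simp
    then show ?thesis using smooth_vf_near[OF A p k] by (simp add: null_def)
  qed
  have null_T: "null (T X Y Z)"
    using parallel_T_invariant[OF X Y Z zero orth p] smooth_nearI[OF T_smooth[OF X Y Z] p] by
        (simp add: null_def)
  let ?K = "\<lambda>q. X q (\<lambda>q. g q (Y q) (Z q)) + Y q (\<lambda>q. g q (X q) (Z q)) - Z q (\<lambda>q. g q (X q) (Y q))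
    + g q (br X Y q) (Z q) - g q (br X Z q) (Y q) - g q (br Y Z q) (X q) + T X Y Z q"
  have "null ?K"
    by (intro null_add null_diff null_T null_Xg X Y Z zero null_g br br_br_zero zero(1,2,3)[OF p] p)
  \<comment> \<open>The dummy summand \<open>0 * ?K q\<close> matches the two-term rule
    \<open>tangent_lin\<close>, which then extracts the factor 1/2.\<close>
  moreover have "\<xi> p (\<lambda>q. g q (nab X Y q) (Z q)) = \<xi> p (\<lambda>q. (1/2) * ?K q + 0 * ?K q)"
  proof (rule tangent_cong[OF manifold t\<xi> oU p])
    fix q assume "q \<in> U"
    from Koszul[OF X Y Z this] show "g q (nab X Y q) (Z q) = (1/2) * ?K q + 0 * ?K q" by simp
  qed
  ultimately show ?thesis using tangent_lin[OF t\<xi>, of ?K ?K "1/2" 0] by (simp add: null_def)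
qed

end

end


lemma smooth_vf_zero: "openin (mtop M) U \<Longrightarrow> smooth_vf M U 0"
  using smooth_fun_const[OF smooth_funD] by (auto simp: smooth_vf_def tangent_zero)

lemma pushforward_add: "pushforward N \<pi> p (u + v) = pushforward N \<pi> p u + pushforward N \<pi> p v"
  and pushforward_minus: "pushforward N \<pi> p (u - v) = pushforward N \<pi> p u - pushforward N \<pi> p v"
  and pushforward_uminus: "pushforward N \<pi> p (- u) = - pushforward N \<pi> p u"
  and pushforward_scale: "pushforward N \<pi> p (tscale a u) = tscale a (pushforward N \<pi> p u)"
  and pushforward_zero: "pushforward N \<pi> p 0 = 0"
  by (auto simp: pushforward_def tscale_def fun_eq_iff)

section \<open>The projection of a flow box onto its transversal ball\<close>

locale bismut_flow_box = bismut_manifold M g J nab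
  for M :: "('a, 'e::euclidean_space) mfd" and g :: "'a metric_tensor" and J :: "'a endo_field"
      and nab :: "'a conn" +
  fixes V :: "'a vfield" and U :: "'a set" and \<theta> :: "'a \<Rightarrow> (real \<times> real) \<times> 'f::euclidean_space" and
      r :: real
  assumes V_smooth: "smooth_vf M (topspace (mtop M)) V"
    and V_nonzero: "\<And>p. p \<in> topspace (mtop M) \<Longrightarrow> V p \<noteq> 0"
    and V_par: "parallel M nab V" and W_par: "parallel M nab (endo_app J V)"
    and V_hol: "\<And>U X p. smooth_vf M U X \<Longrightarrow> p \<in> U \<Longrightarrow> lie_deriv_endo M V J X p = 0"
    and W_hol: "\<And>U X p. smooth_vf M U X \<Longrightarrow> p \<in> U \<Longrightarrow> lie_deriv_endo M (endo_app J V) J X p = 0"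
    and chart: "smooth_chart M U \<theta>" and r: "r > 0" and img: "\<theta> ` U = ball 0 r \<times> ball 0 r"
    and V_eq: "\<And>p. p \<in> U \<Longrightarrow> V p = smooth_chart.cvec M U \<theta> p ((1, 0), 0)"
    and W_eq: "\<And>p. p \<in> U \<Longrightarrow> endo_app J V p = smooth_chart.cvec M U \<theta> p ((0, 1), 0)"
begin

abbreviation "B \<equiv> ball (0::'f) r"
abbreviation "N \<equiv> euclidean_mfd B"
abbreviation "W \<equiv> endo_app J V"
abbreviation "TN \<equiv> tangent_space N"

sublocale C: smooth_chart M U \<theta> by (rule chart)
sublocale D: smooth_chart N B "\<lambda>x. x" by (rule smooth_chart_euclidean) simp

definition proj :: "'a \<Rightarrow> 'f" where "proj p = snd (\<theta> p)"
text \<open>The central slice, a smooth section of \<open>proj\<close>. Whatever is constant along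
  the fibres descends to \<open>N\<close> by evaluation on it.\<close>

definition sect :: "'f \<Rightarrow> 'a" where "sect q = C.\<Omega> (0, q)"

abbreviation "tube Q \<equiv> U \<inter> proj -` Q"
abbreviation "pf \<equiv> pushforward N proj"

lemma W_apply: "W p = J p (V p)" by (simp add: endo_app_def)

lemma W_smooth: "smooth_vf M S W" by (rule J_smooth[OF V_smooth])

lemma U_S: "U \<subseteq> S" by (rule C.U_topspace)

lemma V_smooth_on: "openin (mtop M) A \<Longrightarrow> A \<subseteq> U \<Longrightarrow> smooth_vf M A V"
  and W_smooth_on: "openin (mtop M) A \<Longrightarrow> A \<subseteq> U \<Longrightarrow> smooth_vf M A W"
  using smooth_vf_subset[OF V_smooth] smooth_vf_subset[OF W_smooth] U_S by blast+

lemma V_tangent: "p \<in> U \<Longrightarrow> V p \<in> TM p" and W_tangent: "p \<in> U \<Longrightarrow> W p \<in> TM p"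
  using smooth_vf_tangent[OF V_smooth] smooth_vf_tangent[OF W_smooth] U_S by blast+

lemma proj_in: "p \<in> U \<Longrightarrow> proj p \<in> B"
  using img unfolding proj_def by (metis imageI mem_Times_iff)

lemma sect: assumes "q \<in> B" shows "sect q \<in> U" "\<theta> (sect q) = (0, q)" "proj (sect q) = q"
proof -
  have "(0, q) \<in> \<theta> ` U" using assms r by (simp add: img)
  then show "sect q \<in> U" "\<theta> (sect q) = (0, q)"
    using C.\<Omega>_in[OF order_refl] C.\<theta>_\<Omega> by (auto simp: sect_def)
  then show "proj (sect q) = q" by (simp add: proj_def)
qed

lemma tube_image: assumes "Q \<subseteq> B" shows "\<theta> ` tube Q = ball 0 r \<times> Q"
proof
  show "\<theta> ` tube Q \<subseteq> ball 0 r \<times> Q"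
  proof
    fix z assume "z \<in> \<theta> ` tube Q"
    then obtain p where p: "p \<in> U" "proj p \<in> Q" "z = \<theta> p" by auto
    then have "z \<in> ball 0 r \<times> ball 0 r" using img by blast
    then show "z \<in> ball 0 r \<times> Q" using p by (auto simp: proj_def mem_Times_iff)
  qed
  show "ball 0 r \<times> Q \<subseteq> \<theta> ` tube Q"
  proof
    fix z :: "(real \<times> real) \<times> 'f" assume z: "z \<in> ball 0 r \<times> Q"
    then have "z \<in> \<theta> ` U" using assms by (auto simp: img)
    then obtain p where "p \<in> U" "z = \<theta> p" by blast
    then show "z \<in> \<theta> ` tube Q" using z by (auto simp: proj_def)
  qed
qed

lemma tube_open: assumes "openin (mtop N) Q" shows "openin (mtop M) (tube Q)"
proof -
  have Q: "open Q" "Q \<subseteq> B" using assms openin_euclidean_mfd[OF open_ball, of 0 r Q] by auto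
  have "open (\<theta> ` tube Q)" unfolding tube_image[OF Q(2)] using Q(1) by (simp add: open_Times)
  then show ?thesis using C.open_iff[of "tube Q"] by simp
qed

lemma N_open: "openin (mtop N) Q \<Longrightarrow> open Q \<and> Q \<subseteq> B"
  using openin_euclidean_mfd[OF open_ball, of 0 r Q] by auto

lemma N_topspace: "topspace (mtop N) = B" by simp

lemma sect_tube: "Q \<subseteq> B \<Longrightarrow> q \<in> Q \<Longrightarrow> sect q \<in> tube Q"
  using sect[of q] by auto

lemma smooth_fun_pullback:
  assumes "smooth_fun N Q f"
  shows "smooth_fun M (tube Q) (f \<circ> proj)"
proof -
  have Q: "open Q" "Q \<subseteq> B" "smooth_on Q f" and oQ: "openin (mtop N) Q"
    using assms smooth_fun_euclidean[OF open_ball, of 0 r Q f] smooth_funD[OF assms] by blast+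
  have o: "open (ball (0::real \<times> real) r \<times> Q)" using Q(1) by (simp add: open_Times)
  have "smooth_on (ball (0::real \<times> real) r \<times> Q) (\<lambda>z. f (snd z))"
    by (rule smooth_on_compose[OF smooth_on_linear[OF bounded_linear_snd] Q(3) o Q(1)]) auto
  moreover have "(f \<circ> proj) (C.\<Omega> z) = f (snd z)" if "z \<in> ball 0 r \<times> Q" for z
  proof -
    have "z \<in> \<theta> ` U" using that Q(2) by (auto simp: img)
    then show ?thesis by (simp add: proj_def)
  qed
  ultimately have "smooth_on (\<theta> ` tube Q) (\<lambda>z. (f \<circ> proj) (C.\<Omega> z))"
    unfolding tube_image[OF Q(2)]
    using smooth_on_cong[OF o, of "\<lambda>z. (f \<circ> proj) (C.\<Omega> z)" "\<lambda>z. f (snd z)"] by blast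
  then show ?thesis using C.smooth_fun_iff[OF Int_lower1 tube_open[OF oQ], of "f \<circ> proj"] by blast
qed

lemma smooth_near_pullback:
  assumes "smooth_near N (proj p) f" "p \<in> U"
  shows "smooth_near M p (f \<circ> proj)"
proof -
  obtain Q where "proj p \<in> Q" "smooth_fun N Q f" using assms(1) unfolding smooth_near_def by blast
  then show ?thesis using smooth_nearI[OF smooth_fun_pullback] assms(2) by blast
qed

lemma smooth_fun_section:
  assumes k: "smooth_fun M (tube Q) k" and oQ: "openin (mtop N) Q"
  shows "smooth_fun N Q (\<lambda>q. k (sect q))"
proof -
  have Q: "open Q" "Q \<subseteq> B" using N_open[OF oQ] by auto
  have o: "open (ball (0::real \<times> real) r \<times> Q)" using Q(1) by (simp add: open_Times)
  have "smooth_on (ball 0 r \<times> Q) (\<lambda>z. k (C.\<Omega> z))"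
    using C.smooth_fun_iff[OF Int_lower1 tube_open[OF oQ], of k] k tube_image[OF Q(2)] by simp
  then have "smooth_on Q (\<lambda>q. k (C.\<Omega> (0, q)))"
    using smooth_on_compose[OF smooth_on_linear[OF bounded_linear_Pair_right] _ Q(1) o] r by
        fastforce
  then show ?thesis using Q smooth_fun_euclidean[OF open_ball, of 0 r Q] by (simp add: sect_def)
qed

lemma smooth_map_proj: "smooth_map M U N proj"
  unfolding smooth_map_def
proof (intro conjI ballI C.open_dom)
  have ts: "topspace (subtopology (mtop M) U) = U" using U_S by (rule topspace_subtopology_subset)
  show "continuous_map (subtopology (mtop M) U) (mtop N) proj"
    unfolding continuous_map_def ts
  proof (intro conjI allI impI)
    show "proj \<in> U \<rightarrow> topspace (mtop N)" using proj_in by auto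
    fix Q assume "openin (mtop N) Q"
    from tube_open[OF this] show "openin (subtopology (mtop M) U) {x \<in> U. proj x \<in> Q}"
      using openin_open_subtopology[OF C.open_dom] by (simp add: Int_def vimage_def)
  qed
  fix x assume x: "x \<in> atlas M"
  obtain A \<phi> where A: "x = (A, \<phi>)" by (cases x)
  have e: "A \<inter> U \<inter> proj -` B = A \<inter> U" using proj_in by auto
  have "smooth_on (\<phi> ` (A \<inter> U)) (\<lambda>x. snd (\<theta> (inv_into A \<phi> x)))"
    by (rule smooth_on_bounded_linear[OF bounded_linear_snd C.trans1]) (use x A in simp)
  then show "case x of (C, \<phi>) \<Rightarrow> \<forall>(D, \<psi>) \<in> atlas N.
      smooth_on (\<phi> ` (C \<inter> U \<inter> proj -` D)) (\<psi> \<circ> proj \<circ> inv_into C \<phi>)"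
    using e unfolding A by (simp add: o_def proj_def)
qed

lemma pf_apply: "smooth_near N (proj p) f \<Longrightarrow> pf p v f = v (f \<circ> proj)"
  and pf_not_smooth: "\<not> smooth_near N (proj p) f \<Longrightarrow> pf p v f = 0"
  by (simp_all add: pushforward_def)

lemma pf_tangent:
  assumes p: "p \<in> U" and v: "v \<in> TM p"
  shows "pf p v \<in> TN (proj p)"
  unfolding tangent_space_def mem_Collect_eq
proof (intro conjI allI impI pf_not_smooth)
  fix f h a b assume "smooth_near N (proj p) f \<and> smooth_near N (proj p) h"
  then have f: "smooth_near N (proj p) f" and h: "smooth_near N (proj p) h" by simp_all
  note fh = smooth_near_pullback[OF f p] smooth_near_pullback[OF h p]
  show "pf p v (\<lambda>x. a * f x + b * h x) = a * pf p v f + b * pf p v h"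
    using tangent_lin[OF v fh, of a b]
    by (simp add: pf_apply[OF smooth_near_lin(1)[OF f h]] pf_apply[OF f] pf_apply[OF h] o_def)
  show "pf p v (\<lambda>x. f x * h x) = f (proj p) * pf p v h + h (proj p) * pf p v f"
    using tangent_mult[OF v fh]
    by (simp add: pf_apply[OF smooth_near_lin(2)[OF f h]] pf_apply[OF f] pf_apply[OF h] o_def)
qed

lemma pf_cvec:
  assumes p: "p \<in> U"
  shows "pf p (C.cvec p (\<kappa>, y)) = D.cvec (proj p) y"
proof
  fix f show "pf p (C.cvec p (\<kappa>, y)) f = D.cvec (proj p) y f"
  proof (cases "smooth_near N (proj p) f")
    case True
    let ?F = "\<lambda>x. f (inv_into B (\<lambda>x. x) x)"
    have d: "(?F has_derivative frechet_derivative ?F (at (proj p))) (at (proj p))"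
      by (rule D.chart_differentiable[OF True proj_in[OF p]])
    have o: "open (ball (0::real \<times> real) r \<times> B)" by (simp add: open_Times)
    have z: "\<theta> p \<in> ball 0 r \<times> B" using p img by blast
    have "((\<lambda>z. ?F (snd z)) has_derivative (\<lambda>h. frechet_derivative ?F (at (proj p)) (snd h))) (at
        (\<theta> p))"
      by (rule has_derivative_compose[OF bounded_linear_imp_has_derivative[OF bounded_linear_snd]])
        (use d in \<open>simp add: proj_def\<close>)
    then have "((\<lambda>z. (f \<circ> proj) (C.\<Omega> z)) has_derivative (\<lambda>h. frechet_derivative ?F (at (proj p))
        (snd h))) (at (\<theta> p))"
    proof (rule has_derivative_transform_within_open[OF _ o z])
      fix z :: "(real \<times> real) \<times> 'f" assume z: "z \<in> ball 0 r \<times> B"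
      have "z \<in> \<theta> ` U" using z by (simp add: img)
      moreover have "snd z \<in> B" using z by (simp add: mem_Times_iff)
      ultimately show "?F (snd z) = (f \<circ> proj) (C.\<Omega> z)" by (simp only: o_apply proj_def C.\<theta>_\<Omega>
          inv_into_id)
    qed
    from frechet_derivative_at[OF this]
    have "frechet_derivative (\<lambda>z. (f \<circ> proj) (C.\<Omega> z)) (at (\<theta> p)) (\<kappa>, y) = frechet_derivative ?F
        (at (proj p)) y"
      by (metis snd_conv)
    then show ?thesis
      using True smooth_near_pullback[OF True p] by (simp add: pf_apply C.cvec_def D.cvec_def)
  qed (simp add: pf_not_smooth D.cvec_def)
qed

lemma pf_V: "p \<in> U \<Longrightarrow> pf p (V p) = 0" and pf_W: "p \<in> U \<Longrightarrow> pf p (W p) = 0"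
  using V_eq W_eq pf_cvec D.cvec_zero[OF proj_in] by simp_all

lemma pf_zero:
  assumes p: "p \<in> U" and v: "v \<in> TM p" and z: "pf p v = 0"
  obtains a b where "v = tscale a (V p) + tscale b (W p)"
proof -
  obtain a b y where w: "C.ccomp v = ((a, b), y)" by (metis prod.exhaust)
  have veq: "v = C.cvec p ((a, b), y)" using C.tangent_eq_cvec[OF p v] w by simp
  have "D.cvec (proj p) y = D.cvec (proj p) 0"
    using z pf_cvec[OF p] veq D.cvec_zero[OF proj_in[OF p]] by simp
  then have "y = 0" using D.ccomp_cvec[OF proj_in[OF p]] by metis
  then have "v = C.cvec p (a *\<^sub>R ((1, 0), 0) + b *\<^sub>R ((0, 1), 0))" using veq by simp
  also have "\<dots> = tscale a (V p) + tscale b (W p)"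
    unfolding C.cvec_lin[OF p] using V_eq[OF p] W_eq[OF p] by simp
  finally show ?thesis by (rule that)
qed

subsection \<open>Horizontal lifts\<close>

lemma g_V_W: "p \<in> U \<Longrightarrow> g p (V p) (W p) = 0" "p \<in> U \<Longrightarrow> g p (W p) (V p) = 0"
  and g_W_W: "p \<in> U \<Longrightarrow> g p (W p) (W p) = g p (V p) (V p)"
  using g_J_self[of p "V p"] g_sym[of p "V p" "W p"] g_J[of p "V p" "V p"] V_tangent W_tangent U_S
  by (auto simp: W_apply)

definition len2 :: real where "len2 = g (sect 0) (V (sect 0)) (V (sect 0))"

text \<open>A parallel field of a metric connection has constant length: the derivative of its
  squared length vanishes in every coordinate direction, and the coordinate box is convex.\<close>

lemma g_V_V: assumes "p \<in> U" shows "g p (V p) (V p) = len2"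
proof -
  let ?k = "\<lambda>p. g p (V p) (V p)"
  have Vs: "smooth_vf M U V" by (rule V_smooth_on[OF C.open_dom order_refl])
  have P: "convex (ball (0::real \<times> real) r \<times> B)" "open (ball (0::real \<times> real) r \<times> B)"
    by (simp_all add: convex_Times open_Times)
  have "((\<lambda>z. ?k (C.\<Omega> z)) has_derivative (\<lambda>h. 0)) (at z within ball 0 r \<times> B)" if z: "z \<in> ball 0 r
      \<times> B" for z
  proof -
    obtain q where q: "q \<in> U" "z = \<theta> q" using z img by blast
    have k: "smooth_near M q ?k" using smooth_nearI[OF g_smooth[OF Vs Vs] q(1)] .
    have "frechet_derivative (\<lambda>z. ?k (C.\<Omega> z)) (at z) w = 0" for w
    proof -
      have X: "smooth_vf M U (\<lambda>p. C.cvec p w)"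
        by (rule C.smooth_vf_cvec[OF order_refl C.open_dom, of "\<lambda>p. w"]) (auto intro:
            smooth_on_const)
      have "C.cvec q w ?k = 0"
        using metric_compat[OF X Vs Vs q(1)] nab_parallel[OF Vs V_par X q(1)]
        by (simp add: g_zero g_zero_right V_tangent q(1) subsetD[OF U_S q(1)])
      then show ?thesis using k q(2) by (simp add: C.cvec_def)
    qed
    then have "frechet_derivative (\<lambda>z. ?k (C.\<Omega> z)) (at z) = (\<lambda>h. 0)" by (rule ext)
    then have "((\<lambda>z. ?k (C.\<Omega> z)) has_derivative (\<lambda>h. 0)) (at z)"
      using C.chart_differentiable[OF k q(1)] unfolding q(2) by simp
    then show ?thesis by (rule has_derivative_at_withinI)
  qed
  from has_derivative_zero_constant[OF P(1) this]
  obtain c where c: "\<And>z. z \<in> ball 0 r \<times> B \<Longrightarrow> ?k (C.\<Omega> z) = c" by blast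
  have "?k q = c" if "q \<in> U" for q
    using c[of "\<theta> q"] that img by auto
  then show ?thesis using assms sect(1)[of 0] r by (simp add: len2_def)
qed

lemma len2_pos: "len2 > 0"
proof -
  have s: "sect 0 \<in> U" using sect(1)[of 0] r by simp
  show ?thesis unfolding len2_def
    by (rule g_pos) (use s U_S V_tangent V_nonzero in blast)+
qed

definition hor :: "'a \<Rightarrow> 'a tvec \<Rightarrow> bool" where
  "hor p v \<longleftrightarrow> v \<in> TM p \<and> g p v (V p) = 0 \<and> g p v (W p) = 0"

lemma hor_tangent: "hor p v \<Longrightarrow> v \<in> TM p" by (simp add: hor_def)

lemma hor_add: "p \<in> U \<Longrightarrow> hor p u \<Longrightarrow> hor p v \<Longrightarrow> hor p (u + v)"
  and hor_minus: "p \<in> U \<Longrightarrow> hor p u \<Longrightarrow> hor p v \<Longrightarrow> hor p (u - v)"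
  and hor_scale: "p \<in> U \<Longrightarrow> hor p u \<Longrightarrow> hor p (tscale a u)"
  using U_S V_tangent W_tangent
  by (auto simp: hor_def tangent_plus tangent_minus tangent_scale g_add g_minus g_scale subset_eq)

lemma hor_vertical:
  assumes p: "p \<in> U" and h: "hor p u" and v: "v \<in> TM p" "pf p v = 0"
  shows "g p u v = 0"
proof -
  obtain a b where "v = tscale a (V p) + tscale b (W p)" by (rule pf_zero[OF p v])
  then show ?thesis using h p U_S V_tangent[OF p] W_tangent[OF p]
    by (auto simp: hor_def g_lin_right subset_eq)
qed

lemma hor_pf_zero: "p \<in> U \<Longrightarrow> hor p v \<Longrightarrow> pf p v = 0 \<Longrightarrow> v = 0"
  using hor_vertical[of p v v] g_self_zero[of p v] U_S hor_tangent by blast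

lemma hor_eqI:
  assumes "p \<in> U" "hor p u" "hor p v" "pf p u = pf p v"
  shows "u = v"
  using hor_pf_zero[OF assms(1) hor_minus[OF assms(1-3)]] assms(4) by (simp add: pushforward_minus)

definition hat :: "'a \<Rightarrow> 'f tvec \<Rightarrow> 'a tvec" where "hat p x = C.cvec p (0, D.ccomp x)"

text \<open>The vector \<open>hat p x\<close> lies over \<open>x\<close> but is adapted to the
  coordinates and not to the metric. Its orthogonal projection to the vertical plane is subtracted;
  \<open>V\<close> and \<open>W\<close> are orthogonal with the common squared length
  \<open>len2\<close>, hence the two quotients.\<close>

definition lift :: "'a \<Rightarrow> 'f tvec \<Rightarrow> 'a tvec" where
  "lift p x = hat p x - tscale (g p (hat p x) (V p) / len2) (V p) - tscale (g p (hat p x) (W p) /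
      len2) (W p)"

lemma lift_hor: assumes p: "p \<in> U" shows "hor p (lift p x)"
proof -
  have t: "hat p x \<in> TM p" using C.cvec_tangent[OF p] by (simp add: hat_def)
  note t' = t V_tangent[OF p] W_tangent[OF p] subsetD[OF U_S p]
  show ?thesis using len2_pos
    by (simp add: hor_def lift_def t' tangent_minus tangent_scale g_minus g_scale g_V_V g_V_W
        g_W_W p)
qed

lemma pf_lift: assumes p: "p \<in> U" and x: "x \<in> TN (proj p)" shows "pf p (lift p x) = x"
  using pf_V[OF p] pf_W[OF p] pf_cvec[OF p] D.tangent_eq_cvec[OF proj_in[OF p] x]
  by (simp add: lift_def hat_def pushforward_minus pushforward_scale)

lemma lift_pf: "p \<in> U \<Longrightarrow> hor p v \<Longrightarrow> lift p (pf p v) = v"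
  by (rule hor_eqI[OF _ lift_hor _ pf_lift[OF _ pf_tangent]]) (simp_all add: hor_tangent)

lemma lift_tangent: "p \<in> U \<Longrightarrow> lift p x \<in> TM p"
  using lift_hor hor_tangent by blast

lemma lift_lin:
  assumes p: "p \<in> U" and x: "x \<in> TN (proj p)" and y: "y \<in> TN (proj p)"
  shows "lift p (tscale a x + tscale b y) = tscale a (lift p x) + tscale b (lift p y)"
  by (rule hor_eqI[OF p])
    (simp_all add: lift_hor hor_add hor_scale p pf_lift x y tangent_plus tangent_scale
        pushforward_add pushforward_scale)

lemma lift_add: "p \<in> U \<Longrightarrow> x \<in> TN (proj p) \<Longrightarrow> y \<in> TN (proj p) \<Longrightarrow> lift p (x + y) = lift p x + lift p y"
  and lift_scale: "p \<in> U \<Longrightarrow> x \<in> TN (proj p) \<Longrightarrow> lift p (tscale a x) = tscale a (lift p x)"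
  using lift_lin[of p x y 1 1] lift_lin[of p x x a 0] by simp_all

lemma vertical_space_eq:
  assumes p: "p \<in> U"
  shows "vertical_space M N proj p = {tscale a (V p) + tscale b (J p (V p)) | a b. True}"
proof (intro equalityI subsetI)
  fix v assume "v \<in> vertical_space M N proj p"
  then have "v \<in> TM p" "pf p v = 0" by (simp_all add: vertical_space_def)
  then obtain a b where "v = tscale a (V p) + tscale b (W p)" by (rule pf_zero[OF p])
  then show "v \<in> {tscale a (V p) + tscale b (J p (V p)) | a b. True}" by (auto simp: W_apply)
next
  fix v assume "v \<in> {tscale a (V p) + tscale b (J p (V p)) | a b. True}"
  then obtain a b where v: "v = tscale a (V p) + tscale b (W p)" by (auto simp: W_apply)
  then show "v \<in> vertical_space M N proj p"
    using pf_V[OF p] pf_W[OF p] V_tangent[OF p] W_tangent[OF p]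
    by (simp add: vertical_space_def tangent_plus tangent_scale pushforward_add pushforward_scale)
qed

lemma horizontal_space_eq:
  assumes p: "p \<in> U"
  shows "horizontal_space M g N proj p = {v. hor p v}"
proof (intro equalityI subsetI)
  fix v assume v: "v \<in> horizontal_space M g N proj p"
  have "V p \<in> vertical_space M N proj p" "W p \<in> vertical_space M N proj p"
    using pf_V[OF p] pf_W[OF p] V_tangent[OF p] W_tangent[OF p] by (simp_all add:
        vertical_space_def)
  then show "v \<in> {v. hor p v}" using v by (simp add: horizontal_space_def hor_def)
next
  fix v assume "v \<in> {v. hor p v}"
  then have h: "hor p v" by simp
  show "v \<in> horizontal_space M g N proj p"
    unfolding horizontal_space_def vertical_space_def mem_Collect_eq
    by (intro conjI ballI hor_tangent[OF h] hor_vertical[OF p h]) simp_all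
qed

lemma horizontal_lift_iff:
  assumes p: "p \<in> U" and x: "x \<in> TN (proj p)"
  shows "is_horizontal_lift M g N proj p x v \<longleftrightarrow> v = lift p x"
  using horizontal_space_eq[OF p] lift_pf[OF p] lift_hor[OF p] pf_lift[OF p x]
  by (auto simp: is_horizontal_lift_def)

definition L :: "'f vfield \<Rightarrow> 'a vfield" where "L X = (\<lambda>p. lift p (X (proj p)))"

lemma L_smooth:
  assumes X: "smooth_vf N Q X"
  shows "smooth_vf M (tube Q) (L X)"
proof -
  note oQ = smooth_vf_open[OF X]
  have Q: "open Q" "Q \<subseteq> B" using N_open[OF oQ] by auto
  note oT = tube_open[OF oQ]
  define H where "H p = hat p (X (proj p))" for p
  have "smooth_on Q (\<lambda>q. X q (\<lambda>q. q \<bullet> i))" for i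
    using smooth_vf_fun[OF X smooth_fun_subset[OF D.coord_smooth Q(2) oQ] order_refl]
      smooth_fun_euclidean[OF open_ball, of 0 r Q] by blast
  then have cs: "smooth_on Q (\<lambda>q. D.ccomp (X q))"
    unfolding D.ccomp_def by (intro smooth_on_sum smooth_on_scaleR smooth_on_const)
  have o: "open (ball (0::real \<times> real) r \<times> Q)" using Q(1) by (simp add: open_Times)
  have "smooth_on (ball (0::real \<times> real) r \<times> Q) (\<lambda>z. D.ccomp (X (snd z)))"
    by (rule smooth_on_compose[OF smooth_on_linear[OF bounded_linear_snd] cs o Q(1)]) auto
  then have "smooth_on (ball (0::real \<times> real) r \<times> Q) (\<lambda>z. (0 :: real \<times> real, D.ccomp (X (snd z))))"
    by (rule smooth_on_Pair[OF smooth_on_const])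
  moreover have "D.ccomp (X (proj (C.\<Omega> z))) = D.ccomp (X (snd z))" if "z \<in> ball 0 r \<times> Q" for z
  proof -
    have "z \<in> \<theta> ` U" using that Q(2) by (auto simp: img)
    then show ?thesis by (simp add: proj_def)
  qed
  ultimately have "smooth_on (\<theta> ` tube Q) (\<lambda>z. (0 :: real \<times> real, D.ccomp (X (proj (C.\<Omega> z)))))"
    unfolding tube_image[OF Q(2)]
    using smooth_on_cong[OF o, of "\<lambda>z. (0 :: real \<times> real, D.ccomp (X (proj (C.\<Omega> z))))" "\<lambda>z. (0,
        D.ccomp (X (snd z)))"] by simp
  then have H: "smooth_vf M (tube Q) H"
    by (rule C.smooth_vf_cvec[OF Int_lower1 oT, of "\<lambda>p. (0, D.ccomp (X (proj p)))"]) (simp add: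
        H_def hat_def)
  note Vt = V_smooth_on[OF oT Int_lower1] and Wt = W_smooth_on[OF oT Int_lower1]
  have "L X = H - fscale (\<lambda>p. 1 / len2 * g p (H p) (V p)) V - fscale (\<lambda>p. 1 / len2 * g p (H p) (W
      p)) W"
    by (simp add: L_def H_def lift_def fscale_def fun_eq_iff)
  moreover have "smooth_vf M (tube Q) (H - fscale (\<lambda>p. 1 / len2 * g p (H p) (V p)) V - fscale (\<lambda>p.
      1 / len2 * g p (H p) (W p)) W)"
    by (intro smooth_vf_minus smooth_vf_fscale H Vt Wt smooth_fun_cmult g_smooth)
  ultimately show ?thesis by simp
qed

lemma pf_L: "smooth_vf N Q X \<Longrightarrow> p \<in> tube Q \<Longrightarrow> pf p (L X p) = X (proj p)"
  unfolding L_def by (rule pf_lift) (auto dest: smooth_vf_tangent)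

lemma L_hor: "p \<in> U \<Longrightarrow> hor p (L X p)"
  by (simp add: L_def lift_hor)

text \<open>Second derivatives of a pulled-back function along \<open>proj\<close>-related fields
  are computed on \<open>N\<close>. The difference of two such identities shows that brackets of
  related fields are related.\<close>

lemma related_apply:
  assumes E: "smooth_vf M (tube Q) E" and Y': "smooth_vf N Q Y'" and p: "p \<in> tube Q"
    and rel: "pf p (E p) = Y (proj p)" "\<And>q. q \<in> tube Q \<Longrightarrow> pf q (E' q) = Y' (proj q)"
    and f: "smooth_near N (proj p) f"
  shows "E p (\<lambda>q. E' q (f \<circ> proj)) = Y (proj p) (\<lambda>q. Y' q f)"
proof -
  have pU: "p \<in> U" and pQ: "proj p \<in> Q" using p by auto
  obtain Q1 where Q1: "smooth_fun N Q1 f" "Q1 \<subseteq> Q" "proj p \<in> Q1"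
    by (rule smooth_nearE[OF f smooth_vf_open[OF Y'] pQ])
  have oT: "openin (mtop M) (tube Q1)" by (rule tube_open[OF smooth_funD[OF Q1(1)]])
  have p1: "p \<in> tube Q1" using pU Q1(3) by simp
  have "E' q (f \<circ> proj) = ((\<lambda>q. Y' q f) \<circ> proj) q" if q: "q \<in> tube Q1" for q
  proof -
    have qQ: "q \<in> tube Q" "proj q \<in> Q1" using q Q1(2) by auto
    have "E' q (f \<circ> proj) = pf q (E' q) f" by (rule pf_apply[OF smooth_nearI[OF Q1(1) qQ(2)],
        symmetric])
    then show ?thesis by (simp only: rel(2)[OF qQ(1)] o_apply)
  qed
  then have "E p (\<lambda>q. E' q (f \<circ> proj)) = E p ((\<lambda>q. Y' q f) \<circ> proj)"
    by (rule tangent_cong[OF manifold smooth_vf_tangent[OF E p] oT p1])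
  also have "\<dots> = pf p (E p) (\<lambda>q. Y' q f)"
    by (rule pf_apply[OF smooth_vf_near[OF Y' pQ f], symmetric])
  finally show ?thesis by (simp only: rel(1))
qed

lemma pf_bracket:
  assumes A: "smooth_vf M (tube Q) A" and A': "smooth_vf M (tube Q) A'"
    and X: "smooth_vf N Q X" and X': "smooth_vf N Q X'"
    and rel: "\<And>p. p \<in> tube Q \<Longrightarrow> pf p (A p) = X (proj p)" "\<And>p. p \<in> tube Q \<Longrightarrow> pf p (A' p) = X' (proj p)"
    and p: "p \<in> tube Q"
  shows "pf p (br A A' p) = lie_bracket N X X' (proj p)"
proof
  fix f
  have pU: "p \<in> U" using p by auto
  show "pf p (br A A' p) f = lie_bracket N X X' (proj p) f"
  proof (cases "smooth_near N (proj p) f")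
    case True
    have 1: "A p (\<lambda>q. A' q (f \<circ> proj)) = X (proj p) (\<lambda>q. X' q f)"
      by (rule related_apply[OF A X' p _ _ True]) (use rel p in auto)
    have 2: "A' p (\<lambda>q. A q (f \<circ> proj)) = X' (proj p) (\<lambda>q. X q f)"
      by (rule related_apply[OF A' X p _ _ True]) (use rel p in auto)
    show ?thesis
      by (simp only: pf_apply[OF True] lie_bracket_apply[OF True] lie_bracket_apply[OF
          smooth_near_pullback[OF True pU]] 1 2)
  qed (simp add: pf_not_smooth lie_bracket_not_smooth)
qed

subsection \<open>Descent along the fibres\<close>

lemma br_V_W: "p \<in> S \<Longrightarrow> br V W p = 0"
  using V_hol[OF V_smooth, of p] by (simp add: lie_deriv_endo_def lie_bracket_self endo_app_def
      J_zero)

text \<open>A common name for the two fields, so that each descent argument is carried out once.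
  With one field in \<open>\<xi>\<close> and the other in \<open>\<eta>\<close>, it also covers the
  pairs needed for horizontality.\<close>

definition vert :: "'a vfield \<Rightarrow> bool" where "vert \<xi> \<longleftrightarrow> \<xi> = V \<or> \<xi> = W"

lemma vertD:
  assumes "vert \<xi>"
  shows "parallel M nab \<xi>" "openin (mtop M) A \<Longrightarrow> A \<subseteq> U \<Longrightarrow> smooth_vf M A \<xi>" "p \<in> U \<Longrightarrow> pf p (\<xi> p) = 0"
    "hor p v \<Longrightarrow> g p v (\<xi> p) = 0" "vert \<eta> \<Longrightarrow> p \<in> U \<Longrightarrow> br \<xi> \<eta> p = 0"
    "smooth_vf M A X \<Longrightarrow> q \<in> A \<Longrightarrow> br \<xi> (endo_app J X) q = J q (br \<xi> X q)"
proof -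
  have \<xi>: "\<xi> = V \<or> \<xi> = W" using assms by (simp add: vert_def)
  show "parallel M nab \<xi>" using \<xi> V_par W_par by blast
  show "openin (mtop M) A \<Longrightarrow> A \<subseteq> U \<Longrightarrow> smooth_vf M A \<xi>" using \<xi> V_smooth_on W_smooth_on by blast
  show "p \<in> U \<Longrightarrow> pf p (\<xi> p) = 0" using \<xi> pf_V pf_W by blast
  show "hor p v \<Longrightarrow> g p v (\<xi> p) = 0" using \<xi> by (auto simp: hor_def)
  show "br \<xi> \<eta> p = 0" if "vert \<eta>" "p \<in> U"
    using \<xi> that br_V_W[of p] U_S lie_bracket_antisym[of M W V]
    by (auto simp: vert_def lie_bracket_self)
  show "br \<xi> (endo_app J X) q = J q (br \<xi> X q)" if "smooth_vf M A X" "q \<in> A"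
    using \<xi> V_hol[OF that] W_hol[OF that] by (auto simp: lie_deriv_endo_def endo_app_def)
qed

lemma vert_intros: "vert V" "vert W" by (simp_all add: vert_def)

lemma horI: "v \<in> TM p \<Longrightarrow> (\<And>\<xi>. vert \<xi> \<Longrightarrow> g p v (\<xi> p) = 0) \<Longrightarrow> hor p v"
  using vert_intros by (simp add: hor_def)

lemma pf_br_vert:
  assumes \<xi>: "vert \<xi>" and A: "smooth_vf M (tube Q) A" and X: "smooth_vf N Q X"
    and rel: "\<And>p. p \<in> tube Q \<Longrightarrow> pf p (A p) = X (proj p)" and p: "p \<in> tube Q"
  shows "pf p (br \<xi> A p) = 0"
proof -
  note oQ = smooth_vf_open[OF X]
  have "pf p (br \<xi> A p) = lie_bracket N 0 X (proj p)"
    by (rule pf_bracket[OF vertD(2)[OF \<xi> tube_open[OF oQ]] A smooth_vf_zero[OF oQ] X _ rel p])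
      (use vertD(3)[OF \<xi>] in auto)
  also have "\<dots> = - lie_bracket N X 0 (proj p)" by (simp add: lie_bracket_antisym[of N 0 X])
  also have "\<dots> = 0" using lie_bracket_zero_right[OF X, of "proj p"] p by simp
  finally show ?thesis .
qed

text \<open>Differentiation of \<open>g A \<eta> = 0\<close> along the Killing field
  \<open>\<xi>\<close> gives \<open>g [\<xi>,A] \<eta> + g A [\<xi>,\<eta>] = 0\<close>, and the
  second term vanishes because \<open>V\<close> and \<open>W\<close> commute.\<close>

lemma br_vert_hor:
  assumes \<xi>: "vert \<xi>" and A: "smooth_vf M A0 A" "A0 \<subseteq> U" and h: "\<And>p. p \<in> A0 \<Longrightarrow> hor p (A p)" and p:
      "p \<in> A0"
  shows "hor p (br \<xi> A p)"
proof (rule horI)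
  note oA = smooth_vf_open[OF A(1)]
  note \<xi>s = vertD(2)[OF \<xi> oA A(2)]
  have pS: "p \<in> S" using vf_point[OF A(1) p] .
  show "br \<xi> A p \<in> TM p" using smooth_vf_tangent[OF smooth_vf_lie_bracket[OF manifold \<xi>s A(1)] p] .
  fix \<eta> assume \<eta>: "vert \<eta>"
  note \<eta>s = vertD(2)[OF \<eta> oA A(2)]
  have "\<xi> p (\<lambda>q. g q (A q) (\<eta> q)) = \<xi> p (\<lambda>q. 0)"
    by (rule tangent_cong[OF manifold smooth_vf_tangent[OF \<xi>s p] oA p]) (rule vertD(4)[OF \<eta> h])
  also have "\<dots> = 0" by (rule tangent_const[OF smooth_vf_tangent[OF \<xi>s p]])
  finally have "g p (br \<xi> A p) (\<eta> p) + g p (A p) (br \<xi> \<eta> p) = 0"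
    using parallel_g[OF \<xi>s vertD(1)[OF \<xi>] A(1) \<eta>s p] by simp
  then show "g p (br \<xi> A p) (\<eta> p) = 0"
    using vertD(5)[OF \<xi> \<eta>, of p] p A(2) g_zero_right[OF pS smooth_vf_tangent[OF A(1) p]] by auto
qed

text \<open>The bracket projects to a bracket with the zero field, since \<open>\<xi>\<close> is
  related to zero; so it is vertical. It is also horizontal by \<open>br_vert_hor\<close>, and only
  the zero vector is both.\<close>

lemma br_vert_L:
  assumes \<xi>: "vert \<xi>" and X: "smooth_vf N Q X" and p: "p \<in> tube Q"
  shows "br \<xi> (L X) p = 0"
proof (rule hor_pf_zero)
  show "p \<in> U" using p by simp
  show "hor p (br \<xi> (L X) p)"
    by (rule br_vert_hor[OF \<xi> L_smooth[OF X] Int_lower1 _ p]) (simp add: L_hor)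
  show "pf p (br \<xi> (L X) p) = 0"
    by (rule pf_br_vert[OF \<xi> L_smooth[OF X] X _ p]) (rule pf_L[OF X])
qed

text \<open>In the flow box the fibre through \<open>p\<close> is a disc on which \<open>V\<close>
  and \<open>W\<close> are the coordinate fields. A function killed by both has vanishing derivative
  on the disc, and \<open>sect (proj p)\<close> is its centre.\<close>

lemma invariant_fun:
  assumes k: "smooth_fun M (tube Q) k" and oQ: "openin (mtop N) Q"
    and z: "\<And>\<xi> p. vert \<xi> \<Longrightarrow> p \<in> tube Q \<Longrightarrow> \<xi> p k = 0" and p: "p \<in> tube Q"
  shows "k p = k (sect (proj p))"
proof -
  have Q: "open Q" "Q \<subseteq> B" using N_open[OF oQ] by auto
  have pQ: "proj p \<in> Q" "p \<in> U" using p by auto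
  let ?K = "ball (0::real \<times> real) r"
  have "((\<lambda>a. k (C.\<Omega> (a, proj p))) has_derivative (\<lambda>h. 0)) (at a within ?K)" if a: "a \<in> ?K" for a
  proof -
    have "(a, proj p) \<in> \<theta> ` tube Q" using a pQ tube_image[OF Q(2)] by simp
    then obtain q where q: "q \<in> tube Q" "\<theta> q = (a, proj p)" by auto
    have qU: "q \<in> U" using q by simp
    have kn: "smooth_near M q k" by (rule smooth_nearI[OF k q(1)])
    let ?D = "frechet_derivative (\<lambda>x. k (C.\<Omega> x)) (at (\<theta> q))"
    note d = C.chart_differentiable[OF kn qU]
    have "((\<lambda>a. (a, proj p)) has_derivative (\<lambda>h. (h, 0))) (at a)"
      by (auto intro!: derivative_eq_intros)
    then have "((\<lambda>a. k (C.\<Omega> (a, proj p))) has_derivative (\<lambda>h. ?D (h, 0))) (at a)"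
      by (rule has_derivative_compose) (use d q(2) in simp)
    moreover have "?D (h, 0) = 0" for h
    proof -
      have "C.cvec q (fst h *\<^sub>R ((1, 0), 0) + snd h *\<^sub>R ((0, 1), 0)) k = 0"
        unfolding C.cvec_lin[OF qU] using z[OF vert_intros(1) q(1)] z[OF vert_intros(2) q(1)]
        by (simp add: tscale_def V_eq[OF qU, symmetric] W_eq[OF qU, symmetric])
      then show ?thesis using kn by (simp add: C.cvec_def)
    qed
    ultimately have "((\<lambda>a. k (C.\<Omega> (a, proj p))) has_derivative (\<lambda>h. 0)) (at a)" by simp
    then show ?thesis by (rule has_derivative_at_withinI)
  qed
  from has_derivative_zero_constant[OF convex_ball this]
  obtain c where c: "\<And>a. a \<in> ?K \<Longrightarrow> k (C.\<Omega> (a, proj p)) = c" by blast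
  have "fst (\<theta> p) \<in> ?K" using img pQ(2) by (metis imageI mem_Times_iff)
  from c[OF this] have "k p = c" using pQ(2) by (simp add: proj_def)
  moreover have "k (sect (proj p)) = c" using c[of 0] r by (simp add: sect_def)
  ultimately show ?thesis by simp
qed

definition desc :: "'a vfield \<Rightarrow> 'f vfield" where "desc A q = pf (sect q) (A (sect q))"

text \<open>The converse of \<open>br_vert_L\<close>. For \<open>F = f \<circ> proj\<close> one has
  \<open>\<xi>(A F) = [\<xi>,A] F + A(\<xi> F) = 0\<close>, because \<open>A\<close> commutes with
  \<open>\<xi>\<close> and \<open>F\<close> is constant along the fibres. So \<open>A F\<close> is
  constant along the fibres, and the projection of \<open>A p\<close> depends on
  \<open>proj p\<close> alone.\<close>

lemma desc:
  assumes A: "smooth_vf M (tube Q) A" and oQ: "openin (mtop N) Q"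
    and h: "\<And>p. p \<in> tube Q \<Longrightarrow> hor p (A p)" and b: "\<And>\<xi> p. vert \<xi> \<Longrightarrow> p \<in> tube Q \<Longrightarrow> br \<xi> A p = 0"
  shows "smooth_vf N Q (desc A)" "\<And>p. p \<in> tube Q \<Longrightarrow> pf p (A p) = desc A (proj p)"
    "\<And>p. p \<in> tube Q \<Longrightarrow> L (desc A) p = A p"
proof -
  have Q: "open Q" "Q \<subseteq> B" using N_open[OF oQ] by auto
  show pf: "pf p (A p) = desc A (proj p)" if p: "p \<in> tube Q" for p
  proof
    fix f
    have pU: "p \<in> U" "proj p \<in> Q" using p by auto
    have pB: "proj p \<in> B" using proj_in[OF pU(1)] .
    show "pf p (A p) f = desc A (proj p) f"
    proof (cases "smooth_near N (proj p) f")
      case True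
      let ?F = "f \<circ> proj"
      obtain Q1 where Q1: "smooth_fun N Q1 f" "Q1 \<subseteq> Q" "proj p \<in> Q1"
        by (rule smooth_nearE[OF True oQ pU(2)])
      note oT = tube_open[OF smooth_funD[OF Q1(1)]]
      have sub: "tube Q1 \<subseteq> tube Q" using Q1(2) by auto
      have F: "smooth_fun M (tube Q1) ?F" by (rule smooth_fun_pullback[OF Q1(1)])
      have k: "smooth_fun M (tube Q1) (\<lambda>q. A q ?F)" by (rule smooth_vf_fun[OF A F sub])
      have "A p ?F = A (sect (proj p)) ?F"
      proof (rule invariant_fun[OF k smooth_funD[OF Q1(1)]])
        show "p \<in> tube Q1" using pU Q1 by simp
        fix \<xi> q assume \<xi>: "vert \<xi>" and q: "q \<in> tube Q1"
        have qQ: "q \<in> tube Q" using q sub by blast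
        have "\<xi> q' ?F = 0" if "q' \<in> tube Q1" for q'
          using pf_apply[OF smooth_nearI[OF Q1(1)], of q' "\<xi> q'"] vertD(3)[OF \<xi>, of q'] that by simp
        then have "A q (\<lambda>q'. \<xi> q' ?F) = A q (\<lambda>q'. 0)"
          by (rule tangent_cong[OF manifold smooth_vf_tangent[OF A qQ] oT q])
        also have "\<dots> = 0" by (rule tangent_const[OF smooth_vf_tangent[OF A qQ]])
        finally have "A q (\<lambda>q'. \<xi> q' ?F) = 0" .
        then show "\<xi> q (\<lambda>q. A q ?F) = 0"
          using b[OF \<xi> qQ] lie_bracket_apply[OF smooth_nearI[OF F q], of \<xi> A] by simp
      qed
      then show ?thesis
        using True sect(3)[OF pB] by (simp add: desc_def pf_apply)
    qed (simp add: desc_def pf_not_smooth sect(3)[OF pB])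
  qed
  show "L (desc A) p = A p" if p: "p \<in> tube Q" for p
    using pf[OF p] lift_pf[OF _ h[OF p]] p by (simp add: L_def)
  show "smooth_vf N Q (desc A)"
    unfolding smooth_vf_def
  proof (intro conjI ballI allI impI oQ)
    fix q assume q: "q \<in> Q"
    then have qB: "q \<in> B" using Q(2) by blast
    show "desc A q \<in> TN q"
      using pf_tangent[OF sect(1)[OF qB] hor_tangent[OF h[OF sect_tube[OF Q(2) q]]]] sect(3)[OF qB]
      by (simp add: desc_def)
  next
    fix Q1 f assume f: "Q1 \<subseteq> Q \<and> smooth_fun N Q1 f"
    then have f1: "smooth_fun N Q1 f" and Q1: "Q1 \<subseteq> Q" "Q1 \<subseteq> B" using Q(2) by auto
    have "smooth_fun M (tube Q1) (\<lambda>q. A q (f \<circ> proj))"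
      by (rule smooth_vf_fun[OF A smooth_fun_pullback[OF f1]]) (use Q1 in auto)
    then have "smooth_fun N Q1 (\<lambda>q. A (sect q) (f \<circ> proj))"
      by (rule smooth_fun_section[OF _ smooth_funD[OF f1]])
    moreover have "desc A q f = A (sect q) (f \<circ> proj)" if q: "q \<in> Q1" for q
    proof -
      have "proj (sect q) = q" using sect(3) q Q1(2) by blast
      then show ?thesis using smooth_nearI[OF f1 q] by (simp add: desc_def pf_apply)
    qed
    ultimately show "smooth_fun N Q1 (\<lambda>q. desc A q f)"
      using smooth_fun_cong[OF smooth_manifold_euclidean[OF open_ball], of Q1 "\<lambda>q. desc A q f"
          "\<lambda>q. A (sect q) (f \<circ> proj)" 0 r] by simp
  qed
qed

text \<open>An extension of a single tangent vector to a vector field on the ball with constant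
  coefficients. It turns identities for lifted vector fields into identities for lifted
  vectors.\<close>

definition cfield :: "'f tvec \<Rightarrow> 'f vfield" where "cfield x q = D.cvec q (D.ccomp x)"

lemma oB: "openin (mtop N) B" by simp

lemma cfield_smooth: "smooth_vf N B (cfield x)"
  by (rule D.smooth_vf_cvec[OF order_refl oB, of "\<lambda>q. D.ccomp x"]) (auto simp: cfield_def intro:
      smooth_on_const)

lemma cfield_at: "q \<in> B \<Longrightarrow> x \<in> TN q \<Longrightarrow> cfield x q = x"
  using D.tangent_eq_cvec by (simp add: cfield_def)

lemma L_cfield: "p \<in> U \<Longrightarrow> x \<in> TN (proj p) \<Longrightarrow> L (cfield x) p = lift p x"
  by (simp add: L_def cfield_at[OF proj_in])

subsection \<open>The quotient Hermitian structure and its Bismut connection\<close>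

text \<open>The metric, like \<open>JN\<close> and \<open>nabN\<close> below, is evaluated on the
  central slice; invariance along the fibres makes the values at the other points of the fibre agree
  with this choice.\<close>

definition gN :: "'f metric_tensor" where
  "gN q x y = g (sect q) (lift (sect q) x) (lift (sect q) y)"

definition JN :: "'f endo_field" where "JN q x = pf (sect q) (J (sect q) (lift (sect q) x))"

definition nabN :: "'f conn" where "nabN X Y = desc (nab (L X) (L Y))"

text \<open>By the Killing property the derivative of the product along \<open>\<xi>\<close> only
  involves brackets of \<open>\<xi>\<close> with the lifts, and these vanish. So the product is
  constant along the fibres.\<close>

lemma gN_L:
  assumes X: "smooth_vf N Q X" and Y: "smooth_vf N Q Y" and p: "p \<in> tube Q"
  shows "g p (L X p) (L Y p) = gN (proj p) (X (proj p)) (Y (proj p))"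
proof -
  note oQ = smooth_vf_open[OF X]
  note LX = L_smooth[OF X] and LY = L_smooth[OF Y]
  let ?k = "\<lambda>p. g p (L X p) (L Y p)"
  have "?k p = ?k (sect (proj p))"
  proof (rule invariant_fun[OF g_smooth[OF LX LY] oQ _ p])
    fix \<xi> q assume \<xi>: "vert \<xi>" and q: "q \<in> tube Q"
    have qS: "q \<in> S" using q U_S by blast
    show "\<xi> q ?k = 0"
      using parallel_g[OF vertD(2)[OF \<xi> tube_open[OF oQ] Int_lower1] vertD(1)[OF \<xi>] LX LY q]
        br_vert_L[OF \<xi> X q] br_vert_L[OF \<xi> Y q]
      by (simp add: g_zero[OF qS smooth_vf_tangent[OF LY q]] g_zero_right[OF qS
          smooth_vf_tangent[OF LX q]])
  qed
  moreover have "proj (sect (proj p)) = proj p" using sect(3) proj_in p by blast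
  ultimately show ?thesis by (simp add: gN_def L_def)
qed

lemma gN_lift:
  assumes p: "p \<in> U" and x: "x \<in> TN (proj p)" and y: "y \<in> TN (proj p)"
  shows "g p (lift p x) (lift p y) = gN (proj p) x y"
  using gN_L[OF cfield_smooth[of x] cfield_smooth[of y], of p] p x y proj_in[OF p]
  by (simp add: L_cfield cfield_at)

lemma gN_hor: "p \<in> U \<Longrightarrow> hor p u \<Longrightarrow> hor p v \<Longrightarrow> gN (proj p) (pf p u) (pf p v) = g p u v"
  using gN_lift[of p "pf p u" "pf p v"] by (simp add: lift_pf pf_tangent hor_tangent)

lemma riemannian_metric_gN: "riemannian_metric N gN"
  unfolding riemannian_metric_def N_topspace
proof (intro conjI ballI allI impI)
  fix q assume q: "q \<in> B"
  note s = sect[OF q]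
  have sS: "sect q \<in> S" using s(1) U_S by blast
  note t = lift_tangent[OF s(1)]
  fix u v assume uv: "u \<in> TN q" "v \<in> TN q"
  show "gN q u v = gN q v u" using g_sym[OF sS t t] by (simp add: gN_def)
  show "gN q u u > 0" if "u \<noteq> 0"
  proof -
    have "lift (sect q) u \<noteq> 0" using pf_lift[OF s(1), of u] uv(1) that pushforward_zero s(3) by
        metis
    then show ?thesis using g_pos[OF sS t] by (simp add: gN_def)
  qed
  fix w a b assume w: "w \<in> TN q"
  show "gN q (tscale a u + tscale b v) w = a * gN q u w + b * gN q v w"
    using lift_lin[OF s(1), of u v a b] uv s(3) g_lin[OF sS t t t] by (simp add: gN_def)
next
  fix Q X Y assume "smooth_vf N Q X \<and> smooth_vf N Q Y"
  then have X: "smooth_vf N Q X" and Y: "smooth_vf N Q Y" by simp_all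
  note oQ = smooth_vf_open[OF X]
  have "smooth_fun N Q (\<lambda>q. g (sect q) (L X (sect q)) (L Y (sect q)))"
    by (rule smooth_fun_section[OF g_smooth[OF L_smooth[OF X] L_smooth[OF Y]] oQ])
  moreover have "g (sect q) (L X (sect q)) (L Y (sect q)) = gN q (X q) (Y q)" if "q \<in> Q" for q
  proof -
    have "q \<in> B" using that N_open[OF oQ] by blast
    then show ?thesis by (simp add: L_def gN_def sect(3))
  qed
  ultimately show "smooth_fun N Q (\<lambda>q. gN q (X q) (Y q))"
    using smooth_fun_cong[OF smooth_manifold_euclidean[OF open_ball], of Q
        "\<lambda>q. g (sect q) (L X (sect q)) (L Y (sect q))" "\<lambda>q. gN q (X q) (Y q)" 0 r] by simp
qed

lemma riemannian_submersion_proj: "riemannian_submersion M g U N gN proj"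
  unfolding riemannian_submersion_def
proof (intro conjI ballI smooth_map_proj)
  show "proj ` U = topspace (mtop N)"
    unfolding N_topspace
  proof (intro equalityI subsetI)
    fix q assume q: "q \<in> B"
    show "q \<in> proj ` U" by (rule image_eqI[of _ _ "sect q"]) (simp_all add: sect[OF q] del:
        mem_ball)
  qed (use proj_in in auto)
  fix p assume p: "p \<in> U"
  show "pf p ` TM p = TN (proj p)"
  proof (intro equalityI subsetI)
    fix x assume x: "x \<in> TN (proj p)"
    show "x \<in> pf p ` TM p"
      by (rule image_eqI[of _ _ "lift p x"]) (simp_all add: pf_lift[OF p x] lift_tangent[OF p])
  qed (use pf_tangent[OF p] in auto)
  fix v w assume "v \<in> horizontal_space M g N proj p" "w \<in> horizontal_space M g N proj p"
  then show "gN (proj p) (pf p v) (pf p w) = g p v w"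
    using gN_hor[OF p] by (simp add: horizontal_space_eq[OF p])
qed

lemma J_hor: assumes p: "p \<in> U" and h: "hor p v" shows "hor p (J p v)"
proof -
  have pS: "p \<in> S" and v: "v \<in> TM p" using p U_S h by (auto simp: hor_def)
  have "g p (J p v) (V p) = 0"
    using g_J_skew[OF pS v V_tangent[OF p]] h by (simp add: hor_def W_apply)
  moreover have "g p (J p v) (W p) = 0"
    using g_J[OF pS v V_tangent[OF p]] h by (simp add: hor_def W_apply)
  ultimately show ?thesis using J_tangent[OF pS v] by (simp add: hor_def)
qed

text \<open>\<open>J\<close> preserves horizontality because it preserves the metric and the
  vertical plane. As \<open>\<xi>\<close> preserves \<open>J\<close>, the field
  \<open>J (L X)\<close> commutes with \<open>\<xi>\<close> whenever \<open>L X\<close> does; so it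
  is again a lift.\<close>

lemma JN_L:
  assumes X: "smooth_vf N Q X"
  shows "smooth_vf N Q (endo_app JN X)" "\<And>p. p \<in> tube Q \<Longrightarrow> L (endo_app JN X) p = J p (L X p)"
proof -
  note oQ = smooth_vf_open[OF X]
  let ?A = "endo_app J (L X)"
  have A: "smooth_vf M (tube Q) ?A" by (rule J_smooth[OF L_smooth[OF X]])
  have h: "hor p (?A p)" if "p \<in> tube Q" for p
    using J_hor[OF _ L_hor] that by (simp add: endo_app_def)
  have b: "br \<xi> ?A p = 0" if "vert \<xi>" "p \<in> tube Q" for \<xi> p
    using vertD(6)[OF that(1) L_smooth[OF X] that(2)] br_vert_L[OF that(1) X that(2)] J_zero[of p]
        that(2) U_S by auto
  have d1: "smooth_vf N Q (desc ?A)"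
    by (rule desc(1)[OF A oQ], erule h, erule b, assumption)
  have d3: "L (desc ?A) p = ?A p" if "p \<in> tube Q" for p
    by (rule desc(3)[OF A oQ], erule h, erule b, assumption, rule that)
  have eq: "desc ?A q = endo_app JN X q" if "q \<in> Q" for q
  proof -
    have "q \<in> B" using that N_open[OF oQ] by blast
    then show ?thesis by (simp add: desc_def endo_app_def JN_def L_def sect(3))
  qed
  show "smooth_vf N Q (endo_app JN X)"
    using d1 smooth_vf_cong[OF smooth_manifold_euclidean[OF open_ball], of Q "desc ?A" "endo_app
        JN X" 0 r] eq by simp
  show "L (endo_app JN X) p = J p (L X p)" if p: "p \<in> tube Q" for p
  proof -
    have "L (endo_app JN X) p = L (desc ?A) p" using eq[of "proj p"] p by (simp add: L_def)
    then show ?thesis using d3[OF p] by (simp add: endo_app_def)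
  qed
qed

lemma J_lift:
  assumes p: "p \<in> U" and x: "x \<in> TN (proj p)"
  shows "J p (lift p x) = lift p (JN (proj p) x)"
  using JN_L(2)[OF cfield_smooth[of x], of p] p x proj_in[OF p]
  by (simp add: L_cfield) (simp add: L_def endo_app_def cfield_at)

lemma JN_tangent:
  assumes q: "q \<in> B" and x: "x \<in> TN q" shows "JN q x \<in> TN q"
proof -
  have "J (sect q) (lift (sect q) x) \<in> TM (sect q)"
    by (rule J_tangent) (use sect(1)[OF q] U_S lift_tangent in auto)
  from pf_tangent[OF sect(1)[OF q] this] show ?thesis using sect(3)[OF q] by (simp add: JN_def)
qed

text \<open>The case of horizontal vectors is \<open>J_lift\<close>. The general case follows since
  \<open>J\<close> maps the span of \<open>V\<close> and \<open>W\<close> into itself, so a vertical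
  part stays invisible on \<open>N\<close>. It is needed for brackets of lifts, which need not be
  horizontal.\<close>

lemma pf_J:
  assumes p: "p \<in> U" and v: "v \<in> TM p"
  shows "pf p (J p v) = JN (proj p) (pf p v)"
proof -
  have pS: "p \<in> S" using p U_S by blast
  note x = pf_tangent[OF p v]
  have d: "v - lift p (pf p v) \<in> TM p" by (rule tangent_minus[OF v lift_tangent[OF p]])
  have "pf p (v - lift p (pf p v)) = 0" using pf_lift[OF p x] by (simp add: pushforward_minus)
  then obtain a b where ab: "v - lift p (pf p v) = tscale a (V p) + tscale b (W p)" by (rule
      pf_zero[OF p d])
  have JW: "J p (W p) = - V p" using J_J[OF pS V_tangent[OF p]] by (simp add: W_apply)
  have "J p (v - lift p (pf p v)) = tscale a (W p) + tscale b (- V p)"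
    unfolding ab J_lin[OF pS V_tangent[OF p] W_tangent[OF p]] JW by (simp add: W_apply)
  then have "pf p (J p (v - lift p (pf p v))) = 0"
    by (simp add: pushforward_add pushforward_scale pushforward_uminus pf_V[OF p] pf_W[OF p])
  then have "pf p (J p v) = pf p (J p (lift p (pf p v)))"
    by (simp add: J_minus[OF pS v lift_tangent[OF p]] pushforward_minus)
  also have "\<dots> = JN (proj p) (pf p v)"
    unfolding J_lift[OF p x] by (rule pf_lift[OF p JN_tangent[OF proj_in[OF p] x]])
  finally show ?thesis .
qed

lemma integrable_JN: "integrable_complex_structure N JN"
  unfolding integrable_complex_structure_def almost_complex_structure_def N_topspace
proof (intro conjI ballI allI impI)
  fix q assume q: "q \<in> B"
  note s = sect[OF q]
  have sS: "sect q \<in> S" using s(1) U_S by blast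
  note t = lift_tangent[OF s(1)]
  fix u assume u: "u \<in> TN q"
  show "JN q u \<in> TN q" by (rule JN_tangent[OF q u])
  show "JN q (JN q u) = - u"
  proof -
    have "JN q (JN q u) = pf (sect q) (J (sect q) (J (sect q) (lift (sect q) u)))"
      using pf_J[OF s(1) J_tangent[OF sS t]] s(3) by (simp add: JN_def)
    also have "\<dots> = - pf (sect q) (lift (sect q) u)" by (simp add: J_J[OF sS t] pushforward_uminus)
    also have "\<dots> = - u" using pf_lift[OF s(1), of u] u s(3) by simp
    finally show ?thesis .
  qed
  fix v a b assume v: "v \<in> TN q"
  show "JN q (tscale a u + tscale b v) = tscale a (JN q u) + tscale b (JN q v)"
    using lift_lin[OF s(1), of u v a b] u v s(3)
    by (simp add: JN_def J_lin[OF sS t t] pushforward_add pushforward_scale)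
next
  show "smooth_vf N Q (endo_app JN X)" if "smooth_vf N Q X" for Q X by (rule JN_L(1)[OF that])
next
  fix Q X Y q assume "smooth_vf N Q X \<and> smooth_vf N Q Y" and q: "q \<in> Q"
  then have X: "smooth_vf N Q X" and Y: "smooth_vf N Q Y" by simp_all
  have Q: "Q \<subseteq> B" using N_open[OF smooth_vf_open[OF X]] by blast
  have qB: "q \<in> B" using q Q by blast
  let ?p = "sect q"
  have p: "?p \<in> tube Q" by (rule sect_tube[OF Q q])
  have pU: "?p \<in> U" using p by simp
  have pS: "?p \<in> S" using pU U_S by blast
  note LX = L_smooth[OF X] and LY = L_smooth[OF Y]
  note JX = J_smooth[OF LX] and JY = J_smooth[OF LY]
  note JNX = JN_L(1)[OF X] and JNY = JN_L(1)[OF Y]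
  have rJ: "pf p (endo_app J (L Z) p) = endo_app JN Z (proj p)" if "smooth_vf N Q Z" "p \<in> tube Q"
      for Z p
    using pf_L[OF JN_L(1)[OF that(1)] that(2)] JN_L(2)[OF that] by (simp add: endo_app_def)
  note b1 = pf_bracket[OF JX JY JNX JNY rJ[OF X] rJ[OF Y] p]
  note b2 = pf_bracket[OF JX LY JNX Y rJ[OF X] pf_L[OF Y] p]
  note b3 = pf_bracket[OF LX JY X JNY pf_L[OF X] rJ[OF Y] p]
  note b4 = pf_bracket[OF LX LY X Y pf_L[OF X] pf_L[OF Y] p]
  have t: "br A A' ?p \<in> TM ?p" if "smooth_vf M (tube Q) A" "smooth_vf M (tube Q) A'" for A A'
    by (rule smooth_vf_tangent[OF smooth_vf_lie_bracket[OF manifold that] p])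
  \<comment> \<open>All four brackets are taken between fields related to \<open>X\<close>,
    \<open>Y\<close> and their images under \<open>JN\<close>, so they project to the brackets on
    \<open>N\<close>. With \<open>pf_J\<close> the Nijenhuis tensor projects as well.\<close>
  have "pf ?p (nijenhuis M J (L X) (L Y) ?p) = nijenhuis N JN X Y q"
    using b1 b2 b3 b4
    by (simp add: nijenhuis_def endo_app_def[of J "br _ _"] endo_app_def[of JN "lie_bracket N _
        _"] pushforward_minus
        pf_J[OF pU t[OF JX LY]] pf_J[OF pU t[OF LX JY]] sect(3)[OF qB])
  then show "nijenhuis N JN X Y q = 0"
    using nijenhuis_zero[OF LX LY p] by (simp add: pushforward_zero)
qed

lemma hermitian_N: "hermitian_manifold N gN JN"
  unfolding hermitian_manifold_def N_topspace
proof (intro conjI ballI riemannian_metric_gN integrable_JN smooth_manifold_euclidean open_ball)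
  fix q u v assume q: "q \<in> B" and u: "u \<in> TN q" and v: "v \<in> TN q"
  note s = sect[OF q]
  have sS: "sect q \<in> S" using s(1) U_S by blast
  have "lift (sect q) (JN q x) = J (sect q) (lift (sect q) x)" if "x \<in> TN q" for x
    using J_lift[OF s(1), of x] s(3) that by simp
  then show "gN q (JN q u) (JN q v) = gN q u v"
    using g_J[OF sS lift_tangent[OF s(1)] lift_tangent[OF s(1)]] u v by (simp add: gN_def)
qed

lemma projects_to_JN: "projects_to M g J U N gN JN proj"
  unfolding projects_to_def
proof (intro ballI allI impI)
  fix p x y xb yb assume p: "p \<in> U" and x: "x \<in> TN (proj p)" and y: "y \<in> TN (proj p)"
    and "is_horizontal_lift M g N proj p x xb \<and> is_horizontal_lift M g N proj p y yb"
  then have "xb = lift p x" "yb = lift p y" using horizontal_lift_iff[OF p x]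
      horizontal_lift_iff[OF p y] by simp_all
  then show "g p (J p xb) yb = gN (proj p) (JN (proj p) x) y"
    using J_lift[OF p x] gN_lift[OF p JN_tangent[OF proj_in[OF p] x] y] by simp
qed

lemma nab_L_hor:
  assumes X: "smooth_vf N Q X" and Y: "smooth_vf N Q Y" and p: "p \<in> tube Q"
  shows "hor p (nab (L X) (L Y) p)"
proof (rule horI)
  note LX = L_smooth[OF X] and LY = L_smooth[OF Y]
  note oT = smooth_vf_open[OF LX]
  show "nab (L X) (L Y) p \<in> TM p" by (rule smooth_vf_tangent[OF nab_smooth[OF LX LY] p])
  fix \<xi> assume \<xi>: "vert \<xi>"
  note \<xi>s = vertD(2)[OF \<xi> oT Int_lower1]
  have "L X p (\<lambda>q. g q (L Y q) (\<xi> q)) = L X p (\<lambda>q. 0)"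
    by (rule tangent_cong[OF manifold smooth_vf_tangent[OF LX p] oT p]) (rule vertD(4)[OF \<xi>
        L_hor], simp)
  also have "\<dots> = 0" by (rule tangent_const[OF smooth_vf_tangent[OF LX p]])
  finally show "g p (nab (L X) (L Y) p) (\<xi> p) = 0"
    using metric_compat[OF LX LY \<xi>s p] nab_parallel[OF \<xi>s vertD(1)[OF \<xi>] LX p]
      g_zero_right[OF vf_point[OF LX p] smooth_vf_tangent[OF LY p]] by simp
qed

text \<open>This makes the connection descend. For every lift \<open>Z\<close> the product of the
  bracket with \<open>Z\<close> is the derivative along \<open>\<xi>\<close> of
  \<open>g(\<nabla>\<^sub>XY, Z)\<close>, because \<open>Z\<close> commutes with
  \<open>\<xi>\<close>; that derivative vanishes by \<open>parallel_nab_invariant\<close>. The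
  bracket is horizontal, so lifts suffice to test it.\<close>

lemma br_vert_nab_L:
  assumes \<xi>: "vert \<xi>" and X: "smooth_vf N Q X" and Y: "smooth_vf N Q Y" and p: "p \<in> tube Q"
  shows "br \<xi> (nab (L X) (L Y)) p = 0"
proof -
  note LX = L_smooth[OF X] and LY = L_smooth[OF Y]
  note oT = smooth_vf_open[OF LX] and oQ = smooth_vf_open[OF X]
  note \<xi>s = vertD(2)[OF \<xi> oT Int_lower1]
  let ?E = "nab (L X) (L Y)" and ?b = "br \<xi> (nab (L X) (L Y)) p"
  note E = nab_smooth[OF LX LY]
  have pU: "p \<in> U" and pS: "p \<in> S" using p U_S by auto
  have h: "hor p ?b" by (rule br_vert_hor[OF \<xi> E Int_lower1 nab_L_hor[OF X Y] p])
  \<comment> \<open>The test field is the lift of a field that extends the projection of the bracket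
    itself. At \<open>p\<close> this lift equals the bracket, whose squared length is therefore
    zero.\<close>
  have Z: "smooth_vf N Q (cfield (pf p ?b))"
    by (rule smooth_vf_subset[OF cfield_smooth oQ]) (use N_open[OF oQ] in blast)
  note LZ = L_smooth[OF Z]
  have o: "g q (L A q) (\<xi> q) = 0" if "q \<in> tube Q" for A q using vertD(4)[OF \<xi> L_hor] that by simp
  have "\<xi> p (\<lambda>q. g q (?E q) (L (cfield (pf p ?b)) q)) = 0"
    by (rule parallel_nab_invariant[OF \<xi>s vertD(1)[OF \<xi>] LX LY LZ br_vert_L[OF \<xi> X] br_vert_L[OF \<xi>
        Y] br_vert_L[OF \<xi> Z] o o o p])
  then have "g p ?b (L (cfield (pf p ?b)) p) = 0"
    using parallel_g[OF \<xi>s vertD(1)[OF \<xi>] E LZ p] br_vert_L[OF \<xi> Z p] g_zero_right[OF pS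
        smooth_vf_tangent[OF E p]] by simp
  moreover have "L (cfield (pf p ?b)) p = ?b"
    using L_cfield[OF pU pf_tangent[OF pU hor_tangent[OF h]]] lift_pf[OF pU h] by simp
  ultimately show ?thesis using g_self_zero[OF pS hor_tangent[OF h]] by simp
qed

lemma nabN:
  assumes X: "smooth_vf N Q X" and Y: "smooth_vf N Q Y"
  shows "smooth_vf N Q (nabN X Y)" "\<And>p. p \<in> tube Q \<Longrightarrow> pf p (nab (L X) (L Y) p) = nabN X Y (proj p)"
    "\<And>p. p \<in> tube Q \<Longrightarrow> L (nabN X Y) p = nab (L X) (L Y) p"
  unfolding nabN_def
  using desc[OF nab_smooth[OF L_smooth[OF X] L_smooth[OF Y]] smooth_vf_open[OF X] nab_L_hor[OF X
      Y] br_vert_nab_L[OF _ X Y]]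
  by blast+

lemma L_fun:
  assumes X: "smooth_vf N Q X" and p: "p \<in> tube Q" and f: "smooth_near N (proj p) f"
  shows "L X p (f \<circ> proj) = X (proj p) f"
  using pf_L[OF X p] pf_apply[OF f] by metis

lemma affine_connection_nabN: "affine_connection N nabN"
  unfolding affine_connection_def
proof (intro allI impI)
  fix Q X Y Z h assume "smooth_vf N Q X \<and> smooth_vf N Q Y \<and> smooth_vf N Q Z \<and> smooth_fun N Q h"
  then have X: "smooth_vf N Q X" and Y: "smooth_vf N Q Y" and Z: "smooth_vf N Q Z" and h:
      "smooth_fun N Q h" by simp_all
  note oQ = smooth_vf_open[OF X]
  note LX = L_smooth[OF X] and LY = L_smooth[OF Y] and LZ = L_smooth[OF Z]
  have hM: "smooth_fun M (tube Q) (h \<circ> proj)" by (rule smooth_fun_pullback[OF h])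
  have tX: "X' (proj p) \<in> TN (proj p)" if "smooth_vf N Q X'" "p \<in> tube Q" for X' p
    using smooth_vf_tangent[OF that(1)] that(2) by simp
  have Ladd: "(L A + L A') p = L (A + A') p" if "smooth_vf N Q A" "smooth_vf N Q A'" "p \<in> tube Q"
      for A A' p
    using lift_add[of p "A (proj p)" "A' (proj p)"] tX that by (simp add: L_def)
  have Lsc: "fscale (h \<circ> proj) (L A) p = L (fscale h A) p" if "smooth_vf N Q A" "p \<in> tube Q" for A p
    using lift_scale[of p "A (proj p)"] tX that by (simp add: L_def fscale_def)
  show "smooth_vf N Q (nabN X Y) \<and> (\<forall>q\<in>Q.
      nabN (X + Y) Z q = nabN X Z q + nabN Y Z q \<and>
      nabN (fscale h X) Y q = tscale (h q) (nabN X Y q) \<and>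
      nabN X (Y + Z) q = nabN X Y q + nabN X Z q \<and>
      nabN X (fscale h Y) q = tscale (X q h) (Y q) + tscale (h q) (nabN X Y q))"
  proof (intro conjI ballI)
    show "smooth_vf N Q (nabN X Y)" by (rule nabN(1)[OF X Y])
    fix q assume q: "q \<in> Q"
    have Q: "Q \<subseteq> B" using N_open[OF oQ] by blast
    let ?p = "sect q"
    have p: "?p \<in> tube Q" by (rule sect_tube[OF Q q])
    have pq: "proj ?p = q" using sect(3) q Q by blast
    have n: "nabN A A' q = pf ?p (nab (L A) (L A') ?p)" for A A' by (simp add: nabN_def desc_def)
    \<comment> \<open>The fields \<open>L (X + Y)\<close> and \<open>L X + L Y\<close> agree over
      the tube only, since outside of it the values of \<open>X\<close> and \<open>Y\<close> are
      arbitrary. By locality of the connection this is enough; the other three rules are treated in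
      the same way.\<close>
    have "nab (L (X + Y)) (L Z) ?p = nab (L X + L Y) (L Z) ?p"
      by (rule nab_cong[symmetric, OF smooth_vf_add[OF LX LY] LZ p Ladd[OF X Y]]) simp_all
    then show "nabN (X + Y) Z q = nabN X Z q + nabN Y Z q"
      using nab_add_left[OF LX LY LZ p] by (simp add: n pushforward_add)
    have "nab (L X) (L (Y + Z)) ?p = nab (L X) (L Y + L Z) ?p"
      by (rule nab_cong[symmetric, OF LX smooth_vf_add[OF LY LZ] p _ Ladd[OF Y Z]]) simp_all
    then show "nabN X (Y + Z) q = nabN X Y q + nabN X Z q"
      using nab_add_right[OF LX LY LZ p] by (simp add: n pushforward_add)
    have "nab (L (fscale h X)) (L Y) ?p = nab (fscale (h \<circ> proj) (L X)) (L Y) ?p"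
      by (rule nab_cong[symmetric, OF smooth_vf_fscale[OF LX hM] LY p Lsc[OF X]]) simp_all
    then show "nabN (fscale h X) Y q = tscale (h q) (nabN X Y q)"
      using nab_fscale_left[OF LX LY hM p] pq by (simp add: n pushforward_scale)
    have "nab (L X) (L (fscale h Y)) ?p = nab (L X) (fscale (h \<circ> proj) (L Y)) ?p"
      by (rule nab_cong[symmetric, OF LX smooth_vf_fscale[OF LY hM] p _ Lsc[OF Y]]) simp_all
    moreover have "smooth_near N (proj ?p) h" unfolding pq by (rule smooth_nearI[OF h q])
    ultimately show "nabN X (fscale h Y) q = tscale (X q h) (Y q) + tscale (h q) (nabN X Y q)"
      using nab_fscale_right[OF LX LY hM p] L_fun[OF X p, of h] pf_L[OF Y p] pq
      by (simp add: n pushforward_scale pushforward_add)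
  qed
qed

text \<open>The torsion vector of two lifts projects to the torsion vector on \<open>N\<close>. It
  may have a vertical part, coming from the bracket, but that part is orthogonal to the horizontal
  field \<open>L Z\<close>. The skew-symmetry on \<open>N\<close> is thus inherited from
  \<open>M\<close>.\<close>

lemma torsion_nabN:
  assumes X: "smooth_vf N Q X" and Y: "smooth_vf N Q Y" and Z: "smooth_vf N Q Z" and q: "q \<in> Q"
  shows "torsion_form N gN nabN [X, Y, Z] q = T (L X) (L Y) (L Z) (sect q)"
proof -
  note LX = L_smooth[OF X] and LY = L_smooth[OF Y] and LZ = L_smooth[OF Z]
  have Q: "Q \<subseteq> B" using N_open[OF smooth_vf_open[OF X]] by blast
  let ?p = "sect q"
  have p: "?p \<in> tube Q" by (rule sect_tube[OF Q q])
  have pU: "?p \<in> U" using p by simp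
  have pS: "?p \<in> S" using pU U_S by blast
  have pq: "proj ?p = q" using sect(3) q Q by blast
  let ?t = "torsion M nab (L X) (L Y) ?p"
  have t: "?t \<in> TM ?p"
    by (simp add: torsion_def tangent_minus smooth_vf_tangent[OF nab_smooth p]
        smooth_vf_tangent[OF smooth_vf_lie_bracket[OF manifold] p] LX LY)
  have pft: "pf ?p ?t = torsion N nabN X Y q"
    using nabN(2)[OF X Y p] nabN(2)[OF Y X p] pf_bracket[OF LX LY X Y pf_L[OF X] pf_L[OF Y] p] pq
    by (simp add: torsion_def pushforward_minus)
  have tN: "torsion N nabN X Y q \<in> TN (proj ?p)" unfolding pft[symmetric] by (rule pf_tangent[OF
      pU t])
  have "g ?p (L Z ?p) (?t - lift ?p (torsion N nabN X Y q)) = 0"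
    by (rule hor_vertical[OF pU L_hor[OF pU] tangent_minus[OF t lift_tangent[OF pU]]])
      (simp add: pushforward_minus pft pf_lift[OF pU tN])
  then have "g ?p (lift ?p (torsion N nabN X Y q)) (L Z ?p) = g ?p ?t (L Z ?p)"
    using g_minus_right[OF pS t lift_tangent[OF pU] smooth_vf_tangent[OF LZ p]]
      g_sym[OF pS t smooth_vf_tangent[OF LZ p]] g_sym[OF pS lift_tangent[OF pU]
          smooth_vf_tangent[OF LZ p]] by simp
  then show ?thesis by (simp add: torsion_form_def gN_def L_def pq)
qed

lemma bismut_nabN: "bismut_connection N gN JN nabN"
  unfolding bismut_connection_def
proof (intro conjI allI impI affine_connection_nabN ballI)
  fix Q X Y Z q assume "smooth_vf N Q X \<and> smooth_vf N Q Y \<and> smooth_vf N Q Z" and q: "q \<in> Q"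
  then have X: "smooth_vf N Q X" and Y: "smooth_vf N Q Y" and Z: "smooth_vf N Q Z" by simp_all
  note LX = L_smooth[OF X] and LY = L_smooth[OF Y] and LZ = L_smooth[OF Z]
  note oQ = smooth_vf_open[OF X]
  have Q: "Q \<subseteq> B" using N_open[OF oQ] by blast
  let ?p = "sect q"
  have p: "?p \<in> tube Q" by (rule sect_tube[OF Q q])
  have pU: "?p \<in> U" using p by simp
  have pq: "proj ?p = q" using sect(3) q Q by blast
  have oT: "openin (mtop M) (tube Q)" by (rule tube_open[OF oQ])
  let ?k = "\<lambda>q. gN q (Y q) (Z q)"
  have k: "smooth_near N (proj ?p) ?k"
    unfolding pq using riemannian_metric_gN Y Z q smooth_nearI[of N Q ?k q] by (simp add:
        riemannian_metric_def)
  have "X q ?k = L X ?p (?k \<circ> proj)" using L_fun[OF X p k] pq by simp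
  also have "\<dots> = L X ?p (\<lambda>p. g p (L Y p) (L Z p))"
    by (rule tangent_cong[OF manifold smooth_vf_tangent[OF LX p] oT p]) (simp add: gN_L[OF Y Z])
  also have "\<dots> = g ?p (L (nabN X Y) ?p) (L Z ?p) + g ?p (L Y ?p) (L (nabN X Z) ?p)"
    using metric_compat[OF LX LY LZ p] nabN(3)[OF X Y p] nabN(3)[OF X Z p] by simp
  also have "\<dots> = gN q (nabN X Y q) (Z q) + gN q (Y q) (nabN X Z q)"
    by (simp add: gN_def L_def pq)
  finally show "X q ?k = gN q (nabN X Y q) (Z q) + gN q (Y q) (nabN X Z q)" .
  have "nab (L X) (L (endo_app JN Y)) ?p = nab (L X) (endo_app J (L Y)) ?p"
    by (rule nab_cong[OF LX L_smooth[OF JN_L(1)[OF Y]] p]) (simp_all add: JN_L(2)[OF Y]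
        endo_app_def[of J])
  also have "\<dots> = J ?p (nab (L X) (L Y) ?p)" by (rule nab_J[OF LX LY p])
  finally show "nabN X (endo_app JN Y) q = JN q (nabN X Y q)"
    using pf_J[OF pU smooth_vf_tangent[OF nab_smooth[OF LX LY] p]] nabN(2)[OF X Y p]
      nabN(2)[OF X JN_L(1)[OF Y] p] pq by simp
  show "torsion_form N gN nabN [X, Y, Z] q = - torsion_form N gN nabN [Y, X, Z] q"
    "torsion_form N gN nabN [X, Y, Z] q = - torsion_form N gN nabN [X, Z, Y] q"
    using torsion_nabN[OF X Y Z q] torsion_nabN[OF Y X Z q] torsion_nabN[OF X Z Y q]
      T_antisym12[OF LX LY LZ p] T_antisym23[OF LX LY LZ p] by simp_all
qed

text \<open>Horizontal lifts are unique, so \<open>Xb\<close> and \<open>Yb\<close> coincide over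
  the tube with \<open>L X\<close> and \<open>L Y\<close>; their values elsewhere do not matter
  because the connection is local.\<close>

lemma nabN_horizontal_lift:
  assumes X: "smooth_vf N Q X" and Y: "smooth_vf N Q Y"
    and Xb: "is_horizontal_lift_vf M g U N proj Q X Xb" and Yb: "is_horizontal_lift_vf M g U N
        proj Q Y Yb"
    and p: "p \<in> tube Q"
  shows "nabN X Y (proj p) = pf p (nab Xb Yb p)"
proof -
  have eq: "L Z q = Zb q" if "smooth_vf N Q Z" "is_horizontal_lift_vf M g U N proj Q Z Zb" "q \<in>
      tube Q" for Z Zb q
    using that horizontal_lift_iff[of q "Z (proj q)" "Zb q"] smooth_vf_tangent[OF that(1), of
        "proj q"]
    by (auto simp: is_horizontal_lift_vf_def L_def)
  have "nab (L X) (L Y) p = nab Xb Yb p"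
    by (rule nab_cong[OF L_smooth[OF X] L_smooth[OF Y] p eq[OF X Xb] eq[OF Y Yb]])
  then show ?thesis using nabN(2)[OF X Y p] by simp
qed

end

section \<open>Flow boxes and their quotients around every point\<close>

theorem theorem3p4:
  fixes M :: "('a, 'e::euclidean_space) mfd"
    and g :: "'a metric_tensor" and J :: "'a endo_field"
    and nab :: "'a conn" and V :: "'a vfield"
  assumes bhe: "bhe M g J nab"
    and non_kaehler: "\<not> kaehler M g J"
    and V_smooth: "smooth_vf M (topspace (mtop M)) V"
    and V_nonvanishing: "\<forall>p \<in> topspace (mtop M). V p \<noteq> 0"
    and V_parallel: "parallel M nab V"
    and JV_parallel: "parallel M nab (endo_app J V)"
    and V_holomorphic: "\<forall>U X. smooth_vf M U X \<longrightarrow> (\<forall>p\<in>U. lie_deriv_endo M V J X p = 0)"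
    and JV_holomorphic:
      "\<forall>U X. smooth_vf M U X \<longrightarrow> (\<forall>p\<in>U. lie_deriv_endo M (endo_app J V) J X p = 0)"
    \<comment> \<open>This only names a model space \<open>'f\<close> for the quotient, whose dimension is forced.\<close>
    and dim_quotient: "DIM('f::euclidean_space) + 2 = DIM('e)"
  shows "\<forall>p0 \<in> topspace (mtop M). \<exists>U (N :: ('f, 'f) mfd) gN \<pi>.
      openin (mtop M) U \<and> p0 \<in> U \<and>
      smooth_manifold N \<and> riemannian_metric N gN \<and>
      riemannian_submersion M g U N gN \<pi> \<and>
      (\<forall>p\<in>U. vertical_space M N \<pi> p =
         {tscale a (V p) + tscale b (J p (V p)) | a b. True}) \<and>
      (\<exists>JN nabN.
         integrable_complex_structure N JN \<and>
         projects_to M g J U N gN JN \<pi> \<and>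
         hermitian_manifold N gN JN \<and>
         bismut_connection N gN JN nabN \<and>
         (\<forall>W X Y Xb Yb.
            smooth_vf N W X \<and> smooth_vf N W Y \<and>
            is_horizontal_lift_vf M g U N \<pi> W X Xb \<and>
            is_horizontal_lift_vf M g U N \<pi> W Y Yb \<longrightarrow>
            (\<forall>p \<in> U \<inter> \<pi> -` W. nabN X Y (\<pi> p) = pushforward N \<pi> p (nab Xb Yb p))))"
proof
  have skt: "skt M g J nab" using bhe by (simp add: bhe_def)
  interpret bismut_manifold M g J nab
    by unfold_locales (use skt in \<open>simp_all add: skt_def\<close>)
  let ?S = "topspace (mtop M)" and ?W = "endo_app J V"
  have W_smooth: "smooth_vf M ?S ?W" by (rule J_smooth[OF V_smooth])
  have comm: "lie_bracket M V ?W p = 0" if p: "p \<in> ?S" for p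
    using V_holomorphic V_smooth p
    by (auto simp: lie_deriv_endo_def lie_bracket_self endo_app_def J_zero dest!: spec[of _ ?S]
        spec[of _ V])
  fix p0 assume p0: "p0 \<in> ?S"
  \<comment> \<open>\<open>V\<close> and \<open>JV\<close> are orthogonal and of equal positive
    length, so pairing the relation with each of them isolates one coefficient.\<close>
  have indep: "a = 0 \<and> b = 0" if ab: "tscale a (V p0) + tscale b (?W p0) = 0" for a b
  proof -
    note V0 = smooth_vf_tangent[OF V_smooth p0] and W0 = smooth_vf_tangent[OF W_smooth p0]
    have pos: "g p0 (V p0) (V p0) > 0" using g_pos[OF p0 V0] V_nonvanishing p0 by blast
    have orth: "g p0 (?W p0) (V p0) = 0" "g p0 (V p0) (?W p0) = 0"
      using g_J_self[OF p0 V0] g_sym[OF p0 V0 W0] by (simp_all add: endo_app_def)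
    have "g p0 (?W p0) (?W p0) = g p0 (V p0) (V p0)"
      using g_J[OF p0 V0 V0] by (simp add: endo_app_def)
    moreover have "a * g p0 (V p0) (V p0) + b * g p0 (?W p0) (V p0) = 0"
      using g_lin[OF p0 V0 W0 V0, of a b] unfolding ab g_zero[OF p0 V0] by simp
    moreover have "a * g p0 (V p0) (?W p0) + b * g p0 (?W p0) (?W p0) = 0"
      using g_lin[OF p0 V0 W0 W0, of a b] unfolding ab g_zero[OF p0 W0] by simp
    ultimately show ?thesis using pos orth by auto
  qed
  obtain U and \<theta> :: "'a \<Rightarrow> (real \<times> real) \<times> 'f" and r where box: "r > 0" "smooth_chart M U \<theta>"
    "\<theta> ` U = ball 0 r \<times> ball 0 r" "p0 \<in> U"
    "\<And>p. p \<in> U \<Longrightarrow> V p = smooth_chart.cvec M U \<theta> p ((1, 0), 0)"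
    "\<And>p. p \<in> U \<Longrightarrow> ?W p = smooth_chart.cvec M U \<theta> p ((0, 1), 0)"
  proof (rule flow_box_chart[OF manifold p0 V_smooth W_smooth _ _ dim_quotient], goal_cases)
    case (1 p) show ?case by (rule comm[OF 1(2)])
  next
    case (2 a b) show ?case by (rule indep[OF 2(2)])
  next
    case (3 U \<theta> r) show ?case by (rule 3(1)[OF 3(2-7)])
  qed
  interpret F: bismut_flow_box M g J nab V U \<theta> r
  proof (intro bismut_flow_box.intro bismut_flow_box_axioms.intro bismut_manifold_axioms)
    show "V p \<noteq> 0" if "p \<in> ?S" for p using V_nonvanishing that by blast
    show "lie_deriv_endo M V J X p = 0" if "smooth_vf M A X" "p \<in> A" for A X p
      using V_holomorphic that by blast
    show "lie_deriv_endo M ?W J X p = 0" if "smooth_vf M A X" "p \<in> A" for A X p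
      using JV_holomorphic that by blast
  qed (fact V_smooth V_parallel JV_parallel box)+
  show "\<exists>U (N :: ('f, 'f) mfd) gN \<pi>.
      openin (mtop M) U \<and> p0 \<in> U \<and>
      smooth_manifold N \<and> riemannian_metric N gN \<and>
      riemannian_submersion M g U N gN \<pi> \<and>
      (\<forall>p\<in>U. vertical_space M N \<pi> p =
         {tscale a (V p) + tscale b (J p (V p)) | a b. True}) \<and>
      (\<exists>JN nabN.
         integrable_complex_structure N JN \<and>
         projects_to M g J U N gN JN \<pi> \<and>
         hermitian_manifold N gN JN \<and>
         bismut_connection N gN JN nabN \<and>
         (\<forall>W X Y Xb Yb.
            smooth_vf N W X \<and> smooth_vf N W Y \<and>
            is_horizontal_lift_vf M g U N \<pi> W X Xb \<and>
            is_horizontal_lift_vf M g U N \<pi> W Y Yb \<longrightarrow>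
            (\<forall>p \<in> U \<inter> \<pi> -` W. nabN X Y (\<pi> p) = pushforward N \<pi> p (nab Xb Yb p))))"
  proof (intro exI conjI allI impI ballI)
    show "openin (mtop M) U" by (rule F.C.open_dom)
    show "p0 \<in> U" by (rule box(4))
    show "smooth_manifold F.N" by (rule F.D.manifold)
    show "riemannian_metric F.N F.gN" by (rule F.riemannian_metric_gN)
    show "riemannian_submersion M g U F.N F.gN F.proj" by (rule F.riemannian_submersion_proj)
    show "vertical_space M F.N F.proj p = {tscale a (V p) + tscale b (J p (V p)) | a b. True}" if
        "p \<in> U" for p
      by (rule F.vertical_space_eq[OF that])
    show "integrable_complex_structure F.N F.JN" by (rule F.integrable_JN)
    show "projects_to M g J U F.N F.gN F.JN F.proj" by (rule F.projects_to_JN)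
    show "hermitian_manifold F.N F.gN F.JN" by (rule F.hermitian_N)
    show "bismut_connection F.N F.gN F.JN F.nabN" by (rule F.bismut_nabN)
    fix W X Y Xb Yb p
    assume "smooth_vf F.N W X \<and> smooth_vf F.N W Y \<and> is_horizontal_lift_vf M g U F.N F.proj W X Xb \<and>
        is_horizontal_lift_vf M g U F.N F.proj W Y Yb" and "p \<in> U \<inter> F.proj -` W"
    then show "F.nabN X Y (F.proj p) = pushforward F.N F.proj p (nab Xb Yb p)"
      using F.nabN_horizontal_lift[of W X Y Xb Yb p] by blast
  qed
qed

end
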